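(* For all integers $j,k\ge 0$: (1) for every spherical monogenic $M_k\in\mathcal M_k$, the function $\phi_{j,k}(x)=(\partial_x+x)^j\left(M_k(x)\exp(x^2/2)\right)$ satisfies $$\mathcal F^{\pm}_{m|2n}(\phi_{j,k})(y)=e^{\pm i(j+k)\frac{\pi}{2}}\,\phi_{j,k}(y);$$ (2) for every spherical harmonic $H_k\in\mathcal H_k$, the function $\psi_{j,k}(x)=(\partial_x+x)^{2j}\left(H_k(x)\exp(x^2/2)\right)$ satisfies $$\mathcal F^{\pm}_{m|2n}(\psi_{j,k})(y)=e^{\pm i(2j+k)\frac{\pi}{2}}\,\psi_{j,k}(y).$$
   Context: Let $m,n\ge 0$ be integers and $M=m-2n$. Let $x_1,\dots,x_m$ be commuting real variables and $\grave x_1,\dots,\grave x_{2n}$ anti-commuting variables, with $x_i\grave x_j=\grave x_jx_i$; $\Lambda_{2n}$ is the Grassmann algebra (complex coefficients) generated by the $\grave x_j$. $\mathcal C$ is the complex unital associative algebra generated by $e_1,\dots,e_m,\grave e_1,\dots,\grave e_{2n}$ with relations $e_je_k+e_ke_j=-2\delta_{jk}$, $\grave e_{2j}\grave e_{2k}-\grave e_{2k}\grave e_{2j}=0$, $\grave e_{2j-1}\grave e_{2k-1}-\grave e_{2k-1}\grave e_{2j-1}=0$, $\grave e_{2j-1}\grave e_{2k}-\grave e_{2k}\grave e_{2j-1}=\delta_{jk}$, $e_j\grave e_k+\grave e_ke_j=0$; all generators of $\mathcal C$ commute with all variables. A second set of variables $y_i,\grave y_j$ of the same type is used; all anti-commuting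 variables (from both sets) anti-commute with each other. $\partial_{\grave x_j}$ is the left derivative. $\mathcal S(\mathbb R^m)_{m|2n}=\mathcal S(\mathbb R^m)\otimes\Lambda_{2n}\otimes\mathcal C$, and $\mathcal P=\mathbb C[x_1,\dots,x_m]\otimes\Lambda_{2n}\otimes\mathcal C$. Vector variable: $x=\sum_{i=1}^m x_ie_i+\sum_{j=1}^{2n}\grave x_j\grave e_j$, so $x^2=\sum_{j=1}^n\grave x_{2j-1}\grave x_{2j}-\sum_{j=1}^m x_j^2$. Exponentials of even elements are defined by power series. Super Dirac operator: $\partial_x=2\sum_{j=1}^n(\grave e_{2j}\partial_{\grave x_{2j-1}}-\grave e_{2j-1}\partial_{\grave x_{2j}})-\sum_{j=1}^m e_j\partial_{x_j}$; super Laplace operator: $\Delta=\partial_x^2=4\sum_{j=1}^n\partial_{\grave x_{2j-1}}\partial_{\grave x_{2j}}-\sum_{j=1}^m\partial_{x_j}^2$. Euler operator: $\mathbb E=\sum_{j}x_j\partial_{x_j}+\sum_j\grave x_j\partial_{\grave x_j}$. $\mathcal H_k=\{H\in\mathcal P:\Delta H=0,\ \mathbb EH=kH\}$ (spherical harmonics of degree $k$) and $\mathcal M_k=\{P\in\mathcal P:\partial_xP=0,\ \mathbb EP=kP\}$ (spherical monogenics of degree $k$). Pairing: $\langle x,y\rangle=-\sum_{i=1}^m x_iy_i+\frac12\sum_{j=1}^n(\grave x_{2j-1}\grave y_{2j}-\grave x_{2j}\grave y_{2j-1})$. Berezin integral: $\int_{B,x}=\pi^{-n}\partial_{\grave x_{2n}}\cdots\partial_{\grave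 x_1}$. Super Fourier transform on $\mathcal S(\mathbb R^m)_{m|2n}$: $$\mathcal F^{\pm}_{m|2n}(f)(y)=(2\pi)^{-M/2}\int_{\mathbb R^m}dV(\underline x)\int_{B,x}\exp(\mp i\langle x,y\rangle)f(x).$$ Upper signs go with upper signs, lower with lower. *)

theory Defs
  imports
    "HOL-Analysis.Analysis"
    "HOL-Library.Function_Algebras"
    "HOL-Library.Poly_Mapping"
begin

section \<open>Grassmann algebra\<close>

text \<open>
  The complex Grassmann algebra on anti-commuting generators indexed by the natural numbers.
  An element is given by its coefficients with respect to the basis of ordered products
  \<open>theta\<^sub>A = theta a\<^sub>1 \<cdots> theta a\<^sub>r\<close>, where \<open>A = {a\<^sub>1 < \<dots> < a\<^sub>r}\<close> is a finite set of indices.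
  The algebra \<open>\<Lambda>\<close> on the generators with indices in \<open>J\<close> (\<open>J\<close> finite) consists of the elements
  whose coefficients vanish outside \<open>Pow J\<close>.
\<close>

typedef grassmann = "{f :: nat set \<Rightarrow> complex. \<forall>A. infinite A \<longrightarrow> f A = 0}"
  morphisms gcoeff Grassmann
  by (rule exI[of _ "\<lambda>_. 0"]) simp

setup_lifting type_definition_grassmann

definition gsign :: "nat set \<Rightarrow> nat set \<Rightarrow> complex" where
  "gsign B D = (- 1) ^ card {(b, d). b \<in> B \<and> d \<in> D \<and> d < b}"

lemma gsign_Un_left:
  assumes "finite B" "finite C" "finite D" "B \<inter> C = {}"
  shows "gsign (B \<union> C) D = gsign B D * gsign C D"
proof -
  let ?S = "\<lambda>B. {(b, d). b \<in> B \<and> d \<in> D \<and> d < b}"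
  have "finite (?S B)" "finite (?S C)"
    by (rule finite_subset[of _ "B \<times> D"] finite_subset[of _ "C \<times> D"]; use assms in auto)+
  moreover have "?S (B \<union> C) = ?S B \<union> ?S C" "?S B \<inter> ?S C = {}"
    using assms by auto
  ultimately show ?thesis
    unfolding gsign_def by (simp add: card_Un_disjoint power_add)
qed

lemma gsign_Un_right:
  assumes "finite B" "finite C" "finite D" "C \<inter> D = {}"
  shows "gsign B (C \<union> D) = gsign B C * gsign B D"
proof -
  let ?S = "\<lambda>D. {(b, d). b \<in> B \<and> d \<in> D \<and> d < b}"
  have "finite (?S C)" "finite (?S D)"
    by (rule finite_subset[of _ "B \<times> D"] finite_subset[of _ "B \<times> C"]; use assms in auto)+
  moreover have "?S (C \<union> D) = ?S C \<union> ?S D" "?S C \<inter> ?S D = {}"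
    using assms by auto
  ultimately show ?thesis
    unfolding gsign_def by (simp add: card_Un_disjoint power_add)
qed

lemma gsign_empty [simp]: "gsign {} B = 1" "gsign B {} = 1"
  by (simp_all add: gsign_def)

instantiation grassmann :: ring_1
begin

lift_definition zero_grassmann :: grassmann is "\<lambda>_. 0" by simp

lift_definition one_grassmann :: grassmann is "\<lambda>A. if A = {} then 1 else 0" by auto

lift_definition plus_grassmann :: "grassmann \<Rightarrow> grassmann \<Rightarrow> grassmann" is "\<lambda>f g A. f A + g A"
  by simp

lift_definition minus_grassmann :: "grassmann \<Rightarrow> grassmann \<Rightarrow> grassmann" is "\<lambda>f g A. f A - g A"
  by simp

lift_definition uminus_grassmann :: "grassmann \<Rightarrow> grassmann" is "\<lambda>f A. - f A"
  by simp

lift_definition times_grassmann :: "grassmann \<Rightarrow> grassmann \<Rightarrow> grassmann" is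
  "\<lambda>f g A. \<Sum>B\<in>Pow A. gsign B (A - B) * (f B * g (A - B))"
  by simp

instance
proof
  fix a b c :: grassmann
  show "a * b * c = a * (b * c)"
  proof transfer
    fix f g h :: "nat set \<Rightarrow> complex"
    show "(\<lambda>A. \<Sum>C\<in>Pow A. gsign C (A - C) *
             ((\<Sum>B\<in>Pow C. gsign B (C - B) * (f B * g (C - B))) * h (A - C))) =
          (\<lambda>A. \<Sum>B\<in>Pow A. gsign B (A - B) *
             (f B * (\<Sum>D\<in>Pow (A - B). gsign D (A - B - D) * (g D * h (A - B - D)))))"
      (is "?l = ?r")
    proof
      fix A :: "nat set"
      show "?l A = ?r A"
      proof (cases "finite A")
        case fin: True
        have "?l A = (\<Sum>(C, B)\<in>Sigma (Pow A) Pow.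
            gsign C (A - C) * gsign B (C - B) * (f B * g (C - B) * h (A - C)))"
          using fin by (subst sum.Sigma[symmetric])
            (auto simp: sum_distrib_left sum_distrib_right mult_ac intro: finite_subset)
        also have "\<dots> = (\<Sum>(B, D)\<in>Sigma (Pow A) (\<lambda>B. Pow (A - B)).
            gsign B (A - B) * gsign D (A - B - D) * (f B * g D * h (A - B - D)))"
        proof (rule sum.reindex_bij_witness
            [of _ "\<lambda>(B, D). (B \<union> D, B)" "\<lambda>(C, B). (B, C - B)"])
          fix p assume "p \<in> Sigma (Pow A) Pow"
          then obtain C B where p: "p = (C, B)" and CB: "C \<subseteq> A" "B \<subseteq> C" by auto
          have f: "finite C" "finite B" "finite (A - C)" "finite (C - B)"
            using CB fin by (auto intro: finite_subset)
          have *: "C = B \<union> (C - B)" "A - B = (C - B) \<union> (A - C)" "A - B - (C - B) = A - C"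
            using CB by auto
          have "gsign C (A - C) = gsign B (A - C) * gsign (C - B) (A - C)"
            using gsign_Un_left[of B "C - B" "A - C"] f *(1) by auto
          moreover have "gsign B (A - B) = gsign B (C - B) * gsign B (A - C)"
            using gsign_Un_right[of B "C - B" "A - C"] f *(2) by auto
          ultimately show
            "(case case p of (C, B) \<Rightarrow> (B, C - B) of (B, D) \<Rightarrow>
               gsign B (A - B) * gsign D (A - B - D) * (f B * g D * h (A - B - D))) =
             (case p of (C, B) \<Rightarrow>
               gsign C (A - C) * gsign B (C - B) * (f B * g (C - B) * h (A - C)))"
            unfolding p prod.case *(3) by simp
        qed auto
        also have "\<dots> = ?r A"
          using fin by (subst sum.Sigma[symmetric])
            (auto simp: sum_distrib_left sum_distrib_right mult_ac)
        finally show ?thesis .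
      qed simp
    qed
  qed
  show "1 * a = a"
  proof transfer
    fix f :: "nat set \<Rightarrow> complex" assume f: "\<forall>A. infinite A \<longrightarrow> f A = 0"
    show "(\<lambda>A. \<Sum>B\<in>Pow A. gsign B (A - B) * ((if B = {} then 1 else 0) * f (A - B))) = f"
    proof
      fix A :: "nat set"
      have "(\<Sum>B\<in>Pow A. gsign B (A - B) * ((if B = {} then 1 else 0) * f (A - B))) =
            (\<Sum>B\<in>Pow A. if B = {} then f A else 0)"
        by (rule sum.cong) auto
      then show "(\<Sum>B\<in>Pow A. gsign B (A - B) * ((if B = {} then 1 else 0) * f (A - B))) = f A"
        using f by (cases "finite A") auto
    qed
  qed
  show "a * 1 = a"
  proof transfer
    fix f :: "nat set \<Rightarrow> complex" assume f: "\<forall>A. infinite A \<longrightarrow> f A = 0"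
    show "(\<lambda>A. \<Sum>B\<in>Pow A. gsign B (A - B) * (f B * (if A - B = {} then 1 else 0))) = f"
    proof
      fix A :: "nat set"
      have "(\<Sum>B\<in>Pow A. gsign B (A - B) * (f B * (if A - B = {} then 1 else 0))) =
            (\<Sum>B\<in>Pow A. if B = A then f A else 0)"
        by (rule sum.cong) auto
      then show "(\<Sum>B\<in>Pow A. gsign B (A - B) * (f B * (if A - B = {} then 1 else 0))) = f A"
        using f by (cases "finite A") auto
    qed
  qed
  show "(a + b) * c = a * c + b * c"
    by transfer (simp add: algebra_simps sum.distrib fun_eq_iff)
  show "a * (b + c) = a * b + a * c"
    by transfer (simp add: algebra_simps sum.distrib fun_eq_iff)
  show "(0::grassmann) \<noteq> 1"
    by transfer (auto simp: fun_eq_iff)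
qed (transfer; simp add: fun_eq_iff)+

end

lift_definition gconst :: "complex \<Rightarrow> grassmann" is "\<lambda>c A. if A = {} then c else 0" by auto

lift_definition theta :: "nat \<Rightarrow> grassmann" is "\<lambda>j A. if A = {j} then 1 else 0" by auto

text \<open>Left derivative: move \<open>theta j\<close> to the front of \<open>theta\<^sub>A\<close>, then delete it.\<close>

lift_definition gderiv :: "nat \<Rightarrow> grassmann \<Rightarrow> grassmann" is
  "\<lambda>j f A. if j \<in> A then 0 else (- 1) ^ card {i\<in>A. i < j} * f (insert j A)"
  by auto

text \<open>The power series converges coefficientwise.\<close>

lift_definition gexp :: "grassmann \<Rightarrow> grassmann" is
  "\<lambda>s A. suminf (\<lambda>k. gcoeff (s ^ k) A / fact k)"
  using gcoeff by auto


section \<open>The algebra \<open>C\<close> and superfunctions\<close>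

text \<open>
  \<open>E j\<close> and \<open>G j\<close> are the orthogonal and the symplectic generators; the product of monomials
  in these non-commuting letters is written additively, as required by
  \<^typ>\<open>'a \<Rightarrow>\<^sub>0 'b\<close>, whose multiplication then is that of the monoid algebra.
\<close>

datatype gen = E nat | G nat

datatype monomial = Mon (letters: "gen list")

instantiation monomial :: monoid_add
begin

definition "0 = Mon []"

definition "u + v = Mon (letters u @ letters v)"

instance
  by standard (auto simp: zero_monomial_def plus_monomial_def)

end

text \<open>
  A point of \<open>\<real>\<^sup>m\<close> is a function \<open>x\<close> of which only the coordinates \<open>x 1, \<dots>, x m\<close> are used;
  in this way \<open>m = 0\<close> is included.  In a superfunction of \<open>x\<close> the generators \<open>theta 1, \<dots>, theta (2 * n)\<close>
  are the anti-commuting variables.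

  A \<open>superfun\<close> is an element of the tensor product of an algebra of scalar superfunctions with the
  free algebra on the letters.  The algebra \<open>C\<close> is the quotient of the free algebra by the
  two-sided ideal generated by the defining relations, so elements of the tensor product with \<open>C\<close>
  are represented by \<open>superfun\<close>s, and two of them are equal iff they are congruent (\<open>cong\<^sub>C\<close>) modulo
  the ideal generated by these relations.
\<close>

type_synonym scalar_superfun = "(nat \<Rightarrow> real) \<Rightarrow> grassmann"
type_synonym superfun = "monomial \<Rightarrow>\<^sub>0 scalar_superfun"

abbreviation scalar :: "scalar_superfun \<Rightarrow> superfun" where
  "scalar \<equiv> Poly_Mapping.single 0"

definition const :: "complex \<Rightarrow> superfun" where
  "const c = scalar (\<lambda>_. gconst c)"

definition e_orth :: "nat \<Rightarrow> superfun" where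
  "e_orth j = Poly_Mapping.single (Mon [E j]) 1"

definition e_symp :: "nat \<Rightarrow> superfun" where
  "e_symp j = Poly_Mapping.single (Mon [G j]) 1"

definition gens :: "nat \<Rightarrow> nat \<Rightarrow> gen set" where
  "gens m n = E ` {1..m} \<union> G ` {1..2*n}"

definition superfuns :: "nat \<Rightarrow> nat \<Rightarrow> superfun set" where
  "superfuns m n = {f. \<forall>w\<in>Poly_Mapping.keys f. set (letters w) \<subseteq> gens m n}"

inductive_set relations :: "nat \<Rightarrow> nat \<Rightarrow> superfun set" for m n where
  "j \<in> {1..m} \<Longrightarrow> k \<in> {1..m} \<Longrightarrow>
    e_orth j * e_orth k + e_orth k * e_orth j + (if j = k then 2 else 0) \<in> relations m n"
| "j \<in> {1..n} \<Longrightarrow> k \<in> {1..n} \<Longrightarrow>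
    e_symp (2*j) * e_symp (2*k) - e_symp (2*k) * e_symp (2*j) \<in> relations m n"
| "j \<in> {1..n} \<Longrightarrow> k \<in> {1..n} \<Longrightarrow>
    e_symp (2*j-1) * e_symp (2*k-1) - e_symp (2*k-1) * e_symp (2*j-1) \<in> relations m n"
| "j \<in> {1..n} \<Longrightarrow> k \<in> {1..n} \<Longrightarrow>
    e_symp (2*j-1) * e_symp (2*k) - e_symp (2*k) * e_symp (2*j-1) - (if j = k then 1 else 0) \<in> relations m n"
| "j \<in> {1..m} \<Longrightarrow> k \<in> {1..2*n} \<Longrightarrow> e_orth j * e_symp k + e_symp k * e_orth j \<in> relations m n"

inductive_set relation_ideal :: "nat \<Rightarrow> nat \<Rightarrow> superfun set" for m n where
  zero: "0 \<in> relation_ideal m n"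
| gen: "a \<in> superfuns m n \<Longrightarrow> r \<in> relations m n \<Longrightarrow> b \<in> superfuns m n \<Longrightarrow>
    a * r * b \<in> relation_ideal m n"
| add: "f \<in> relation_ideal m n \<Longrightarrow> g \<in> relation_ideal m n \<Longrightarrow> f + g \<in> relation_ideal m n"

definition cong\<^sub>C :: "nat \<Rightarrow> nat \<Rightarrow> superfun \<Rightarrow> superfun \<Rightarrow> bool" where
  "cong\<^sub>C m n f g \<longleftrightarrow> f - g \<in> relation_ideal m n"

text \<open>An operator \<open>T\<close> on scalar superfunctions (with \<open>T 0 = 0\<close>) acts on the first tensor factor.\<close>

definition lift_op :: "(scalar_superfun \<Rightarrow> scalar_superfun) \<Rightarrow> superfun \<Rightarrow> superfun" where
  "lift_op T f = Poly_Mapping.map T f"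


section \<open>Polynomials and differential operators\<close>

definition xv :: "nat \<Rightarrow> scalar_superfun" where
  "xv i = (\<lambda>x. gconst (of_real (x i)))"

definition xg :: "nat \<Rightarrow> scalar_superfun" where
  "xg j = (\<lambda>_. theta j)"

definition poly_funs :: "nat \<Rightarrow> ((nat \<Rightarrow> real) \<Rightarrow> complex) set" where
  "poly_funs m = {p. \<exists>S :: (nat \<Rightarrow> nat) set. \<exists>c. finite S \<and>
     p = (\<lambda>x. \<Sum>\<alpha>\<in>S. c \<alpha> * (\<Prod>i=1..m. complex_of_real (x i) ^ \<alpha> i))}"

definition superpolys :: "nat \<Rightarrow> nat \<Rightarrow> superfun set" where
  "superpolys m n = {f \<in> superfuns m n. \<forall>w A. (\<lambda>x. gcoeff (Poly_Mapping.lookup f w x) A) \<in>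
     (if A \<subseteq> {1..2*n} then poly_funs m else {0})}"

definition partial_x :: "nat \<Rightarrow> scalar_superfun \<Rightarrow> scalar_superfun" where
  "partial_x i g = (\<lambda>x. Grassmann (\<lambda>A.
     vector_derivative (\<lambda>t. gcoeff (g (x(i := t))) A) (at (x i))))"

definition partial_xg :: "nat \<Rightarrow> scalar_superfun \<Rightarrow> scalar_superfun" where
  "partial_xg j g = (\<lambda>x. gderiv j (g x))"

definition euler :: "nat \<Rightarrow> nat \<Rightarrow> superfun \<Rightarrow> superfun" where
  "euler m n f = (\<Sum>i=1..m. scalar (xv i) * lift_op (partial_x i) f) +
     (\<Sum>j=1..2*n. scalar (xg j) * lift_op (partial_xg j) f)"

definition dirac :: "nat \<Rightarrow> nat \<Rightarrow> superfun \<Rightarrow> superfun" where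
  "dirac m n f =
     2 * (\<Sum>j=1..n. e_symp (2*j) * lift_op (partial_xg (2*j-1)) f -
                     e_symp (2*j-1) * lift_op (partial_xg (2*j)) f) -
     (\<Sum>j=1..m. e_orth j * lift_op (partial_x j) f)"

definition laplace :: "nat \<Rightarrow> nat \<Rightarrow> superfun \<Rightarrow> superfun" where
  "laplace m n f = dirac m n (dirac m n f)"

definition harmonics :: "nat \<Rightarrow> nat \<Rightarrow> nat \<Rightarrow> superfun set" where
  "harmonics m n k = {H \<in> superpolys m n.
     cong\<^sub>C m n (laplace m n H) 0 \<and> cong\<^sub>C m n (euler m n H) (of_nat k * H)}"

definition monogenics :: "nat \<Rightarrow> nat \<Rightarrow> nat \<Rightarrow> superfun set" where
  "monogenics m n k = {P \<in> superpolys m n.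
     cong\<^sub>C m n (dirac m n P) 0 \<and> cong\<^sub>C m n (euler m n P) (of_nat k * P)}"


section \<open>Vector variable and Gaussian\<close>

definition super_vec :: "nat \<Rightarrow> nat \<Rightarrow> superfun" where
  "super_vec m n = (\<Sum>i=1..m. scalar (xv i) * e_orth i) + (\<Sum>j=1..2*n. scalar (xg j) * e_symp j)"

text \<open>The square of the vector variable, which is scalar in \<open>C\<close>; see \<open>super_vec_square\<close> below.\<close>

definition super_vec_sq :: "nat \<Rightarrow> nat \<Rightarrow> scalar_superfun" where
  "super_vec_sq m n = (\<Sum>j=1..n. xg (2*j-1) * xg (2*j)) - (\<Sum>j=1..m. xv j ^ 2)"

lemma relation_ideal_scalar:
  assumes "r \<in> relation_ideal m n"
  shows "scalar g * r \<in> relation_ideal m n"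
  using assms
proof induction
  case (gen a r b)
  have "scalar g * a \<in> superfuns m n"
  proof -
    have "Poly_Mapping.keys (scalar g * a) \<subseteq> Poly_Mapping.keys a"
    proof
      fix w assume "w \<in> Poly_Mapping.keys (scalar g * a)"
      then obtain u v where "w = u + v" "u \<in> Poly_Mapping.keys (scalar g)" "v \<in> Poly_Mapping.keys a"
        using Poly_Mapping.keys_mult[of "scalar g" a] by auto
      then show "w \<in> Poly_Mapping.keys a" by (cases "g = 0") auto
    qed
    then show ?thesis using gen unfolding superfuns_def by blast
  qed
  from relation_ideal.gen[OF this gen(2,3)] show ?case by (simp add: mult.assoc)
qed (auto simp: distrib_left intro: relation_ideal.intros)

lemma relation_ideal_relation: "r \<in> relations m n \<Longrightarrow> r \<in> relation_ideal m n"
  using relation_ideal.gen[of 1 m n r 1]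
  by (simp add: superfuns_def keys_one zero_monomial_def)

lemma relation_ideal_sum: "(\<And>i. i \<in> I \<Longrightarrow> f i \<in> relation_ideal m n) \<Longrightarrow> sum f I \<in> relation_ideal m n"
  by (induction I rule: infinite_finite_induct) (auto intro: relation_ideal.intros)

lemma scalar_sum: "scalar (sum f I) = (\<Sum>i\<in>I. scalar (f i))"
  by (induction I rule: infinite_finite_induct) (simp_all only: sum.infinite sum.empty sum.insert single_zero single_add not_False_eq_True)

lemma scalar_prod: "scalar f * scalar g = scalar (f * g)"
  by (simp add: mult_single)

lemma e_scalar: "e_orth i * scalar f = scalar f * e_orth i" "e_symp i * scalar f = scalar f * e_symp i"
  by (simp_all add: e_orth_def e_symp_def mult_single)

lemma ee_prod:
  "(scalar f * e_orth i) * (scalar g * e_orth j) = scalar (f * g) * (e_orth i * e_orth j)"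
  "(scalar f * e_orth i) * (scalar g * e_symp j) = scalar (f * g) * (e_orth i * e_symp j)"
  "(scalar f * e_symp i) * (scalar g * e_orth j) = scalar (f * g) * (e_symp i * e_orth j)"
  "(scalar f * e_symp i) * (scalar g * e_symp j) = scalar (f * g) * (e_symp i * e_symp j)"
  by (simp_all add: e_orth_def e_symp_def mult_single)

lemma gconst_mult: "gconst a * gconst b = gconst (a * b)"
proof (rule gcoeff_inject[THEN iffD1], rule ext)
  fix A
  have "(\<Sum>B\<in>Pow A. gsign B (A - B) * ((if B = {} then a else 0) * (if A - B = {} then b else 0))) =
     (\<Sum>B\<in>Pow A. if B = {} then (if A = {} then a * b else 0) else 0)"
    by (rule sum.cong) auto
  then show "gcoeff (gconst a * gconst b) A = gcoeff (gconst (a * b)) A"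
    by (cases "finite A"; cases "A = {}") (auto simp: times_grassmann.rep_eq gconst.rep_eq)
qed

lemma gconst_theta: "gconst a * theta j = theta j * gconst a"
proof (rule gcoeff_inject[THEN iffD1], rule ext)
  fix A
  have "(\<Sum>B\<in>Pow A. gsign B (A - B) * ((if B = {} then a else 0) * (if A - B = {j} then 1 else 0))) =
     (\<Sum>B\<in>Pow A. if B = {} then (if A = {j} then a else 0) else 0)"
    by (rule sum.cong) auto
  moreover have "(\<Sum>B\<in>Pow A. gsign B (A - B) * ((if B = {j} then 1 else 0) * (if A - B = {} then a else 0))) =
     (\<Sum>B\<in>Pow A. if B = A then (if A = {j} then a else 0) else 0)"
    by (rule sum.cong) auto
  ultimately show "gcoeff (gconst a * theta j) A = gcoeff (theta j * gconst a) A"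
    unfolding times_grassmann.rep_eq gconst.rep_eq theta.rep_eq
    by (cases "finite A") (simp_all only: sum.delta finite_Pow_iff, auto)
qed

lemma theta_anti: "theta i * theta j = - (theta j * theta i)"
proof (rule gcoeff_inject[THEN iffD1], rule ext)
  fix A
  have *: "gcoeff (theta i * theta j) A = (if A = {i, j} \<and> i \<noteq> j then gsign {i} {j} else 0)" for i j
  proof -
    have "(\<Sum>B\<in>Pow A. gsign B (A - B) * ((if B = {i} then 1 else 0) * (if A - B = {j} then 1 else 0))) =
     (\<Sum>B\<in>Pow A. if B = {i} then (if A = {i, j} \<and> i \<noteq> j then gsign {i} {j} else 0) else 0)"
    proof (rule sum.cong, goal_cases)
      case (2 B)
      show ?case
      proof (cases "A = {i, j} \<and> i \<noteq> j")
        case True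
        then have "A - {i} = {j}" by auto
        then show ?thesis using True by auto
      next
        case False
        have "\<not> (B = {i} \<and> A - B = {j})" using False 2 by auto
        then show ?thesis using False by auto
      qed
    qed simp
    then show ?thesis
      by (cases "finite A") (auto simp: times_grassmann.rep_eq theta.rep_eq)
  qed
  have "gsign {i} {j} = - gsign {j} {i}" if "i \<noteq> j"
  proof -
    have S: "{(b, d). b \<in> {i} \<and> d \<in> {j} \<and> d < b} = (if j < i then {(i,j)} else {})" for i j :: nat by auto
    show ?thesis using that unfolding gsign_def S by auto
  qed
  then show "gcoeff (theta i * theta j) A = gcoeff (- (theta j * theta i)) A"
    by (auto simp: * uminus_grassmann.rep_eq insert_commute)
qed

lemma xv_comm: "xv i * xv j = xv j * xv i" "xv i * xg j = xg j * xv i" "xg i * xg j = - (xg j * xg i)"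
  using theta_anti[of i j]
  by (simp_all add: xv_def xg_def fun_eq_iff gconst_mult gconst_theta mult.commute)

lemma half_ideal: assumes "f + f \<in> relation_ideal m n" shows "f \<in> relation_ideal m n"
proof -
  have "const (1/2) + const (1/2) = 1"
  proof -
    have "gconst (1/2) + gconst (1/2) = 1"
      by (rule gcoeff_inject[THEN iffD1], rule ext)
        (simp add: plus_grassmann.rep_eq gconst.rep_eq one_grassmann.rep_eq)
    then have "(\<lambda>_. gconst (1/2)) + (\<lambda>_. gconst (1/2)) = (1 :: scalar_superfun)"
      by (simp add: fun_eq_iff)
    then show ?thesis unfolding const_def by (metis single_add single_one)
  qed
  then have "const (1/2) * (f + f) = f"
    by (metis distrib_left distrib_right mult_1)
  then show ?thesis using relation_ideal_scalar[OF assms] unfolding const_def by metis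
qed

lemma sum_parity: "(\<Sum>j=1..2*n. g j) = (\<Sum>j=1..n. g (2*j-1) + g (2*j))" for g :: "nat \<Rightarrow> 'a::ab_group_add"
  by (induction n) (simp_all add: algebra_simps)

lemma double_sum_square: "(\<Sum>i\<in>I. X i) * (\<Sum>i\<in>I. X i) + (\<Sum>i\<in>I. X i) * (\<Sum>i\<in>I. X i) = (\<Sum>i\<in>I. \<Sum>j\<in>I. X i * X j + X j * X i)"
  for X :: "nat \<Rightarrow> 'a::ring"
  apply (simp add: sum_product sum.distrib)
  apply (subst (2) sum.swap) 
  by simp

lemma ideal_diff: "f \<in> relation_ideal m n \<Longrightarrow> g \<in> relation_ideal m n \<Longrightarrow> f - g \<in> relation_ideal m n"
  using relation_ideal.add[of f m n "scalar (-1) * g"] relation_ideal_scalar[of g m n "-1"]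
  by (simp add: single_uminus)

lemma super_vec_square: "cong\<^sub>C m n (super_vec m n * super_vec m n) (scalar (super_vec_sq m n))"
proof -
  let ?I = "relation_ideal m n"
  define X where "X i = scalar (xv i) * e_orth i" for i
  define Y where "Y j = scalar (xg j) * e_symp j" for j
  define U where "U = (\<Sum>i=1..m. X i)"
  define A where "A = (\<Sum>j=1..n. Y (2*j-1))"
  define B where "B = (\<Sum>j=1..n. Y (2*j))"
  define V where "V = (\<Sum>j=1..2*n. Y j)"
  have V: "V = A + B" unfolding V_def A_def B_def sum_parity sum.distrib ..
  have "(U * U + scalar (\<Sum>i=1..m. xv i ^ 2)) + (U * U + scalar (\<Sum>i=1..m. xv i ^ 2)) \<in> ?I"
  proof -
    have "(U * U + scalar (\<Sum>i=1..m. xv i ^ 2)) + (U * U + scalar (\<Sum>i=1..m. xv i ^ 2)) =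
      (U * U + U * U) + (\<Sum>i=1..m. scalar (xv i ^ 2) * 2)"
      by (simp add: sum.distrib scalar_sum mult_2_right)
    also have "\<dots> = (\<Sum>i=1..m. \<Sum>j=1..m. scalar (xv i * xv j) * (e_orth i * e_orth j + e_orth j * e_orth i + (if i = j then 2 else 0)))"
      unfolding U_def double_sum_square
    proof (subst sum.distrib[symmetric], rule sum.cong)
      fix i assume i: "i \<in> {1..m}"
      have "scalar (xv i ^ 2) * 2 = (\<Sum>j=1..m. scalar (xv i * xv j) * (if i = j then 2 else 0))"
        using i by (simp add: if_distrib[of "(*) _"] power2_eq_square cong: if_cong)
      then show "(\<Sum>j=1..m. X i * X j + X j * X i) + scalar (xv i ^ 2) * 2 = (\<Sum>j=1..m. scalar (xv i * xv j) * (e_orth i * e_orth j + e_orth j * e_orth i + (if i = j then 2 else 0)))"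
        unfolding X_def ee_prod by (simp add: sum.distrib distrib_left xv_comm(1)[of _ i])
    qed simp
    also have "\<dots> \<in> ?I"
      by (intro relation_ideal_sum relation_ideal_scalar relation_ideal_relation relations.intros)
    finally show ?thesis .
  qed
  then have 1: "U * U + scalar (\<Sum>i=1..m. xv i ^ 2) \<in> ?I" by (rule half_ideal)
  have 2: "U * V + V * U \<in> ?I"
  proof -
    have "U * V + V * U = (\<Sum>i=1..m. \<Sum>j=1..2*n. X i * Y j) + (\<Sum>i=1..m. \<Sum>j=1..2*n. Y j * X i)"
      unfolding U_def V_def sum_product by (subst (4) sum.swap) simp
    also have "\<dots> = (\<Sum>i=1..m. \<Sum>j=1..2*n. X i * Y j + Y j * X i)"
      by (simp add: sum.distrib)
    also have "\<dots> = (\<Sum>i=1..m. \<Sum>j=1..2*n. scalar (xv i * xg j) * (e_orth i * e_symp j + e_symp j * e_orth i))"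
      unfolding X_def Y_def ee_prod by (simp add: distrib_left xv_comm(2))
    also have "\<dots> \<in> ?I"
      by (intro relation_ideal_sum relation_ideal_scalar relation_ideal_relation relations.intros)
    finally show ?thesis .
  qed
  have YY: "Y i * Y j + Y j * Y i = scalar (xg i * xg j) * (e_symp i * e_symp j - e_symp j * e_symp i)" for i j
    unfolding Y_def ee_prod xv_comm(3)[of j i] by (simp add: single_uminus algebra_simps)
  have 3: "A * A \<in> ?I"
    by (rule half_ideal) (unfold A_def double_sum_square YY,
      intro relation_ideal_sum relation_ideal_scalar relation_ideal_relation relations.intros)
  have 4: "B * B \<in> ?I"
    by (rule half_ideal) (unfold B_def double_sum_square YY,
      intro relation_ideal_sum relation_ideal_scalar relation_ideal_relation relations.intros)
  have 5: "A * B + B * A - scalar (\<Sum>j=1..n. xg (2*j-1) * xg (2*j)) \<in> ?I"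
  proof -
    have "A * B + B * A = (\<Sum>j=1..n. \<Sum>k=1..n. Y (2*j-1) * Y (2*k)) + (\<Sum>j=1..n. \<Sum>k=1..n. Y (2*k) * Y (2*j-1))"
      unfolding A_def B_def sum_product by (subst (4) sum.swap) simp
    also have "\<dots> = (\<Sum>j=1..n. \<Sum>k=1..n. Y (2*j-1) * Y (2*k) + Y (2*k) * Y (2*j-1))"
      by (simp add: sum.distrib)
    finally have "A * B + B * A - scalar (\<Sum>j=1..n. xg (2*j-1) * xg (2*j)) =
      (\<Sum>j=1..n. (\<Sum>k=1..n. Y (2*j-1) * Y (2*k) + Y (2*k) * Y (2*j-1)) - scalar (xg (2*j-1) * xg (2*j)))"
      by (simp add: scalar_sum sum_subtractf)
    also have "\<dots> = (\<Sum>j=1..n. \<Sum>k=1..n. scalar (xg (2*j-1) * xg (2*k)) *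
       (e_symp (2*j-1) * e_symp (2*k) - e_symp (2*k) * e_symp (2*j-1) - (if j = k then 1 else 0)))"
    proof (rule sum.cong)
      fix j assume j: "j \<in> {1..n}"
      have "scalar (xg (2*j-1) * xg (2*j)) = (\<Sum>k=1..n. scalar (xg (2*j-1) * xg (2*k)) * (if j = k then 1 else 0))"
        using j by (simp add: if_distrib[of "(*) _"] cong: if_cong)
      then show "(\<Sum>k=1..n. Y (2*j-1) * Y (2*k) + Y (2*k) * Y (2*j-1)) - scalar (xg (2*j-1) * xg (2*j)) = (\<Sum>k=1..n. scalar (xg (2*j-1) * xg (2*k)) *
       (e_symp (2*j-1) * e_symp (2*k) - e_symp (2*k) * e_symp (2*j-1) - (if j = k then 1 else 0)))"
        unfolding YY by (simp add: right_diff_distrib sum_subtractf)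
    qed simp
    also have "\<dots> \<in> ?I"
      by (intro relation_ideal_sum relation_ideal_scalar relation_ideal_relation relations.intros)
    finally show ?thesis .
  qed
  have "super_vec m n * super_vec m n - scalar (super_vec_sq m n) =
     (U * U + scalar (\<Sum>i=1..m. xv i ^ 2)) + (U * V + V * U) + A * A + B * B +
     (A * B + B * A - scalar (\<Sum>j=1..n. xg (2*j-1) * xg (2*j)))"
  proof -
    have "super_vec m n = U + V" by (simp add: super_vec_def U_def V_def X_def Y_def)
    then show ?thesis by (simp add: V super_vec_sq_def single_diff algebra_simps)
  qed
  also have "\<dots> \<in> ?I" by (intro relation_ideal.add[OF relation_ideal.add[OF relation_ideal.add[OF relation_ideal.add]]] 1 2 3 4 5)
  finally show ?thesis unfolding cong\<^sub>C_def .
qed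

definition gaussian :: "nat \<Rightarrow> nat \<Rightarrow> superfun" where
  "gaussian m n = scalar (\<lambda>x. gexp (gconst (1/2) * super_vec_sq m n x))"


section \<open>Super Fourier transform\<close>

text \<open>
  In the kernel both sets of variables occur; the anti-commuting variables of the second set are
  the generators \<open>theta (2*n+1), \<dots>, theta (2*n+2*n)\<close>.  The result of the Berezin integral is an element of
  the Grassmann algebra on the second set, which \<open>super_fourier\<^sub>0\<close> renames back to
  \<open>theta 1, \<dots>, theta (2*n)\<close>.  This is order preserving, hence does not change signs.
\<close>

definition pairing :: "nat \<Rightarrow> nat \<Rightarrow> (nat \<Rightarrow> real) \<Rightarrow> (nat \<Rightarrow> real) \<Rightarrow> grassmann" where
  "pairing m n x y = - (\<Sum>i=1..m. gconst (of_real (x i * y i))) +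
     gconst (1/2) * (\<Sum>j=1..n. theta (2*j-1) * theta (2*n + 2*j) - theta (2*j) * theta (2*n + (2*j-1)))"

text \<open>\<open>fold\<close> applies \<open>gderiv 1\<close> first and \<open>gderiv (2*n)\<close> last.\<close>

definition berezin :: "nat \<Rightarrow> grassmann \<Rightarrow> grassmann" where
  "berezin n g = gconst (of_real (1 / pi ^ n)) * fold gderiv [1..<2*n+1] g"

text \<open>
  \<open>\<sigma>\<close> is \<open>1\<close> for the upper and \<open>-1\<close> for the lower sign.  The integral over \<open>\<real>\<^sup>m\<close> is
  the Lebesgue integral of each coefficient; for Schwartz functions it always exists.
\<close>

definition super_fourier\<^sub>0 :: "real \<Rightarrow> nat \<Rightarrow> nat \<Rightarrow> scalar_superfun \<Rightarrow> scalar_superfun" where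
  "super_fourier\<^sub>0 \<sigma> m n f = (\<lambda>y. Grassmann (\<lambda>A. if A \<subseteq> {1..2*n} then
     of_real ((2 * pi) powr (- (real m - 2 * real n) / 2)) *
       (LINT x|PiM {1..m} (\<lambda>_. lborel).
          gcoeff (berezin n (gexp (gconst (- of_real \<sigma> * \<i>) * pairing m n x y) * f x))
            ((\<lambda>j. 2*n + j) ` A))
     else 0))"

definition super_fourier :: "real \<Rightarrow> nat \<Rightarrow> nat \<Rightarrow> superfun \<Rightarrow> superfun" where
  "super_fourier \<sigma> m n = lift_op (super_fourier\<^sub>0 \<sigma> m n)"

definition dirac_plus_vec :: "nat \<Rightarrow> nat \<Rightarrow> superfun \<Rightarrow> superfun" where
  "dirac_plus_vec m n f = dirac m n f + super_vec m n * f"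

definition phi_fun :: "nat \<Rightarrow> nat \<Rightarrow> nat \<Rightarrow> superfun \<Rightarrow> superfun" where
  "phi_fun m n j P = (dirac_plus_vec m n ^^ j) (P * gaussian m n)"

definition psi_fun :: "nat \<Rightarrow> nat \<Rightarrow> nat \<Rightarrow> superfun \<Rightarrow> superfun" where
  "psi_fun m n j H = (dirac_plus_vec m n ^^ (2 * j)) (H * gaussian m n)"

end

(* The Dirac operator plus the vector variable is the sum, over the generators e_l of C, of e_l times
   a raising operator r_l of a super harmonic oscillator.  The Fourier transform intertwines each r_l with
   itself up to the factor s*i (s = 1 or -1), and it fixes the Gaussian; so the products of d raising operators
   applied to the Gaussian are eigenfunctions with eigenvalue (s*i)^d.  They span all polynomials
   times the Gaussian and are also eigenfunctions of the number operator, which on the polynomial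
   factor is a combination of the Euler and Laplace operators.  A spherical harmonic of degree k is an
   eigenvector of that combination, so times the Gaussian it lies in the span of the products of
   k raising operators.  The remaining factors of the Dirac operator plus vector variable only multiply the
   eigenvalue by s*i each.

   For superfunctions with values in C one pairs with functionals on C: an element of the tensor
   product with the free algebra lies in the relation ideal iff it is killed by every functional on
   the free algebra that vanishes on the two-sided ideal generated by the relations. *)
theory Submission
  imports Defs "HOL-Probability.Probability" "HOL-Real_Asymp.Real_Asymp"
begin

section \<open>Grassmann calculus\<close>

text \<open>The equations for harmonics and monogenics hold only modulo the relations of C, so the
  coefficients of H in the free algebra need not be harmonic. A functional that annihilates the
  ideal turns H into a scalar superpolynomial for which both equations are exact. There are enough
  functionals because the relations have constant coefficients: the ideal consists of combinations,
  over scalar superfunctions, of constant elements, which form a complex subspace of the free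
  algebra; the coordinates of a projection with this subspace as kernel are the functionals needed.

  The fermionic transform of the Gaussian is found without evaluating a Berezin integral. The
  Gaussian is determined up to a factor by the equations \<open>ddg l g = theta l * g\<close>, which
  the transform respects, and the factor is 1 because the \<open>2 ^ n\<close> left by the
  normalisation meets the top coefficient \<open>(1/2) ^ n\<close>.\<close>

lemma sum_fun_apply: "(\<Sum>i\<in>I. f i) x = (\<Sum>i\<in>I. f i x)"
  by (induction I rule: infinite_finite_induct) simp_all

lemma grassmann_eqI: "(\<And>A. gcoeff a A = gcoeff b A) \<Longrightarrow> a = b"
  using gcoeff_inject by blast

lemma gcoeff_infinite: "infinite A \<Longrightarrow> gcoeff a A = 0"
  using gcoeff[of a] by blast

lemma gcoeff_Grassmann: "(\<And>A. infinite A \<Longrightarrow> f A = 0) \<Longrightarrow> gcoeff (Grassmann f) A = f A"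
  by (subst Grassmann_inverse) auto

lemmas gcoeff_linear [simp] = zero_grassmann.rep_eq plus_grassmann.rep_eq minus_grassmann.rep_eq
  uminus_grassmann.rep_eq

lemma gcoeff_sum: "gcoeff (\<Sum>i\<in>I. f i) A = (\<Sum>i\<in>I. gcoeff (f i) A)"
  by (induction I rule: infinite_finite_induct) simp_all

lemma gcoeff_one: "gcoeff 1 A = (if A = {} then 1 else 0)"
  by (simp add: one_grassmann.rep_eq)

lemma gcoeff_gconst_mult [simp]: "gcoeff (gconst c * a) A = c * gcoeff a A"
proof (cases "finite A")
  case True
  have "(\<Sum>B\<in>Pow A. gsign B (A - B) * ((if B = {} then c else 0) * gcoeff a (A - B))) =
        (\<Sum>B\<in>Pow A. if B = {} then c * gcoeff a A else 0)"
    by (rule sum.cong) auto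
  then show ?thesis using True by (simp add: times_grassmann.rep_eq gconst.rep_eq)
qed (simp add: gcoeff_infinite)

lemma gcoeff_mult_gconst [simp]: "gcoeff (a * gconst c) A = c * gcoeff a A"
proof (cases "finite A")
  case True
  have "(\<Sum>B\<in>Pow A. gsign B (A - B) * (gcoeff a B * (if A - B = {} then c else 0))) =
        (\<Sum>B\<in>Pow A. if B = A then c * gcoeff a A else 0)"
    by (rule sum.cong) auto
  then show ?thesis using True by (simp add: times_grassmann.rep_eq gconst.rep_eq)
qed (simp add: gcoeff_infinite)

lemma gconst_commute: "a * gconst c = gconst c * a"
  by (rule grassmann_eqI) simp

lemma gconst_left_commute: "a * (gconst c * b) = gconst c * (a * b)"
  by (metis gconst_commute mult.assoc)

lemma gconst_0 [simp]: "gconst 0 = 0" and gconst_1 [simp]: "gconst 1 = 1"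
  by (rule grassmann_eqI, simp add: gconst.rep_eq gcoeff_one)+

lemma gconst_add: "gconst (a + b) = gconst a + gconst b"
  by (rule grassmann_eqI) (simp add: gconst.rep_eq)

lemma gconst_uminus: "gconst (- a) = - gconst a"
  by (rule grassmann_eqI) (simp add: gconst.rep_eq)

lemma gconst_sum: "gconst (\<Sum>i\<in>I. f i) = (\<Sum>i\<in>I. gconst (f i))"
  by (induction I rule: infinite_finite_induct) (simp_all add: gconst_add)

lemma gconst_power: "gconst a ^ k = gconst (a ^ k)"
  by (induction k) (simp_all add: gconst_mult)

text \<open>The number of transpositions that bring \<open>theta j\<close> to the front of the basis
  product indexed by \<open>A\<close>; it governs the signs of left multiplication and of the left
  derivative alike.\<close>

definition below :: "nat set \<Rightarrow> nat \<Rightarrow> nat" where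
  "below A j = card {i\<in>A. i < j}"

lemma below_insert:
  assumes "finite A" "i \<notin> A"
  shows "below (insert i A) j = below A j + (if i < j then 1 else 0)"
proof -
  have "{x\<in>insert i A. x < j} = (if i < j then insert i {x\<in>A. x < j} else {x\<in>A. x < j})" by auto
  then show ?thesis using assms by (simp add: below_def)
qed

lemma below_remove:
  assumes "finite A" "i \<in> A"
  shows "below A j = below (A - {i}) j + (if i < j then 1 else 0)"
  using below_insert[of "A - {i}" i j] assms by (simp add: insert_absorb)

lemma below_self: "below (insert j A) j = below A j" "below (A - {j}) j = below A j"
  unfolding below_def by (rule arg_cong[of _ _ card]; auto)+

lemma gcoeff_gderiv:
  "gcoeff (gderiv j a) A = (if j \<in> A then 0 else (- 1) ^ below A j * gcoeff a (insert j A))"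
  by (simp add: gderiv.rep_eq below_def)

lemma gcoeff_theta_mult:
  "gcoeff (theta j * a) A = (if j \<in> A then (- 1) ^ below A j * gcoeff a (A - {j}) else 0)"
proof (cases "finite A")
  case True
  have "(\<Sum>B\<in>Pow A. gsign B (A - B) * ((if B = {j} then 1 else 0) * gcoeff a (A - B))) =
        (\<Sum>B\<in>Pow A. if B = {j} then gsign {j} (A - {j}) * gcoeff a (A - {j}) else 0)"
    by (rule sum.cong) auto
  moreover have "gsign {j} (A - {j}) = (- 1) ^ below A j"
  proof -
    have "{(b, d). b \<in> {j} \<and> d \<in> A - {j} \<and> d < b} = Pair j ` {i\<in>A. i < j}" by auto
    then show ?thesis unfolding gsign_def below_def by (simp add: card_image inj_on_def)
  qed
  ultimately show ?thesis using True by (simp add: times_grassmann.rep_eq theta.rep_eq)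
qed (simp add: gcoeff_infinite)

text \<open>The canonical anticommutation relation. For \<open>i = j\<close> the two equal signs
  cancel; for distinct indices the sets involved agree and only the signs have to be
  compared.\<close>

lemma gderiv_theta_mult:
  "gderiv i (theta j * a) = (if i = j then a else 0) - theta j * gderiv i a"
proof (rule grassmann_eqI)
  fix A :: "nat set"
  show "gcoeff (gderiv i (theta j * a)) A = gcoeff ((if i = j then a else 0) - theta j * gderiv i a) A"
  proof (cases "finite A")
    case fin: True
    show ?thesis
    proof (cases "i = j")
      case True
      have "insert j (A - {j}) = A" if "j \<in> A" using that by auto
      moreover have "(- 1) ^ k * ((- 1) ^ k * c) = (c::complex)" for k c
        by (simp add: mult.assoc[symmetric] power_add[symmetric] flip: mult_2)
      ultimately show ?thesis using True
        by (auto simp: gcoeff_gderiv gcoeff_theta_mult below_self)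
    next
      case False
      show ?thesis
      proof (cases "j \<in> A \<and> i \<notin> A")
        case True
        have "insert i (A - {j}) = insert i A - {j}" using False by auto
        \<comment> \<open>Exactly one of \<open>i < j\<close> and \<open>j < i\<close> holds, so
          exactly one of the two \<open>below\<close> exponents changes by one, which produces the
          minus sign.\<close>
        then show ?thesis using True False below_insert[OF fin, of i j] below_remove[OF fin, of j i]
          by (cases "i < j") (simp_all add: gcoeff_gderiv gcoeff_theta_mult)
      qed (use False in \<open>auto simp: gcoeff_gderiv gcoeff_theta_mult\<close>)
    qed
  qed (simp add: gcoeff_infinite)
qed

lemma gderiv_linear [simp]:
  "gderiv i 0 = 0" "gderiv i (a + b) = gderiv i a + gderiv i b"
  "gderiv i (a - b) = gderiv i a - gderiv i b" "gderiv i (- a) = - gderiv i a"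
  "gderiv i (gconst c * a) = gconst c * gderiv i a" "gderiv i (a * gconst c) = gderiv i a * gconst c"
  "gderiv i (gconst c) = 0" "gderiv i 1 = 0"
  by (rule grassmann_eqI; simp add: gcoeff_gderiv gconst.rep_eq gcoeff_one algebra_simps)+

lemma gderiv_sum: "gderiv i (\<Sum>j\<in>I. f j) = (\<Sum>j\<in>I. gderiv i (f j))"
  by (induction I rule: infinite_finite_induct) simp_all

lemma gderiv_theta: "gderiv i (theta j) = (if i = j then 1 else 0)"
  using gderiv_theta_mult[of i j 1] by simp

lemma theta_square: "theta j * theta j = 0"
proof (rule grassmann_eqI)
  fix A show "gcoeff (theta j * theta j) A = gcoeff 0 A"
    by (auto simp: gcoeff_theta_mult theta.rep_eq)
qed

lemma theta_left_anti: "theta i * (theta j * a) = - (theta j * (theta i * a))"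
  by (metis theta_anti mult.assoc mult_minus_left)

lemma theta_theta_commute: "theta a * theta b * theta l = theta l * (theta a * theta b)"
proof -
  have "theta a * theta b * theta l = - (theta a * (theta l * theta b))"
    by (simp add: mult.assoc theta_anti[of b l])
  then show ?thesis by (simp add: theta_left_anti[of a l])
qed

subsection \<open>Exponentials of quadratic elements\<close>

text \<open>The definition of \<open>gexp\<close> through \<open>suminf\<close> says nothing about
  convergence. Recording convergence as well allows series to be shifted and added term by
  term.\<close>

definition gexp_sums :: "grassmann \<Rightarrow> grassmann \<Rightarrow> bool" where
  "gexp_sums s g \<longleftrightarrow> (\<forall>A. (\<lambda>k. gcoeff (s ^ k) A / fact k) sums gcoeff g A)"

lemma gexp_sums_gexp: "gexp_sums s g \<Longrightarrow> gexp s = g"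
  by (rule grassmann_eqI) (simp add: gexp_sums_def gexp.rep_eq sums_iff)

lemma gexp_sums_gconst: "gexp_sums (gconst c) (gconst (exp c))"
  unfolding gexp_sums_def
proof
  fix A
  have "(\<lambda>k. c ^ k / fact k) sums exp c"
    using exp_converges[of c] by (simp add: scaleR_conv_of_real field_simps)
  then show "(\<lambda>k. gcoeff (gconst c ^ k) A / fact k) sums gcoeff (gconst (exp c)) A"
    by (cases "A = {}") (simp_all add: gconst_power gconst.rep_eq)
qed

text \<open>Since \<open>q\<close> commutes with \<open>s\<close> and has square zero, its own
  exponential is \<open>1 + q\<close>, and the exponential of the sum is the product.\<close>

lemma gexp_sums_add_nilpotent:
  assumes s: "gexp_sums s g" and comm: "s * q = q * s" and q: "q * q = 0"
  shows "gexp_sums (s + q) (g * (1 + q))"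
  unfolding gexp_sums_def
proof
  fix A
  have pq: "s ^ k * q = q * s ^ k" for k
    using comm by (induction k) (simp_all add: mult.assoc, metis mult.assoc)
  have nc: "x * (of_nat n * y) = of_nat n * (x * y)" for n and x y :: grassmann
    by (metis mult.assoc mult_of_nat_commute)
  \<comment> \<open>The binomial theorem: all terms of degree at least two in \<open>q\<close>
    vanish.\<close>
  have pow: "(s + q) ^ Suc k = s ^ Suc k + of_nat (Suc k) * (s ^ k * q)" for k
  proof (induction k)
    case (Suc k)
    have "q * (of_nat (Suc k) * (s ^ k * q)) = 0"
    proof -
      have "q * (s ^ k * q) = 0" by (simp only: pq mult.assoc[symmetric] q mult_zero_left)
      then show ?thesis by (simp only: nc mult_zero_right)
    qed
    then have "(s + q) ^ Suc (Suc k) = s ^ Suc (Suc k) + q * s ^ Suc k + s * (of_nat (Suc k) * (s ^ k * q))"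
      using Suc by (simp only: power_Suc[of "s + q" "Suc k"] distrib_left distrib_right) simp
    also have "s * (of_nat (Suc k) * (s ^ k * q)) = of_nat (Suc k) * (s ^ Suc k * q)"
      by (simp only: nc power_Suc mult.assoc)
    finally show ?case
      by (simp only: pq[of "Suc k", symmetric] of_nat_Suc[of "Suc k"] distrib_right mult_1_left) (simp only: add_ac)
  qed simp
  have mq: "gcoeff (a * q) A = (\<Sum>B\<in>Pow A. gsign B (A - B) * (gcoeff a B * gcoeff q (A - B)))" for a
    by (simp add: times_grassmann.rep_eq)
  have 1: "(\<lambda>k. gcoeff (s ^ k * q) A / fact k) sums gcoeff (g * q) A"
    unfolding mq sum_divide_distrib
  proof (rule sums_sum)
    fix B
    have "(\<lambda>k. gsign B (A - B) * gcoeff q (A - B) * (gcoeff (s ^ k) B / fact k)) sums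
            (gsign B (A - B) * gcoeff q (A - B) * gcoeff g B)"
      using s by (intro sums_mult) (simp add: gexp_sums_def)
    then show "(\<lambda>k. gsign B (A - B) * (gcoeff (s ^ k) B * gcoeff q (A - B)) / fact k) sums
                 (gsign B (A - B) * (gcoeff g B * gcoeff q (A - B)))"
      by (simp add: mult_ac)
  qed
  have nat: "gcoeff (of_nat k * a) A = of_nat k * gcoeff a A" for k a
    by (induction k) (simp_all add: algebra_simps)
  \<comment> \<open>The part linear in \<open>q\<close> at exponent \<open>Suc k\<close> matches the
    term of index \<open>k\<close> of the series for \<open>g * q\<close>. Hence the term of index 0
    is split off before the two series are added.\<close>
  have "(\<lambda>k. gcoeff (s ^ Suc k) A / fact (Suc k)) sums (gcoeff g A - gcoeff (s ^ 0) A / fact 0)"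
    using s unfolding gexp_sums_def by (subst sums_Suc_iff) simp
  from sums_add[OF this 1]
  have "(\<lambda>k. gcoeff ((s + q) ^ Suc k) A / fact (Suc k)) sums
      (gcoeff g A - gcoeff (s ^ 0) A / fact 0 + gcoeff (g * q) A)"
  proof (rule sums_cong[THEN iffD1, rotated])
    fix k
    have "of_nat (Suc k) * c / fact (Suc k) = c / (fact k :: complex)" for c
      unfolding fact_Suc by (simp del: of_nat_Suc)
    then show "gcoeff (s ^ Suc k) A / fact (Suc k) + gcoeff (s ^ k * q) A / fact k =
      gcoeff ((s + q) ^ Suc k) A / fact (Suc k)"
      unfolding pow by (simp add: add_divide_distrib nat del: fact_Suc power_Suc of_nat_Suc)
  qed
  then have "(\<lambda>k. gcoeff ((s + q) ^ k) A / fact k) sums (gcoeff g A + gcoeff (g * q) A)"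
    by (subst (asm) sums_Suc_iff) simp
  then show "(\<lambda>k. gcoeff ((s + q) ^ k) A / fact k) sums gcoeff (g * (1 + q)) A"
    by (simp add: distrib_left)
qed

text \<open>Sums of terms \<open>c \<theta>\<^sub>a \<theta>\<^sub>b\<close>; \<open>b\<close> is restricted to \<open>B\<close> in order to track which
  coefficients the exponential can affect.\<close>

inductive_set quad :: "nat set \<Rightarrow> grassmann set" for B where
  zero: "0 \<in> quad B"
| step: "s \<in> quad B \<Longrightarrow> b \<in> B \<Longrightarrow> s + gconst c * (theta a * theta b) \<in> quad B"

lemma quad_add: "t \<in> quad B \<Longrightarrow> s \<in> quad B \<Longrightarrow> s + t \<in> quad B"
  by (induction rule: quad.induct) (auto simp: add.assoc[symmetric] intro: quad.intros)

lemma quad_sum: "(\<And>i. i \<in> I \<Longrightarrow> f i \<in> quad B) \<Longrightarrow> (\<Sum>i\<in>I. f i) \<in> quad B"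
  by (induction I rule: infinite_finite_induct) (auto intro: quad_add quad.zero)

lemma quad_single: "b \<in> B \<Longrightarrow> gconst c * (theta a * theta b) \<in> quad B"
  using quad.step[OF quad.zero] by simp

lemma quad_gconst_mult: "s \<in> quad B \<Longrightarrow> gconst d * s \<in> quad B"
proof (induction rule: quad.induct)
  case (step s b c a)
  then show ?case
    using quad.step[OF step.IH step.hyps(2), of "d * c" a]
    by (simp add: distrib_left gconst_mult[symmetric] mult.assoc)
qed (simp add: quad.zero)

lemma quad_commute: "s \<in> quad B \<Longrightarrow> s * theta l = theta l * s"
proof (induction rule: quad.induct)
  case (step s b c a)
  have "gconst c * (theta a * theta b) * theta l = gconst c * (theta a * theta b * theta l)"
    by (simp only: mult.assoc)
  also have "\<dots> = theta l * (gconst c * (theta a * theta b))"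
    by (simp only: theta_theta_commute gconst_left_commute)
  finally show ?case using step by (simp add: distrib_left distrib_right)
qed simp

text \<open>Each summand of \<open>s\<close> is even with square zero, so the exponential is a
  finite product of factors \<open>1 + q\<close>. One induction builds this product as a witness
  \<open>g\<close> and carries all properties along; only at the end is \<open>g\<close> identified
  with \<open>gexp s\<close>. The last claim holds because every nonconstant monomial of the product
  contains a generator with index in \<open>B\<close>.\<close>

lemma quad_exp:
  assumes "s \<in> quad B"
  shows "gexp_sums s (gexp s)"
    and "gexp (s + gconst c) = gconst (exp c) * gexp s"
    and "gexp s * theta l = theta l * gexp s"
    and "gderiv l (gexp s * h) = gderiv l s * (gexp s * h) + gexp s * gderiv l h"
    and "A \<inter> B = {} \<Longrightarrow> gcoeff (gexp s * h) A = gcoeff h A"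
proof -
  have "\<exists>g. gexp_sums s g \<and> (\<forall>c. gexp_sums (s + gconst c) (gconst (exp c) * g)) \<and>
    (\<forall>l. g * theta l = theta l * g) \<and>
    (\<forall>l h. gderiv l (g * h) = gderiv l s * (g * h) + g * gderiv l h) \<and>
    (\<forall>A h. A \<inter> B = {} \<longrightarrow> gcoeff (g * h) A = gcoeff h A)"
    using assms
  proof induction
    case zero
    have "gexp_sums 0 1" using gexp_sums_gconst[of 0] by simp
    then show ?case by (intro exI[of _ 1]) (simp add: gexp_sums_gconst)
  next
    case (step s b c a)
    then obtain g where g: "gexp_sums s g" "\<And>c. gexp_sums (s + gconst c) (gconst (exp c) * g)"
      "\<And>l. g * theta l = theta l * g"
      "\<And>l h. gderiv l (g * h) = gderiv l s * (g * h) + g * gderiv l h"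
      "\<And>A h. A \<inter> B = {} \<Longrightarrow> gcoeff (g * h) A = gcoeff h A"
      by blast
    define q where "q = gconst c * (theta a * theta b)"
    \<comment> \<open>The derivative of \<open>q\<close>; being a combination of
      \<open>theta a\<close> and \<open>theta b\<close>, it satisfies
      \<open>dq l * q = 0\<close>.\<close>
    define dq where "dq l = gconst c * ((if l = a then theta b else 0) - (if l = b then theta a else 0))" for l
    have qt: "q * theta l = theta l * q" for l
      using quad_commute[OF quad_single[of b "{b}" c a]] by (simp add: q_def)
    have thq: "theta b * q = 0" "theta a * q = 0"
    proof -
      have "theta b * (theta a * theta b) = 0" "theta a * (theta a * theta b) = 0"
        by (simp_all add: theta_left_anti[of b a] theta_square)
          (simp add: theta_square flip: mult.assoc)
      then show "theta b * q = 0" "theta a * q = 0"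
        by (simp_all add: q_def gconst_left_commute)
    qed
    have q2: "q * q = 0"
      by (subst q_def) (simp add: mult.assoc thq)
    have sq: "s * q = q * s"
      unfolding q_def using quad_commute[OF step.hyps(1)]
      by (metis gconst_commute mult.assoc)
    have gq: "g * q = q * g"
      unfolding q_def using g(3) by (metis gconst_commute mult.assoc)
    have dqh: "gderiv l (q * h) = dq l * h + q * gderiv l h" for l h
      unfolding q_def dq_def
      by (simp add: mult.assoc gderiv_theta_mult left_diff_distrib right_diff_distrib)
    have dql: "gderiv l q = dq l" for l using dqh[of l 1] by simp
    have dqq: "dq l * q = 0" for l
      by (simp add: dq_def left_diff_distrib mult.assoc thq)
    have gdq: "g * dq l = dq l * g" for l
      unfolding dq_def by (simp add: gconst_left_commute mult.assoc right_diff_distrib left_diff_distrib g(3))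
    show ?case
    proof (intro exI[of _ "g * (1 + q)"] conjI allI impI)
      show "gexp_sums (s + gconst c * (theta a * theta b)) (g * (1 + q))"
        using gexp_sums_add_nilpotent[OF g(1) sq q2] by (simp add: q_def)
      fix d
      have "(s + gconst d) * q = q * (s + gconst d)"
        by (simp add: distrib_left distrib_right sq gconst_commute)
      from gexp_sums_add_nilpotent[OF g(2) this q2]
      show "gexp_sums (s + gconst c * (theta a * theta b) + gconst d) (gconst (exp d) * (g * (1 + q)))"
        by (simp add: q_def algebra_simps)
    next
      fix l
      show "g * (1 + q) * theta l = theta l * (g * (1 + q))"
        by (simp add: algebra_simps qt g(3)) (metis g(3) mult.assoc)
    next
      fix l h
      have "gderiv l (g * (1 + q) * h) = gderiv l s * (g * ((1 + q) * h)) + g * (dq l * h + (1 + q) * gderiv l h)"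
        by (simp add: mult.assoc g(4) dqh distrib_right add.left_commute)
      \<comment> \<open>Because \<open>dq l * q = 0\<close>, the missing factor \<open>1 + q\<close>
        may be inserted after \<open>dq l\<close>, so the full exponential reappears in the product
        rule.\<close>
      moreover have "g * (dq l * h) = dq l * (g * (1 + q) * h)"
      proof -
        have "dq l * (g * q * h) = 0"
          by (simp add: gq) (metis dqq mult.assoc mult_zero_left)
        then show ?thesis by (simp add: algebra_simps) (metis gdq mult.assoc)
      qed
      ultimately show "gderiv l (g * (1 + q) * h) =
          gderiv l (s + gconst c * (theta a * theta b)) * (g * (1 + q) * h) + g * (1 + q) * gderiv l h"
        using dql[of l] by (simp add: q_def[symmetric] distrib_left distrib_right mult.assoc)
    next
      fix A h assume A: "A \<inter> B = {}"
      \<comment> \<open>With \<open>theta b\<close> pulled to the front, every monomial of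
        \<open>q * h\<close> is seen to contain \<open>b\<close>, an index that \<open>A\<close>
        avoids.\<close>
      have qh: "q * h = - (theta b * (gconst c * theta a * h))"
        unfolding q_def by (simp add: gconst_left_commute mult.assoc theta_left_anti[of a b])
      have "gcoeff (g * (q * h)) A = gcoeff (q * h) A" using g(5) A by blast
      also have "\<dots> = 0"
        using step.hyps(2) A by (auto simp: qh gcoeff_theta_mult)
      finally show "gcoeff (g * (1 + q) * h) A = gcoeff h A"
        using g(5)[OF A, of h] by (simp add: distrib_left distrib_right mult.assoc)
    qed
  qed
  then obtain g where g: "gexp_sums s g" "\<And>c. gexp_sums (s + gconst c) (gconst (exp c) * g)"
      "\<And>l. g * theta l = theta l * g"
      "\<And>l h. gderiv l (g * h) = gderiv l s * (g * h) + g * gderiv l h"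
      "\<And>A h. A \<inter> B = {} \<Longrightarrow> gcoeff (g * h) A = gcoeff h A"
    by blast
  have [simp]: "gexp s = g" using g(1) by (rule gexp_sums_gexp)
  show "gexp_sums s (gexp s)" using g(1) by simp
  show "gexp (s + gconst c) = gconst (exp c) * gexp s" using gexp_sums_gexp[OF g(2)] by simp
  show "gexp s * theta l = theta l * gexp s" using g(3) by simp
  show "gderiv l (gexp s * h) = gderiv l s * (gexp s * h) + gexp s * gderiv l h" using g(4) by simp
  show "A \<inter> B = {} \<Longrightarrow> gcoeff (gexp s * h) A = gcoeff h A" using g(5) by simp
qed

lemmas fun_simps = plus_fun_apply zero_fun_apply times_fun_apply one_fun_apply minus_apply uminus_apply

text \<open>Unification may leave eta-expanded sums of functions behind; these rules would turn them into
  terms on which the rules below fail to match.\<close>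

declare fun_simps [simp del]

section \<open>Canonical commutation relations on scalar superfunctions\<close>

definition csc :: "complex \<Rightarrow> scalar_superfun \<Rightarrow> scalar_superfun" where
  "csc c f = (\<lambda>x. gconst c * f x)"

lemma csc_simps [simp]:
  "csc c (f + g) = csc c f + csc c g" "csc c (f - g) = csc c f - csc c g" "csc c (- f) = - csc c f"
  "csc c (csc d f) = csc (c * d) f" "csc 1 f = f" "csc 0 f = 0" "csc c 0 = 0"
  by (auto simp: csc_def fun_eq_iff fun_simps distrib_left right_diff_distrib gconst_mult[symmetric] mult.assoc)

lemma csc_add: "csc (c + d) f = csc c f + csc d f"
  by (auto simp: csc_def fun_eq_iff fun_simps gconst_add distrib_right)

lemma csc_minus: "csc (- c) f = - csc c f"
  by (auto simp: csc_def fun_eq_iff fun_simps gconst_uminus)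

lemma csc_diff: "csc (c - d) f = csc c f - csc d f"
  using csc_add[of c "- d" f] by (simp add: csc_minus)

lemma mult_csc: "f * csc c g = csc c (f * g)"
  by (simp add: csc_def fun_eq_iff fun_simps gconst_left_commute)

lemma csc_sum: "csc c (\<Sum>i\<in>I. f i) = (\<Sum>i\<in>I. csc c (f i))"
  by (induction I rule: infinite_finite_induct)
    (simp_all only: sum.infinite sum.empty sum.insert csc_simps not_False_eq_True)

lemma csc_eq_0: "csc c f = 0 \<Longrightarrow> c \<noteq> 0 \<Longrightarrow> f = 0"
  using csc_simps(4)[of "1 / c" c f] by simp

lemma gcoeff_csc [simp]: "gcoeff (csc c f x) A = c * gcoeff (f x) A"
  by (simp add: csc_def)

text \<open>Where no derivative exists, \<open>vector_derivative\<close> has an unspecified value,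
  so the sum and product rules for \<open>partial_x\<close> are stated on this class.\<close>

definition diff_superfuns :: "scalar_superfun set" where
  "diff_superfuns = {f. \<forall>A i x. (\<lambda>t. gcoeff (f (x(i := t))) A) differentiable (at (x i))}"

lemma gcoeff_partial_x:
  "gcoeff (partial_x i f x) A = vector_derivative (\<lambda>t. gcoeff (f (x(i := t))) A) (at (x i))"
  unfolding partial_x_def by (rule gcoeff_Grassmann) (simp add: gcoeff_infinite)

lemma has_partial_x:
  assumes "f \<in> diff_superfuns"
  shows "((\<lambda>t. gcoeff (f (x(i := t))) A) has_vector_derivative gcoeff (partial_x i f x) A) (at (x i))"
  using assms unfolding diff_superfuns_def gcoeff_partial_x by (simp add: vector_derivative_works)

lemma partial_xI:
  assumes "\<And>x A. ((\<lambda>t. gcoeff (f (x(i := t))) A) has_vector_derivative gcoeff (g x) A) (at (x i))"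
  shows "partial_x i f = g"
  using assms by (intro ext grassmann_eqI) (auto simp: gcoeff_partial_x intro: vector_derivative_at)

lemma diff_superfunsI:
  assumes "\<And>i x A. ((\<lambda>t. gcoeff (f (x(i := t))) A) has_vector_derivative D i x A) (at (x i))"
  shows "f \<in> diff_superfuns"
  using assms unfolding diff_superfuns_def differentiable_def has_vector_derivative_def by blast

lemma partial_x_add:
  assumes "f \<in> diff_superfuns" "g \<in> diff_superfuns"
  shows "f + g \<in> diff_superfuns" "partial_x i (f + g) = partial_x i f + partial_x i g"
proof -
  have D: "((\<lambda>t. gcoeff ((f + g) (x(i := t))) A) has_vector_derivative
      gcoeff ((partial_x i f + partial_x i g) x) A) (at (x i))" for i x A
    using has_vector_derivative_add[OF has_partial_x[OF assms(1), of x i A] has_partial_x[OF assms(2), of x i A]] by (simp add: fun_simps)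
  show "f + g \<in> diff_superfuns" by (rule diff_superfunsI, rule D)
  show "partial_x i (f + g) = partial_x i f + partial_x i g" by (rule partial_xI, rule D)
qed

lemma gcoeff_mult: "gcoeff (a * b) A = (\<Sum>B\<in>Pow A. gsign B (A - B) * (gcoeff a B * gcoeff b (A - B)))"
  by (simp add: times_grassmann.rep_eq)

lemma partial_x_mult:
  assumes "f \<in> diff_superfuns" "g \<in> diff_superfuns"
  shows "f * g \<in> diff_superfuns" "partial_x i (f * g) = partial_x i f * g + f * partial_x i g"
proof -
  have D: "((\<lambda>t. gcoeff ((f * g) (x(i := t))) A) has_vector_derivative
      gcoeff ((partial_x i f * g + f * partial_x i g) x) A) (at (x i))" for i x A
  proof -
    have "((\<lambda>t. gsign B (A - B) * (gcoeff (f (x(i := t))) B * gcoeff (g (x(i := t))) (A - B))) has_vector_derivative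
      gsign B (A - B) * (gcoeff (f x) B * gcoeff (partial_x i g x) (A - B) + gcoeff (partial_x i f x) B * gcoeff (g x) (A - B)))
      (at (x i))" for B
      using has_vector_derivative_mult[OF has_partial_x[OF assms(1), of x i B] has_partial_x[OF assms(2), of x i "A - B"]]
      by (intro has_vector_derivative_mult_right) simp
    from has_vector_derivative_sum[of "Pow A", OF this]
    show ?thesis
      by (simp add: gcoeff_mult sum.distrib[symmetric] distrib_left add.commute fun_simps)
  qed
  show "f * g \<in> diff_superfuns" by (rule diff_superfunsI, rule D)
  show "partial_x i (f * g) = partial_x i f * g + f * partial_x i g" by (rule partial_xI, rule D)
qed

lemma partial_x_const: "(\<lambda>_. a) \<in> diff_superfuns" "partial_x i (\<lambda>_. a) = 0"
proof -
  have D: "((\<lambda>t. gcoeff ((\<lambda>_. a) (x(i := t))) A) has_vector_derivative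
      gcoeff ((0 :: scalar_superfun) x) A) (at (x i))" for i A and x :: "nat \<Rightarrow> real"
    by (simp add: fun_simps)
  show "(\<lambda>_. a) \<in> diff_superfuns" by (rule diff_superfunsI, rule D)
  show "partial_x i (\<lambda>_. a) = 0" by (rule partial_xI, rule D)
qed

lemma partial_x_csc:
  assumes "f \<in> diff_superfuns"
  shows "csc c f \<in> diff_superfuns" "partial_x i (csc c f) = csc c (partial_x i f)"
proof -
  have eq: "csc c f = (\<lambda>_. gconst c) * f" by (auto simp: csc_def fun_simps fun_eq_iff)
  note * = partial_x_mult[OF partial_x_const(1)[of "gconst c"] assms]
  show "csc c f \<in> diff_superfuns" unfolding eq by (rule *)
  show "partial_x i (csc c f) = csc c (partial_x i f)"
    unfolding eq * by (simp add: partial_x_const csc_def fun_simps fun_eq_iff)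
qed

lemma partial_x_xv:
  shows "xv j \<in> diff_superfuns" "partial_x i (xv j) = (if i = j then 1 else 0)"
proof -
  have *: "((\<lambda>t. gcoeff (xv j (x(i := t))) A) has_vector_derivative
     gcoeff ((if i = j then 1 else 0 :: scalar_superfun) x) A) (at (x i))" for i x A
  proof (cases "i = j \<and> A = {}")
    case False
    then show ?thesis by (cases "A = {}") (auto simp: xv_def gconst.rep_eq gcoeff_one fun_simps)
  next
    case True
    have "((\<lambda>t. complex_of_real t) has_vector_derivative 1) (at (x i))"
      using has_vector_derivative_of_real[OF DERIV_ident] by simp
    then show ?thesis using True by (simp add: xv_def gconst.rep_eq gcoeff_one fun_simps)
  qed
  show "xv j \<in> diff_superfuns" by (rule diff_superfunsI, rule *)
  show "partial_x i (xv j) = (if i = j then 1 else 0)" by (rule partial_xI, rule *)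
qed

lemma xg_const: "xg j = (\<lambda>_. theta j)"
  by (simp add: xg_def)

section \<open>Multiplication and differentiation operators indexed by the generators of C\<close>

fun xx :: "gen \<Rightarrow> scalar_superfun \<Rightarrow> scalar_superfun" where
  "xx (E i) f = xv i * f"
| "xx (G j) f = xg j * f"

text \<open>\<open>dd l\<close> is the scalar operator that accompanies the letter \<open>l\<close> in the Dirac operator.\<close>

fun dd :: "gen \<Rightarrow> scalar_superfun \<Rightarrow> scalar_superfun" where
  "dd (E i) f = - partial_x i f"
| "dd (G j) f = (if even j then csc 2 (partial_xg (j - 1) f) else csc (-2) (partial_xg (j + 1) f))"

text \<open>The letter whose variable is differentiated by \<open>dd l\<close>: the letter itself in
  the orthogonal case, the other member of the symplectic pair otherwise.\<close>

fun partner :: "gen \<Rightarrow> gen" where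
  "partner (E i) = E i"
| "partner (G j) = (if even j then G (j - 1) else G (j + 1))"

text \<open>The value of \<open>dd l\<close> on the variable that belongs to
  \<open>partner l\<close>.\<close>

fun om :: "gen \<Rightarrow> complex" where
  "om (E i) = -1"
| "om (G j) = (if even j then 2 else -2)"

text \<open>The sign under which the variables of two letters are exchanged. The letters themselves
  are exchanged in C with the opposite sign, up to constants; see
  \<open>relation_letters\<close>.\<close>

fun ss :: "gen \<Rightarrow> gen \<Rightarrow> complex" where
  "ss (G i) (G j) = -1"
| "ss _ _ = 1"

text \<open>The bilinear form of the canonical commutation relations, symmetric on orthogonal and
  antisymmetric on symplectic letters.\<close>

definition omega :: "gen \<Rightarrow> gen \<Rightarrow> complex" where
  "omega l l' = (if l' = partner l then om l else 0)"

lemma ss_simps [simp]: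
  "ss l l' * ss l l' = 1" "ss (E i) l = 1" "ss l (E i) = 1"
  "ss (partner l) l' = ss l l'" "ss l (partner l') = ss l l'"
  by (cases l; cases l'; simp)+

lemma ss_left [simp]: "ss l l' * (ss l l' * c) = c"
  by (simp flip: mult.assoc)

lemma ss_commute: "ss l l' = ss l' l"
  by (cases l; cases l') simp_all

lemma gens_cases:
  assumes "l \<in> gens m n"
  obtains i where "l = E i" "i \<in> {1..m}"
  | j where "l = G (2 * j)" "j \<in> {1..n}" | j where "l = G (2 * j - 1)" "j \<in> {1..n}"
proof (cases l)
  case (G i)
  then have i: "1 \<le> i" "i \<le> 2 * n" using assms by (auto simp: gens_def)
  show ?thesis
  proof (cases "even i")
    case True
    with i show ?thesis using that(2)[of "i div 2"] G by auto
  next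
    case False
    then obtain k where k: "i = 2 * k + 1" by (auto elim: oddE)
    with i show ?thesis using that(3)[of "k + 1"] G by auto
  qed
qed (use that assms in \<open>auto simp: gens_def\<close>)

lemma finite_gens [simp]: "finite (gens m n)"
  by (simp add: gens_def)

lemma E_in_gens [simp]: "E i \<in> gens m n \<longleftrightarrow> 1 \<le> i \<and> i \<le> m"
  by (auto simp: gens_def)

lemma G_in_gens [simp]: "G i \<in> gens m n \<longleftrightarrow> 1 \<le> i \<and> i \<le> 2 * n"
  by (auto simp: gens_def)

lemma partner_gens [simp]:
  assumes "l \<in> gens m n"
  shows "partner l \<in> gens m n" "partner (partner l) = l"
  using assms by (cases rule: gens_cases; auto)+

lemma omega_swap:
  assumes "l \<in> gens m n" "l' \<in> gens m n"
  shows "omega l l' = ss l l' * omega l' l"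
proof (cases "l' = partner l")
  case True
  show ?thesis using assms(1)
    by (cases rule: gens_cases) (auto simp: omega_def True)
next
  case False
  then have "l \<noteq> partner l'" using partner_gens(2)[OF assms(2)] by auto
  with False show ?thesis by (simp add: omega_def)
qed

lemma xx_linear [simp]:
  "xx l (f + g) = xx l f + xx l g" "xx l (f - g) = xx l f - xx l g" "xx l (- f) = - xx l f"
  "xx l (csc c f) = csc c (xx l f)" "xx l 0 = 0"
  by (cases l; auto simp: distrib_left right_diff_distrib mult_csc)+

lemma xx_sum: "xx l (\<Sum>i\<in>I. f i) = (\<Sum>i\<in>I. xx l (f i))"
  by (induction I rule: infinite_finite_induct)
    (simp_all only: sum.infinite sum.empty sum.insert xx_linear not_False_eq_True)

lemma csc_m1: "csc (- 1) f = - f"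
  by (simp add: csc_minus)

lemma xx_xx: "xx l (xx l' f) = csc (ss l l') (xx l' (xx l f))"
proof -
  have 1: "xv i * (xv j * f) = xv j * (xv i * f)" "xv i * (xg j * f) = xg j * (xv i * f)" for i j
    by (simp_all only: mult.assoc[symmetric] xv_comm(1)[of i j] xv_comm(2)[of i j])
  have 2: "xg i * (xg j * f) = - (xg j * (xg i * f))" for i j
    by (simp only: mult.assoc[symmetric] xv_comm(3)[of i j] mult_minus_left)
  show ?thesis
    by (cases l; cases l'; simp only: xx.simps ss.simps csc_simps csc_m1)
      (rule 1 2 1(2)[symmetric])+
qed

lemma xx_diff [simp]: "f \<in> diff_superfuns \<Longrightarrow> xx l f \<in> diff_superfuns"
  by (cases l) (auto intro!: partial_x_mult partial_x_xv simp: xg_const partial_x_const)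

lemma partial_xg_linear:
  "partial_xg j (f + g) = partial_xg j f + partial_xg j g"
  "partial_xg j (csc c f) = csc c (partial_xg j f)"
  by (auto simp: partial_xg_def fun_eq_iff fun_simps csc_def)

lemma dd_linear:
  shows dd_add: "f \<in> diff_superfuns \<Longrightarrow> g \<in> diff_superfuns \<Longrightarrow> dd l (f + g) = dd l f + dd l g"
    and dd_csc: "f \<in> diff_superfuns \<Longrightarrow> dd l (csc c f) = csc c (dd l f)"
  by (cases l; auto simp: partial_x_add partial_x_csc partial_xg_linear mult.commute)+

lemma partial_xg_xx:
  "partial_xg j (xg i * f) = (if i = j then f else 0) - xg i * partial_xg j f"
  "partial_xg j (xv i * f) = xv i * partial_xg j f"
  by (auto simp: partial_xg_def xg_def xv_def fun_eq_iff fun_simps gderiv_theta_mult fun_simps)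

text \<open>The bosonic commutator and the fermionic anticommutator in one formula. The algebra of
  the number operator rests on it.\<close>

lemma dd_xx:
  assumes "f \<in> diff_superfuns"
  shows "dd l (xx l' f) = csc (omega l l') f + csc (ss l l') (xx l' (dd l f))"
proof (cases l)
  case l: (E i)
  show ?thesis
  proof (cases l')
    case (E j)
    then show ?thesis using l partial_x_mult[OF partial_x_xv(1)[of j] assms] 
      by (simp add: omega_def partial_x_xv csc_m1)
  next
    case (G j)
    then show ?thesis using l partial_x_mult[OF partial_x_const(1) assms] 
      by (simp add: omega_def partial_x_const xg_const)
  qed
next
  case l: (G i)
  show ?thesis
  proof (cases l')
    case (E j)
    then show ?thesis using l by (simp add: omega_def partial_xg_xx mult_csc)
  next
    case (G j)
    then show ?thesis using l
      by (auto simp: omega_def partial_xg_xx csc_m1 csc_minus mult_csc)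
  qed
qed

lemma dd_one: "dd l 1 = 0"
  using partial_x_const(2)[of _ 1]
  by (cases l) (auto simp: partial_xg_def one_fun_def fun_eq_iff fun_simps csc_def)

lemma dd_zero: "dd l 0 = 0"
  using partial_x_const(2)[of _ 0]
  by (cases l) (auto simp: partial_xg_def zero_fun_def fun_eq_iff fun_simps csc_def)

subsection \<open>Scalar superpolynomials and the number operator\<close>

text \<open>Generation by \<open>1\<close> and the operators \<open>xx l\<close> lets operator
  identities be proved by induction from the commutation relations alone.\<close>

inductive_set spolys :: "nat \<Rightarrow> nat \<Rightarrow> scalar_superfun set" for m n where
  one: "1 \<in> spolys m n"
| add: "f \<in> spolys m n \<Longrightarrow> g \<in> spolys m n \<Longrightarrow> f + g \<in> spolys m n"
| csc: "f \<in> spolys m n \<Longrightarrow> csc c f \<in> spolys m n"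
| xx: "f \<in> spolys m n \<Longrightarrow> l \<in> gens m n \<Longrightarrow> xx l f \<in> spolys m n"

lemma spolys_0: "0 \<in> spolys m n"
  using spolys.csc[OF spolys.one, of 0] by simp

lemma spolys_diff: "f \<in> spolys m n \<Longrightarrow> g \<in> spolys m n \<Longrightarrow> f - g \<in> spolys m n"
  using spolys.add[OF _ spolys.csc[of g m n "-1"], of f] by (simp add: csc_m1)

lemma spolys_sum: "(\<And>i. i \<in> I \<Longrightarrow> f i \<in> spolys m n) \<Longrightarrow> (\<Sum>i\<in>I. f i) \<in> spolys m n"
  by (induction I rule: infinite_finite_induct) (auto intro: spolys_0 spolys.add)

lemma spolys_diff_superfuns: "f \<in> spolys m n \<Longrightarrow> f \<in> diff_superfuns"
  by (induction rule: spolys.induct)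
    (auto simp: one_fun_def intro: partial_x_const partial_x_add partial_x_csc)

lemma spolys_dd: "f \<in> spolys m n \<Longrightarrow> dd l f \<in> spolys m n"
  by (induction rule: spolys.induct)
    (auto simp: dd_one dd_add dd_csc dd_xx spolys_diff_superfuns intro: spolys.intros spolys_0)

lemma dd_diff_superfuns: "f \<in> spolys m n \<Longrightarrow> dd l f \<in> diff_superfuns"
  using spolys_dd spolys_diff_superfuns by blast

lemma dd_sum: "(\<And>i. i \<in> I \<Longrightarrow> f i \<in> spolys m n) \<Longrightarrow> dd l (\<Sum>i\<in>I. f i) = (\<Sum>i\<in>I. dd l (f i))"
proof (induction I rule: infinite_finite_induct)
  case (insert i I)
  then show ?case
    by (subst sum.insert, simp, simp, subst dd_add)
      (auto simp: spolys_diff_superfuns[of _ m n] intro!: spolys_diff_superfuns[of _ m n] spolys_sum)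
qed (auto simp: dd_zero)

text \<open>Symmetry of second derivatives is not taken from analysis: both sides vanish on
  \<open>1\<close> and obey the same recursion under \<open>xx k\<close>, by
  \<open>dd_xx\<close>.\<close>

lemma dd_dd: "f \<in> spolys m n \<Longrightarrow> dd l (dd l' f) = csc (ss l l') (dd l' (dd l f))"
proof (induction rule: spolys.induct)
  case (xx f k)
  note d = spolys_diff_superfuns[OF xx.hyps(1)] spolys_diff_superfuns[OF spolys_dd[OF xx.hyps(1)]]
  \<comment> \<open>Where \<open>omega l' k\<close> is nonzero, \<open>k\<close> is the partner of
    \<open>l'\<close> and therefore has the same exchange sign with \<open>l\<close> as
    \<open>l'\<close>.\<close>
  have 1: "ss l l' * (ss l k * omega l' k) = omega l' k"
    by (simp add: omega_def flip: mult.assoc)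
  have 2: "ss l l' * omega l k = ss l' k * omega l k"
    by (simp add: omega_def ss_commute)
  have 3: "dd l (dd l' (xx k f)) = csc (omega l' k) (dd l f) + csc (ss l' k * omega l k) (dd l' f) +
      csc (ss l' k * ss l k * ss l l') (xx k (dd l' (dd l f)))"
    by (simp add: dd_xx d dd_add dd_csc partial_x_csc partial_x_add mult.assoc xx.IH add.assoc)
  have 4: "csc (ss l l') (dd l' (dd l (xx k f))) = csc (ss l l' * omega l k) (dd l' f) +
      csc (ss l l' * (ss l k * omega l' k)) (dd l f) + csc (ss l' k * ss l k * ss l l') (xx k (dd l' (dd l f)))"
    by (simp add: dd_xx d dd_add dd_csc partial_x_csc partial_x_add mult_ac add.assoc)
  show ?case
    unfolding 1 2 3 4 by (simp add: add_ac)
qed (auto simp: dd_one dd_zero dd_add dd_csc spolys_diff_superfuns dd_diff_superfuns mult.commute)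

text \<open>Up to conjugation by the Gaussian, \<open>rr l\<close> is the raising operator \<open>xx l + dd l\<close>.\<close>

definition rr :: "gen \<Rightarrow> scalar_superfun \<Rightarrow> scalar_superfun" where
  "rr l f = csc 2 (xx l f) + dd l f"

lemma spolys_rr: "f \<in> spolys m n \<Longrightarrow> l \<in> gens m n \<Longrightarrow> rr l f \<in> spolys m n"
  unfolding rr_def by (intro spolys.add spolys.csc spolys.xx spolys_dd)

lemma rr_linear:
  shows rr_add: "f \<in> spolys m n \<Longrightarrow> g \<in> spolys m n \<Longrightarrow> rr l (f + g) = rr l f + rr l g"
    and rr_csc: "f \<in> spolys m n \<Longrightarrow> rr l (csc c f) = csc c (rr l f)"
    and rr_sum: "(\<And>i. i \<in> I \<Longrightarrow> F i \<in> spolys m n) \<Longrightarrow> rr l (\<Sum>i\<in>I. F i) = (\<Sum>i\<in>I. rr l (F i))"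
  by (auto simp: rr_def dd_add dd_csc spolys_diff_superfuns mult.commute dd_sum[of I F m n] xx_sum csc_sum sum.distrib)

lemma rr_zero: "rr l 0 = 0"
  by (simp add: rr_def dd_zero)

lemma dd_rr:
  assumes "f \<in> spolys m n"
  shows "dd l (rr l' f) = csc (2 * omega l l') f + csc (ss l l') (rr l' (dd l f))"
  using spolys_diff_superfuns[OF assms] spolys_diff_superfuns[OF spolys_dd[OF assms]]
  by (simp add: rr_def dd_add dd_csc dd_xx dd_dd[OF assms, of l l'] partial_x_csc mult.commute)

text \<open>The two orders of composition leave \<open>2 * omega l l'\<close> on one side and
  \<open>2 * ss l l' * omega l' l\<close> on the other; these agree by the symmetry of
  \<open>omega\<close>.\<close>

lemma rr_rr:
  assumes "f \<in> spolys m n" "l \<in> gens m n" "l' \<in> gens m n"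
  shows "rr l (rr l' f) = csc (ss l l') (rr l' (rr l f))"
proof -
  have "xx l (rr l' f) = csc (2 * ss l l') (xx l' (xx l f)) + xx l (dd l' f)"
    by (simp add: rr_def xx_xx[of l l'])
  then have "rr l (rr l' f) = csc (4 * ss l l') (xx l' (xx l f)) + csc 2 (xx l (dd l' f)) +
     csc (2 * omega l l') f + csc (2 * ss l l') (xx l' (dd l f)) + csc (ss l l') (dd l' (dd l f))"
    by (subst rr_def) (simp add: dd_rr[OF assms(1)], simp add: rr_def dd_dd[OF assms(1), of l' l] ss_commute[of l' l] mult_ac)
  moreover have "csc (ss l l') (rr l' (rr l f)) = csc (4 * ss l l') (xx l' (xx l f)) + csc (2 * ss l l') (xx l' (dd l f)) +
     csc (2 * (ss l l' * omega l' l)) f + csc 2 (xx l (dd l' f)) + csc (ss l l') (dd l' (dd l f))"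
    by (subst rr_def) (simp add: dd_rr[OF assms(1)], simp add: rr_def ss_commute[of l' l] mult_ac,
      rule dd_dd[OF assms(1)])
  ultimately show ?thesis using omega_swap[OF assms(2,3)] by (simp add: add_ac)
qed

text \<open>Normalised by \<open>kap_om\<close>, so that each raising operator increases the
  eigenvalue of \<open>numop\<close> by 4. The same constants stand on the right-hand sides of the
  relations of C, which is why they reappear in the square of the Dirac operator.\<close>

fun kap :: "gen \<Rightarrow> complex" where
  "kap (E i) = -2"
| "kap (G j) = (if even j then -1 else 1)"

lemma kap_om: "l \<in> gens m n \<Longrightarrow> kap l * om (partner l) = 2"
  by (cases rule: gens_cases) auto

text \<open>Four times the Euler operator plus twice the Laplace operator: up to conjugation by the Gaussian,
  the number operator of a harmonic oscillator.\<close>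

definition numop :: "nat \<Rightarrow> nat \<Rightarrow> scalar_superfun \<Rightarrow> scalar_superfun" where
  "numop m n f = (\<Sum>l\<in>gens m n. csc (kap l) (rr l (dd (partner l) f)))"

lemma numop_linear:
  shows numop_add: "f \<in> spolys m n \<Longrightarrow> g \<in> spolys m n \<Longrightarrow> numop m n (f + g) = numop m n f + numop m n g"
    and numop_csc: "f \<in> spolys m n \<Longrightarrow> numop m n (csc c f) = csc c (numop m n f)"
proof -
  show "numop m n (f + g) = numop m n f + numop m n g" if "f \<in> spolys m n" "g \<in> spolys m n"
    using that by (simp add: numop_def dd_add rr_add[of _ m n] spolys_diff_superfuns spolys_dd sum.distrib)
  show "numop m n (csc c f) = csc c (numop m n f)" if "f \<in> spolys m n"
    using that by (simp add: numop_def dd_csc rr_csc[of _ m n] spolys_diff_superfuns spolys_dd csc_sum mult.commute)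
qed

lemma numop_zero: "numop m n 0 = 0"
  using numop_csc[OF spolys.one, of m n 0] by simp

lemma numop_sum: "(\<And>i. i \<in> I \<Longrightarrow> f i \<in> spolys m n) \<Longrightarrow> numop m n (\<Sum>i\<in>I. f i) = (\<Sum>i\<in>I. numop m n (f i))"
  by (induction I rule: infinite_finite_induct) (auto simp: numop_zero numop_add spolys_sum)

text \<open>Pulling \<open>rr k\<close> out to the left passes \<open>dd (partner l)\<close> and
  \<open>rr l\<close>. Both exchanges have the sign \<open>ss l k\<close>, so the signs cancel, and
  the commutator survives only for \<open>l = k\<close>, with the constant
  \<open>2 * kap l * om (partner l) = 4\<close>.\<close>

lemma numop_rr:
  assumes f: "f \<in> spolys m n" and k: "k \<in> gens m n"
  shows "numop m n (rr k f) = csc 4 (rr k f) + rr k (numop m n f)"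
proof -
  have *: "csc (kap l) (rr l (dd (partner l) (rr k f))) =
     (if l = k then csc 4 (rr k f) else 0) + rr k (csc (kap l) (rr l (dd (partner l) f)))"
    if l: "l \<in> gens m n" for l
  proof -
    have dp: "dd (partner l) f \<in> spolys m n" using f by (rule spolys_dd)
    have "rr l (dd (partner l) (rr k f)) =
       csc (2 * omega (partner l) k) (rr l f) + csc (ss l k) (rr l (rr k (dd (partner l) f)))"
      by (simp add: dd_rr[OF f] rr_add[of _ m n] rr_csc[of _ m n] spolys.csc f spolys_rr k dp)
    also have "csc (ss l k) (rr l (rr k (dd (partner l) f))) = rr k (rr l (dd (partner l) f))"
      by (simp add: rr_rr[OF dp l k])
    finally have "csc (kap l) (rr l (dd (partner l) (rr k f))) =
       csc (2 * (kap l * omega (partner l) k)) (rr l f) + rr k (csc (kap l) (rr l (dd (partner l) f)))"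
      by (simp add: rr_csc[of _ m n] spolys_rr l dp mult_ac)
    moreover have "kap l * omega (partner l) k = (if l = k then 2 else 0)"
      using kap_om[OF l] l by (auto simp: omega_def)
    ultimately show ?thesis by auto
  qed
  have "numop m n (rr k f) = (\<Sum>l\<in>gens m n. if l = k then csc 4 (rr k f) else 0) +
    (\<Sum>l\<in>gens m n. rr k (csc (kap l) (rr l (dd (partner l) f))))"
    unfolding numop_def sum.distrib[symmetric] by (rule sum.cong) (simp_all add: *)
  also have "(\<Sum>l\<in>gens m n. rr k (csc (kap l) (rr l (dd (partner l) f)))) = rr k (numop m n f)"
    unfolding numop_def
    by (rule rr_sum[of _ _ m n, symmetric]) (auto intro!: spolys.csc spolys_rr spolys_dd f)
  finally show ?thesis using k by simp
qed

lemma numop_one: "numop m n 1 = 0"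
  by (simp add: numop_def dd_one rr_zero)

section \<open>Super Hermite polynomials and the spectrum of the number operator\<close>

inductive hermite :: "nat \<Rightarrow> nat \<Rightarrow> nat \<Rightarrow> scalar_superfun \<Rightarrow> bool" for m n where
  zero: "hermite m n d 0"
| one: "hermite m n 0 1"
| add: "hermite m n d p \<Longrightarrow> hermite m n d q \<Longrightarrow> hermite m n d (p + q)"
| csc: "hermite m n d p \<Longrightarrow> hermite m n d (csc c p)"
| rr: "hermite m n d p \<Longrightarrow> l \<in> gens m n \<Longrightarrow> hermite m n (Suc d) (rr l p)"

lemma hermite_spolys: "hermite m n d p \<Longrightarrow> p \<in> spolys m n"
  by (induction rule: hermite.induct) (auto intro: spolys.intros spolys_rr spolys_0)

lemma hermite_numop: "hermite m n d p \<Longrightarrow> numop m n p = csc (4 * of_nat d) p"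
proof (induction rule: hermite.induct)
  case (rr d p l)
  then show ?case using hermite_spolys[OF rr.hyps(1)]
    by (simp add: numop_rr rr_csc distrib_left csc_add)
qed (auto simp: numop_zero numop_one numop_add numop_csc hermite_spolys mult.commute)

inductive_set hermite_span :: "nat \<Rightarrow> nat \<Rightarrow> scalar_superfun set" for m n where
  zero: "0 \<in> hermite_span m n"
| step: "hermite m n d p \<Longrightarrow> u \<in> hermite_span m n \<Longrightarrow> p + u \<in> hermite_span m n"

lemma hermite_span_base: "hermite m n d p \<Longrightarrow> p \<in> hermite_span m n"
  using hermite_span.step[OF _ hermite_span.zero] by force

lemma hermite_span_add: "u \<in> hermite_span m n \<Longrightarrow> v \<in> hermite_span m n \<Longrightarrow> u + v \<in> hermite_span m n"
  by (induction rule: hermite_span.induct) (auto simp: add.assoc intro: hermite_span.step)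

lemma hermite_span_csc: "u \<in> hermite_span m n \<Longrightarrow> csc c u \<in> hermite_span m n"
  by (induction rule: hermite_span.induct) (auto intro: hermite_span.intros hermite.csc)

lemma hermite_span_spolys: "u \<in> hermite_span m n \<Longrightarrow> u \<in> spolys m n"
  by (induction rule: hermite_span.induct) (auto intro: spolys_0 spolys.add hermite_spolys)

lemma hermite_span_rr: "u \<in> hermite_span m n \<Longrightarrow> l \<in> gens m n \<Longrightarrow> rr l u \<in> hermite_span m n"
proof (induction rule: hermite_span.induct)
  case zero
  then show ?case by (simp add: rr_zero hermite_span.zero)
next
  case (step d p u)
  then show ?case
    by (auto simp: rr_add[OF hermite_spolys[OF step.hyps(1)] hermite_span_spolys[OF step.hyps(2)]]
      intro: hermite_span.intros hermite.rr)
qed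

lemma hermite_diff_superfuns: "hermite m n d p \<Longrightarrow> p \<in> diff_superfuns"
  using hermite_spolys spolys_diff_superfuns by blast

lemma hermite_dd: "hermite m n d p \<Longrightarrow> dd l p \<in> hermite_span m n"
proof (induction rule: hermite.induct)
  case (rr d p k)
  then show ?case
    by (auto simp: dd_rr[OF hermite_spolys[OF rr.hyps(1)]]
      intro!: hermite_span_add hermite_span_csc hermite_span_rr hermite_span_base[OF rr.hyps(1)])
qed (auto simp: dd_one dd_zero dd_add dd_csc hermite_diff_superfuns
  intro: hermite_span_add hermite_span_csc hermite_span.zero)

lemma hermite_span_dd: "u \<in> hermite_span m n \<Longrightarrow> dd l u \<in> hermite_span m n"
  by (induction rule: hermite_span.induct)
   (auto simp: dd_zero dd_add hermite_diff_superfuns spolys_diff_superfuns[OF hermite_span_spolys] hermite_dd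
     intro: hermite_span_add hermite_span.zero)

text \<open>Multiplication is \<open>xx l = (rr l - dd l) / 2\<close>, and the span is stable under
  \<open>dd l\<close> because \<open>dd_rr\<close> moves it through the raising operators until it
  meets \<open>1\<close>.\<close>

lemma spolys_hermite_span: "f \<in> spolys m n \<Longrightarrow> f \<in> hermite_span m n"
proof (induction rule: spolys.induct)
  case (xx f l)
  have "xx l f = csc (1/2) (rr l f + csc (-1) (dd l f))"
    by (simp add: rr_def csc_minus)
  then show ?case
    using xx by (auto intro!: hermite_span_add hermite_span_csc hermite_span_rr hermite_span_dd simp del: csc_simps)
qed (auto intro: hermite_span_add hermite_span_csc hermite_span_base hermite.one)

lemma hermite_span_sum:
  "u \<in> hermite_span m n \<Longrightarrow> \<exists>D P. (\<forall>d. hermite m n d (P d)) \<and> u = (\<Sum>d<D. P d)"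
proof (induction rule: hermite_span.induct)
  case zero
  show ?case by (rule exI[of _ 0], rule exI[of _ "\<lambda>_. 0"]) (simp add: hermite.zero)
next
  case (step e p u)
  then obtain D P where P: "\<And>d. hermite m n d (P d)" "u = (\<Sum>d<D. P d)" by blast
  \<comment> \<open>The component of degree \<open>e\<close> may lie beyond the old bound, so the
    range is enlarged and the old components are continued by zero.\<close>
  define D' where "D' = max D (Suc e)"
  define P' where "P' d = (if d < D then P d else 0) + (if d = e then p else 0)" for d
  have "(\<Sum>d<D'. if d < D then P d else 0) = (\<Sum>d<D. P d)"
    by (rule sum.mono_neutral_cong_right) (auto simp: D'_def)
  moreover have "(\<Sum>d<D'. if d = e then p else 0) = p"
  proof -
    have "e < D'" by (simp add: D'_def)
    then show ?thesis by simp
  qed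
  ultimately have "p + u = (\<Sum>d<D'. P' d)"
    unfolding P'_def by (simp add: sum.distrib P(2))
  moreover have "hermite m n d (P' d)" for d
    unfolding P'_def using P(1) step.hyps(1) by (auto intro: hermite.add hermite.zero)
  ultimately show ?case by blast
qed

text \<open>Applying \<open>numop\<close> minus the eigenvalue \<open>4 * e\<close> removes the
  component at \<open>e\<close> and multiplies every other one by a nonzero number, which leaves a
  smaller index set.\<close>

lemma numop_eigen_independent:
  assumes "finite S" "\<And>d. d \<in> S \<Longrightarrow> P d \<in> spolys m n"
    "\<And>d. d \<in> S \<Longrightarrow> numop m n (P d) = csc (4 * of_nat d) (P d)" "(\<Sum>d\<in>S. P d) = 0" "d \<in> S"
  shows "P d = 0"
  using assms
proof (induction S arbitrary: P d rule: finite_induct)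
  case (insert e S)
  have zero: "csc (4 * of_nat d - 4 * of_nat e) (P d) = 0" if "d \<in> S" for d
  proof (rule insert.IH[of "\<lambda>d. csc (4 * of_nat d - 4 * of_nat e) (P d)"])
    fix c assume c: "c \<in> S"
    show "csc (4 * of_nat c - 4 * of_nat e) (P c) \<in> spolys m n" using c insert.prems by (auto intro: spolys.csc)
    show "numop m n (csc (4 * of_nat c - 4 * of_nat e) (P c)) =
      csc (4 * of_nat c) (csc (4 * of_nat c - 4 * of_nat e) (P c))"
      using c insert.prems by (simp add: numop_csc mult.commute)
  next
    have "(\<Sum>d\<in>insert e S. csc (4 * of_nat d - 4 * of_nat e) (P d)) =
      (\<Sum>d\<in>insert e S. numop m n (P d)) - csc (4 * of_nat e) (\<Sum>d\<in>insert e S. P d)"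
      unfolding csc_sum sum_subtractf[symmetric]
      by (rule sum.cong) (use insert.prems in \<open>auto simp: csc_diff\<close>)
    also have "(\<Sum>d\<in>insert e S. numop m n (P d)) = numop m n (\<Sum>d\<in>insert e S. P d)"
      using insert.prems by (intro numop_sum[symmetric]) auto
    finally have "(\<Sum>d\<in>insert e S. csc (4 * of_nat d - 4 * of_nat e) (P d)) = 0"
      unfolding insert.prems(3) by (simp add: numop_zero)
    then show "(\<Sum>d\<in>S. csc (4 * of_nat d - 4 * of_nat e) (P d)) = 0"
      using insert.hyps by simp
  qed (use that in auto)
  have S: "P d = 0" if "d \<in> S" for d
  proof (rule csc_eq_0[OF zero[OF that]])
    have "d \<noteq> e" using that insert.hyps by auto
    then show "4 * of_nat d - 4 * of_nat e \<noteq> (0::complex)" by simp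
  qed
  then have "P e = 0" using insert.prems(3) insert.hyps by simp
  then show ?case using S insert.prems(4) by auto
qed simp

text \<open>The eigenvalue equation says that the components rescaled by
  \<open>4 * d - 4 * k\<close> add up to zero. By independence each rescaled component vanishes, so
  only degree \<open>k\<close> remains.\<close>

lemma numop_eigen_hermite:
  assumes h: "h \<in> spolys m n" and e: "numop m n h = csc (4 * of_nat k) h"
  shows "hermite m n k h"
proof -
  obtain D P where P: "\<And>d. hermite m n d (P d)" "h = (\<Sum>d<D. P d)"
    using hermite_span_sum[OF spolys_hermite_span[OF h]] by blast
  have "(\<Sum>d<D. csc (4 * of_nat d - 4 * of_nat k) (P d)) = numop m n h - csc (4 * of_nat k) h"
    unfolding P(2) csc_sum
    by (subst numop_sum[of _ _ m n])
      (simp_all only: hermite_spolys[OF P(1)] hermite_numop[OF P(1)] sum_subtractf[symmetric] csc_diff)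
  then have "(\<Sum>d<D. csc (4 * of_nat d - 4 * of_nat k) (P d)) = 0" using e by simp
  then have "csc (4 * of_nat d - 4 * of_nat k) (P d) = 0" if "d < D" for d
    using that hermite_numop[OF hermite.csc[OF P(1)]] hermite_spolys[OF P(1)]
    by (intro numop_eigen_independent[of "{..<D}" "\<lambda>d. csc (4 * of_nat d - 4 * of_nat k) (P d)" m n])
      (auto intro: spolys.csc simp del: csc_simps)
  then have "P d = 0" if "d < D" "d \<noteq> k" for d
    using that by (intro csc_eq_0[of _ "P d"]) auto
  then have "h = (if k < D then P k else 0)"
    unfolding P(2) by (simp add: sum.remove[of "{..<D}" k])
  then show ?thesis using P(1) hermite.zero by auto
qed

section \<open>The Fourier transform of monomials times the Gaussian\<close>

definition gmono :: "nat \<Rightarrow> real \<Rightarrow> complex" where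
  "gmono a x = of_real (x ^ a * exp (- x\<^sup>2 / 2))"

text \<open>The exponent has a plus sign because the bosonic part of the pairing is negative, which
  cancels the minus sign in the definition of the transform.\<close>

definition fkernel :: "real \<Rightarrow> real \<Rightarrow> complex" where
  "fkernel \<sigma> t = exp (\<i> * of_real \<sigma> * of_real t)"

definition gft :: "real \<Rightarrow> nat \<Rightarrow> real \<Rightarrow> complex" where
  "gft \<sigma> a y = of_real (1 / sqrt (2 * pi)) * (LINT x|lborel. fkernel \<sigma> (x * y) * gmono a x)"

lemma norm_fkernel [simp]: "norm (fkernel \<sigma> t) = 1"
  by (simp add: fkernel_def norm_exp_eq_Re)

lemma gmono_integrable: "integrable lborel (gmono a)"
proof -
  have "integrable lborel (\<lambda>x. sqrt (2 * pi) * (std_normal_density x * x ^ a))"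
    by (intro integrable_mult_right integrable_std_normal_moment)
  also have "(\<lambda>x. sqrt (2 * pi) * (std_normal_density x * x ^ a)) = (\<lambda>x. x ^ a * exp (- x\<^sup>2 / 2))"
    by (simp add: std_normal_density_def fun_eq_iff)
  finally have "integrable lborel (\<lambda>x. complex_of_real (x ^ a * exp (- x\<^sup>2 / 2)))"
    by (rule integrable_of_real)
  then show ?thesis by (simp add: gmono_def[abs_def])
qed

lemma fkernel_measurable [measurable]: "fkernel \<sigma> \<in> borel_measurable borel"
  unfolding fkernel_def[abs_def] by (intro borel_measurable_continuous_onI continuous_intros)

lemma fkernel_gmono_integrable: "integrable lborel (\<lambda>x. fkernel \<sigma> (x * y) * gmono a x)"
proof (rule Bochner_Integration.integrable_bound[OF gmono_integrable[of a]])
  have [measurable]: "gmono a \<in> borel_measurable borel"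
    using gmono_integrable[of a] by (simp add: integrable_iff_bounded)
  show "(\<lambda>x. fkernel \<sigma> (x * y) * gmono a x) \<in> borel_measurable lborel" by measurable
qed (simp add: norm_mult)

text \<open>The integral is the characteristic function of the standard normal distribution at
  \<open>\<sigma> * y\<close>, and the hypothesis removes \<sigma> from the square.\<close>

lemma gft_0:
  assumes "\<sigma>\<^sup>2 = 1"
  shows "gft \<sigma> 0 y = gmono 0 y"
proof -
  have "char std_normal_distribution (\<sigma> * y) = (LINT x|lborel. std_normal_density x *\<^sub>R exp (\<i> * of_real (\<sigma> * y * x)))"
    unfolding char_def by (subst integral_density) auto
  also have "\<dots> = (LINT x|lborel. of_real (1 / sqrt (2 * pi)) * (fkernel \<sigma> (x * y) * gmono 0 x))"
    by (simp add: std_normal_density_def fkernel_def gmono_def scaleR_conv_of_real mult_ac)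
  also have "\<dots> = gft \<sigma> 0 y"
    unfolding gft_def by (rule integral_mult_right_zero)
  finally show ?thesis
    by (simp add: char_std_normal_distribution gmono_def power_mult_distrib assms)
qed

lemma gmono_has_vector_derivative:
  "(gmono a has_vector_derivative (of_nat a * gmono (a - 1) x - gmono (a + 1) x)) (at x)"
proof -
  have "((\<lambda>x. x ^ a * exp (- x\<^sup>2 / 2)) has_real_derivative
      of_nat a * (x ^ (a - 1) * exp (- x\<^sup>2 / 2)) - x ^ (a + 1) * exp (- x\<^sup>2 / 2)) (at x)"
    by (auto intro!: derivative_eq_intros simp: field_simps power2_eq_square)
  from has_vector_derivative_of_real[OF this]
  show ?thesis unfolding gmono_def[abs_def] by simp
qed

lemma fkernel_has_vector_derivative:
  "((\<lambda>x. fkernel \<sigma> (x * y)) has_vector_derivative (\<i> * of_real \<sigma> * of_real y * fkernel \<sigma> (x * y))) (at x)"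
proof -
  have "((\<lambda>z. exp (\<i> * of_real \<sigma> * of_real y * z)) has_field_derivative
     \<i> * of_real \<sigma> * of_real y * exp (\<i> * of_real \<sigma> * of_real y * of_real x)) (at (of_real x))"
    by (auto intro!: derivative_eq_intros)
  from has_vector_derivative_real_field[OF this] show ?thesis
    by (simp add: fkernel_def mult_ac)
qed

lemma gmono_tendsto: "((\<lambda>x. fkernel \<sigma> (x * y) * gmono a x) \<longlongrightarrow> 0) at_top"
  "((\<lambda>x. fkernel \<sigma> (x * y) * gmono a x) \<longlongrightarrow> 0) at_bot"
proof -
  have 1: "((\<lambda>x. x ^ a * exp (- x\<^sup>2 / 2)) \<longlongrightarrow> (0::real)) at_top"
    by real_asymp
  have 2: "norm (fkernel \<sigma> (x * y) * gmono a x) = \<bar>x\<bar> ^ a * exp (- \<bar>x\<bar>\<^sup>2 / 2)" for x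
    by (simp add: norm_mult norm_power gmono_def)
  show "((\<lambda>x. fkernel \<sigma> (x * y) * gmono a x) \<longlongrightarrow> 0) at_top"
    by (rule tendsto_norm_zero_cancel, unfold 2, rule filterlim_compose[OF 1 filterlim_abs_real])
  have 3: "filterlim (\<lambda>x::real. \<bar>x\<bar>) at_top at_bot"
    by real_asymp
  show "((\<lambda>x. fkernel \<sigma> (x * y) * gmono a x) \<longlongrightarrow> 0) at_bot"
    by (rule tendsto_norm_zero_cancel, unfold 2, rule filterlim_compose[OF 1 3])
qed

text \<open>Integration by parts: the product of the kernel and \<open>gmono a\<close> vanishes at
  both ends, so its derivative has integral zero. For \<open>a = 0\<close> the index
  \<open>a - 1\<close> is harmless, since its coefficient is zero.\<close>

lemma gft_Suc:
  "gft \<sigma> (Suc a) y = of_nat a * gft \<sigma> (a - 1) y + \<i> * of_real \<sigma> * of_real y * gft \<sigma> a y"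
proof -
  let ?K = "\<lambda>x. fkernel \<sigma> (x * y)" and ?s = "\<i> * of_real \<sigma> * of_real y"
  let ?f = "\<lambda>x. of_nat a * (?K x * gmono (a - 1) x) - ?K x * gmono (Suc a) x + ?s * (?K x * gmono a x)"
  note int = fkernel_gmono_integrable[of \<sigma> y]
  have cont: "isCont (\<lambda>x. ?K x * gmono b x) x" for b x
    unfolding fkernel_def gmono_def by (intro continuous_intros) simp
  have intf: "integrable lborel ?f"
    by (intro Bochner_Integration.integrable_add Bochner_Integration.integrable_diff integrable_mult_right int)
  have "(LBINT x=-\<infinity>..\<infinity>. ?f x) = 0 - 0"
  proof (rule interval_integral_FTC_integrable[where F = "\<lambda>x. ?K x * gmono a x"])
    fix x
    show "((\<lambda>x. ?K x * gmono a x) has_vector_derivative ?f x) (at x)"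
      by (rule has_vector_derivative_eq_rhs[OF has_vector_derivative_mult[OF fkernel_has_vector_derivative gmono_has_vector_derivative]])
        (simp add: algebra_simps)
    show "isCont ?f x" by (intro continuous_intros cont)
  next
    show "set_integrable lborel (einterval (-\<infinity>) \<infinity>) ?f"
      using intf by (simp add: set_integrable_def)
    show "(((\<lambda>x. ?K x * gmono a x) \<circ> real_of_ereal) \<longlongrightarrow> 0) (at_right (-\<infinity>))"
      using gmono_tendsto(2) by (simp add: ereal_tendsto_simps)
    show "(((\<lambda>x. ?K x * gmono a x) \<circ> real_of_ereal) \<longlongrightarrow> 0) (at_left \<infinity>)"
      using gmono_tendsto(1) by (simp add: ereal_tendsto_simps)
  qed simp
  then have "(LINT x|lborel. ?f x) = 0"
    by (simp add: interval_lebesgue_integral_def set_lebesgue_integral_def)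
  moreover have "(LINT x|lborel. ?f x) = of_nat a * (LINT x|lborel. ?K x * gmono (a - 1) x) -
     (LINT x|lborel. ?K x * gmono (Suc a) x) + ?s * (LINT x|lborel. ?K x * gmono a x)"
    by (subst Bochner_Integration.integral_add Bochner_Integration.integral_diff;
        (intro Bochner_Integration.integrable_diff integrable_mult_right int)?)+ simp
  ultimately have "(LINT x|lborel. ?K x * gmono (Suc a) x) = of_nat a * (LINT x|lborel. ?K x * gmono (a - 1) x) +
     ?s * (LINT x|lborel. ?K x * gmono a x)"
    by (simp add: algebra_simps)
  then show ?thesis unfolding gft_def by (simp only: distrib_left) (simp add: mult_ac)
qed

text \<open>Differentiation under the integral sign is avoided. The transform of degree 0 is
  explicit, and the recursion \<open>gft_Suc\<close> expresses higher degrees by lower ones, so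
  induction suffices.\<close>

lemma gft_has_vector_derivative:
  assumes "\<sigma>\<^sup>2 = 1"
  shows "(gft \<sigma> a has_vector_derivative (\<i> * of_real \<sigma> * gft \<sigma> (Suc a) y)) (at y)"
proof (induction a arbitrary: y rule: less_induct)
  case (less a)
  have s: "\<i> * of_real \<sigma> * (\<i> * of_real \<sigma>) = -1"
    using assms by (simp add: power_mult_distrib flip: power2_eq_square of_real_power)
  then have s': "\<i> * of_real \<sigma> * (\<i> * of_real \<sigma> * c) = - c" for c
    by (metis (no_types, lifting) mult.assoc mult_minus1)
  show ?case
  proof (cases a)
    case 0
    have "gft \<sigma> 0 = gmono 0" using gft_0[OF assms] by auto
    moreover have "gmono 1 y = of_real y * gmono 0 y" by (simp add: gmono_def)
    ultimately show ?thesis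
      using gmono_has_vector_derivative[of 0 y] s'
      by (simp add: 0 gft_Suc mult.assoc)
  next
    case (Suc b)
    have I: "((\<lambda>y. of_real y) has_vector_derivative (1::complex)) (at y)"
      using has_vector_derivative_of_real[OF DERIV_ident] by simp
    have D: "((\<lambda>y. of_nat b * gft \<sigma> (b - 1) y + \<i> * of_real \<sigma> * (of_real y * gft \<sigma> b y)) has_vector_derivative
       of_nat b * (\<i> * of_real \<sigma> * gft \<sigma> (Suc (b - 1)) y) +
         \<i> * of_real \<sigma> * (of_real y * (\<i> * of_real \<sigma> * gft \<sigma> (Suc b) y) + 1 * gft \<sigma> b y)) (at y)"
      by (intro has_vector_derivative_add has_vector_derivative_mult_right has_vector_derivative_mult less I)
        (auto simp: Suc)
    \<comment> \<open>For \<open>b = 0\<close> the truncated index \<open>Suc (b - 1)\<close>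
      differs from \<open>b\<close>, but then the coefficient is zero.\<close>
    have "of_nat b * (\<i> * of_real \<sigma> * gft \<sigma> (Suc (b - 1)) y) = of_nat b * (\<i> * of_real \<sigma> * gft \<sigma> b y)"
      by (cases b) auto
    then have "of_nat b * (\<i> * of_real \<sigma> * gft \<sigma> (Suc (b - 1)) y) +
         \<i> * of_real \<sigma> * (of_real y * (\<i> * of_real \<sigma> * gft \<sigma> (Suc b) y) + 1 * gft \<sigma> b y) =
       \<i> * of_real \<sigma> * gft \<sigma> (Suc a) y"
      unfolding Suc gft_Suc[of \<sigma> "Suc b"] by (simp add: algebra_simps)
    moreover have "(\<lambda>y. of_nat b * gft \<sigma> (b - 1) y + \<i> * of_real \<sigma> * (of_real y * gft \<sigma> b y)) = gft \<sigma> a"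
      by (auto simp: Suc gft_Suc mult.assoc)
    ultimately show ?thesis using D by simp
  qed
qed

subsection \<open>Several variables\<close>

definition gmonom :: "nat \<Rightarrow> (nat \<Rightarrow> nat) \<Rightarrow> (nat \<Rightarrow> real) \<Rightarrow> complex" where
  "gmonom m \<alpha> x = (\<Prod>i\<in>{1..m}. gmono (\<alpha> i) (x i))"

text \<open>The polynomials times the Gaussian. On the generators the Fourier integral factorises
  into one-variable integrals, and the rules for the transform extend linearly.\<close>

inductive_set gpolys :: "nat \<Rightarrow> ((nat \<Rightarrow> real) \<Rightarrow> complex) set" for m where
  gmonom: "gmonom m \<alpha> \<in> gpolys m"
| add: "f \<in> gpolys m \<Longrightarrow> g \<in> gpolys m \<Longrightarrow> (\<lambda>x. f x + g x) \<in> gpolys m"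
| scale: "f \<in> gpolys m \<Longrightarrow> (\<lambda>x. c * f x) \<in> gpolys m"

text \<open>The factor is the purely bosonic \<open>(2 * pi) powr (- m / 2)\<close>; the rest of the
  super normalisation is assigned to the fermionic transform.\<close>

definition ft :: "real \<Rightarrow> nat \<Rightarrow> ((nat \<Rightarrow> real) \<Rightarrow> complex) \<Rightarrow> (nat \<Rightarrow> real) \<Rightarrow> complex" where
  "ft \<sigma> m f y = of_real (1 / sqrt (2 * pi)) ^ m *
     (LINT x|PiM {1..m} (\<lambda>_. lborel). fkernel \<sigma> (\<Sum>i=1..m. x i * y i) * f x)"

lemma fkernel_sum: "fkernel \<sigma> (\<Sum>i\<in>I. f i) = (\<Prod>i\<in>I. fkernel \<sigma> (f i))"
  by (cases "finite I") (simp_all add: fkernel_def sum_distrib_left exp_sum)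

interpretation lborel_product: product_sigma_finite "\<lambda>_::nat. lborel :: real measure"
  by standard

lemma fkernel_gmonom:
  "fkernel \<sigma> (\<Sum>i=1..m. x i * y i) * gmonom m \<alpha> x = (\<Prod>i\<in>{1..m}. fkernel \<sigma> (x i * y i) * gmono (\<alpha> i) (x i))"
  by (simp add: fkernel_sum gmonom_def prod.distrib)

lemma gpolys_integrable:
  "f \<in> gpolys m \<Longrightarrow> integrable (PiM {1..m} (\<lambda>_. lborel)) (\<lambda>x. fkernel \<sigma> (\<Sum>i=1..m. x i * y i) * f x)"
proof (induction rule: gpolys.induct)
  case (gmonom \<alpha>)
  show ?case unfolding fkernel_gmonom
    by (rule lborel_product.product_integrable_prod) (simp_all add: fkernel_gmono_integrable)
next
  case (scale f c)
  have "integrable (PiM {1..m} (\<lambda>_. lborel)) (\<lambda>x. c * (fkernel \<sigma> (\<Sum>i=1..m. x i * y i) * f x))"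
    by (rule integrable_mult_right) (use scale in blast)
  then show ?case by (simp add: mult_ac)
qed (simp add: distrib_left)

lemma ft_gmonom: "ft \<sigma> m (gmonom m \<alpha>) y = (\<Prod>i\<in>{1..m}. gft \<sigma> (\<alpha> i) (y i))"
  unfolding ft_def fkernel_gmonom gft_def
  by (subst lborel_product.product_integral_prod) (simp_all add: fkernel_gmono_integrable prod_dividef power_divide)

lemma ft_gmonom_split:
  assumes "i \<in> {1..m}"
  shows "ft \<sigma> m (gmonom m \<alpha>) y = gft \<sigma> (\<alpha> i) (y i) * (\<Prod>k\<in>{1..m}-{i}. gft \<sigma> (\<alpha> k) (y k))"
  unfolding ft_gmonom using assms by (intro prod.remove) auto

lemma ft_add:
  "f \<in> gpolys m \<Longrightarrow> g \<in> gpolys m \<Longrightarrow> ft \<sigma> m (\<lambda>x. f x + g x) y = ft \<sigma> m f y + ft \<sigma> m g y"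
  unfolding ft_def distrib_left[of "fkernel _ _"]
  by (subst Bochner_Integration.integral_add[OF gpolys_integrable gpolys_integrable]) (auto simp: distrib_left)

lemma ft_scale: "ft \<sigma> m (\<lambda>x. c * f x) y = c * ft \<sigma> m f y"
proof -
  have "(\<lambda>x. fkernel \<sigma> (\<Sum>i=1..m. x i * y i) * (c * f x)) = (\<lambda>x. c * (fkernel \<sigma> (\<Sum>i=1..m. x i * y i) * f x))"
    by (simp add: mult_ac)
  then show ?thesis unfolding ft_def by (simp only: integral_mult_right_zero) (simp add: mult_ac)
qed

lemma gmonom_split:
  assumes "i \<in> {1..m}"
  shows "gmonom m \<alpha> x = gmono (\<alpha> i) (x i) * (\<Prod>k\<in>{1..m}-{i}. gmono (\<alpha> k) (x k))"
  unfolding gmonom_def using assms by (intro prod.remove) auto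

lemma gmono_Suc: "gmono (Suc a) x = of_real x * gmono a x"
  by (simp add: gmono_def)

lemma gmonom_mult:
  assumes "i \<in> {1..m}"
  shows "of_real (x i) * gmonom m \<alpha> x = gmonom m (\<alpha>(i := Suc (\<alpha> i))) x"
  by (simp add: gmonom_split[OF assms] gmono_Suc)

lemma gpolys_mult: "f \<in> gpolys m \<Longrightarrow> i \<in> {1..m} \<Longrightarrow> (\<lambda>x. of_real (x i) * f x) \<in> gpolys m"
proof (induction rule: gpolys.induct)
  case (add f g)
  then show ?case using gpolys.add[of "\<lambda>x. of_real (x i) * f x" m] by (simp add: distrib_left)
next
  case (scale f c)
  then show ?case using gpolys.scale[of "\<lambda>x. of_real (x i) * f x" m c] by (simp add: mult_ac)
qed (simp add: gmonom_mult gpolys.gmonom)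

lemma gpolys_zero: "(\<lambda>x. 0) \<in> gpolys m"
  using gpolys.scale[OF gpolys.gmonom, of 0] by simp

text \<open>The derivative is supplied as a member of \<open>gpolys\<close> together with its
  transform, so that \<open>ft_add\<close> is applicable to it in the induction. On a monomial the
  transform formula is the recursion \<open>gft_Suc\<close>.\<close>

lemma gpolys_derivative:
  assumes "f \<in> gpolys m" "i \<in> {1..m}"
  shows "\<exists>g\<in>gpolys m. (\<forall>x. ((\<lambda>t. f (x(i := t))) has_vector_derivative g x) (at (x i))) \<and>
     (\<forall>y. ft \<sigma> m g y = - (\<i> * of_real \<sigma> * of_real (y i)) * ft \<sigma> m f y)"
  using assms(1)
proof (induction rule: gpolys.induct)
  case (gmonom \<alpha>)
  define a where "a = \<alpha> i"
  define g where "g = (\<lambda>x. of_nat a * gmonom m (\<alpha>(i := a - 1)) x + (-1) * gmonom m (\<alpha>(i := Suc a)) x)"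
  have g: "g \<in> gpolys m" unfolding g_def by (intro gpolys.intros)
  have D: "((\<lambda>t. gmonom m \<alpha> (x(i := t))) has_vector_derivative g x) (at (x i))" for x
  proof -
    have "((\<lambda>t. gmono a t * (\<Prod>k\<in>{1..m}-{i}. gmono (\<alpha> k) (x k))) has_vector_derivative
      (of_nat a * gmono (a - 1) (x i) - gmono (a + 1) (x i)) * (\<Prod>k\<in>{1..m}-{i}. gmono (\<alpha> k) (x k))) (at (x i))"
      by (intro has_vector_derivative_mult_left gmono_has_vector_derivative)
    then show ?thesis
      by (simp add: gmonom_split[OF assms(2)] g_def a_def algebra_simps)
  qed
  have "ft \<sigma> m g y = - (\<i> * of_real \<sigma> * of_real (y i)) * ft \<sigma> m (gmonom m \<alpha>) y" for y
  proof -
    have "ft \<sigma> m g y = of_nat a * ft \<sigma> m (gmonom m (\<alpha>(i := a - 1))) y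
        + (-1) * ft \<sigma> m (gmonom m (\<alpha>(i := Suc a))) y"
      unfolding g_def
      by (subst ft_add) (intro gpolys.intros, intro gpolys.intros, simp only: ft_scale)
    then show ?thesis
      by (simp add: ft_gmonom_split[OF assms(2)] gft_Suc a_def algebra_simps)
  qed
  with g D show ?case by blast
next
  case (add f1 f2)
  then obtain g1 g2 where g: "g1 \<in> gpolys m" "g2 \<in> gpolys m"
    "\<And>x. ((\<lambda>t. f1 (x(i := t))) has_vector_derivative g1 x) (at (x i))"
    "\<And>x. ((\<lambda>t. f2 (x(i := t))) has_vector_derivative g2 x) (at (x i))"
    "\<And>y. ft \<sigma> m g1 y = - (\<i> * of_real \<sigma> * of_real (y i)) * ft \<sigma> m f1 y"
    "\<And>y. ft \<sigma> m g2 y = - (\<i> * of_real \<sigma> * of_real (y i)) * ft \<sigma> m f2 y"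
    by blast
  show ?case
    by (rule bexI[of _ "\<lambda>x. g1 x + g2 x"])
      (use g add.hyps in \<open>auto intro: has_vector_derivative_add gpolys.add simp: ft_add algebra_simps simp del: fun_upd_apply\<close>)
next
  case (scale f c)
  then obtain g where g: "g \<in> gpolys m"
    "\<And>x. ((\<lambda>t. f (x(i := t))) has_vector_derivative g x) (at (x i))"
    "\<And>y. ft \<sigma> m g y = - (\<i> * of_real \<sigma> * of_real (y i)) * ft \<sigma> m f y"
    by blast
  show ?case
    by (rule bexI[of _ "\<lambda>x. c * g x"])
      (use g in \<open>auto intro: has_vector_derivative_mult_right gpolys.scale simp: ft_scale simp del: fun_upd_apply\<close>)
qed

lemma ft_has_vector_derivative:
  assumes "f \<in> gpolys m" "i \<in> {1..m}" "\<sigma>\<^sup>2 = 1"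
  shows "((\<lambda>t. ft \<sigma> m f (y(i := t))) has_vector_derivative
     \<i> * of_real \<sigma> * ft \<sigma> m (\<lambda>x. of_real (x i) * f x) y) (at (y i))"
  using assms(1)
proof (induction rule: gpolys.induct)
  case (gmonom \<alpha>)
  have "((\<lambda>t. gft \<sigma> (\<alpha> i) t * (\<Prod>k\<in>{1..m}-{i}. gft \<sigma> (\<alpha> k) (y k))) has_vector_derivative
      (\<i> * of_real \<sigma> * gft \<sigma> (Suc (\<alpha> i)) (y i)) * (\<Prod>k\<in>{1..m}-{i}. gft \<sigma> (\<alpha> k) (y k))) (at (y i))"
    by (intro has_vector_derivative_mult_left gft_has_vector_derivative assms)
  then show ?case
    by (simp add: gmonom_mult[OF assms(2)] ft_gmonom_split[OF assms(2)] mult_ac)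
next
  case (add f g)
  have "ft \<sigma> m (\<lambda>x. of_real (x i) * (f x + g x)) y =
    ft \<sigma> m (\<lambda>x. of_real (x i) * f x) y + ft \<sigma> m (\<lambda>x. of_real (x i) * g x) y"
    using ft_add[OF gpolys_mult[OF add.hyps(1) assms(2)] gpolys_mult[OF add.hyps(2) assms(2)]]
    by (simp add: distrib_left)
  then show ?case
    using has_vector_derivative_add[OF add.IH] by (simp add: ft_add add.hyps distrib_left)
next
  case (scale f c)
  have "ft \<sigma> m (\<lambda>x. of_real (x i) * (c * f x)) y = c * ft \<sigma> m (\<lambda>x. of_real (x i) * f x) y"
    using ft_scale[of \<sigma> m c "\<lambda>x. of_real (x i) * f x" y] by (simp add: mult_ac)
  then show ?case
    using has_vector_derivative_mult_right[OF scale.IH, of c] by (simp add: ft_scale mult_ac)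
qed

lemma ft_gaussian:
  assumes "\<sigma>\<^sup>2 = 1"
  shows "ft \<sigma> m (gmonom m (\<lambda>_. 0)) y = gmonom m (\<lambda>_. 0) y"
  by (simp add: ft_gmonom gft_0[OF assms] gmonom_def)

section \<open>The Berezin part of the Fourier transform\<close>

text \<open>The pointwise form of \<open>dd (G l)\<close>, as \<open>dd_G\<close> states; the index
  may also belong to the second set of generators.\<close>

definition ddg :: "nat \<Rightarrow> grassmann \<Rightarrow> grassmann" where
  "ddg l g = (if even l then gconst 2 * gderiv (l - 1) g else gconst (-2) * gderiv (l + 1) g)"

definition in_gens :: "nat \<Rightarrow> grassmann set" where
  "in_gens n = {g. \<forall>A. \<not> A \<subseteq> {1..2*n} \<longrightarrow> gcoeff g A = 0}"

definition shift_ext :: "nat \<Rightarrow> nat set \<Rightarrow> nat set" where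
  "shift_ext n A = {1..2*n} \<union> (\<lambda>j. 2*n + j) ` A"

text \<open>The coefficients of \<open>\<theta>\<^sub>1 \<cdots> \<theta>\<^sub>2\<^sub>n\<close>, with the second set of generators renamed.\<close>

definition top_coeff :: "nat \<Rightarrow> grassmann \<Rightarrow> grassmann" where
  "top_coeff n X = Grassmann (\<lambda>A. if A \<subseteq> {1..2*n} then 2 ^ n * gcoeff X (shift_ext n A) else 0)"

lemma gcoeff_top_coeff:
  "gcoeff (top_coeff n X) A = (if A \<subseteq> {1..2*n} then 2 ^ n * gcoeff X (shift_ext n A) else 0)"
  unfolding top_coeff_def by (rule gcoeff_Grassmann) (auto dest: finite_subset)

lemma top_coeff_linear:
  "top_coeff n (X + Y) = top_coeff n X + top_coeff n Y"
  "top_coeff n (gconst c * X) = gconst c * top_coeff n X"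
  "top_coeff n 0 = 0"
  by (rule grassmann_eqI; simp add: gcoeff_top_coeff distrib_left)+

lemma top_coeff_in_gens: "top_coeff n X \<in> in_gens n"
  by (simp add: in_gens_def gcoeff_top_coeff)

lemma shift_ext_simps:
  assumes "A \<subseteq> {1..2*n}" "l \<in> {1..2*n}"
  shows "l \<in> shift_ext n A" "2*n + l \<in> shift_ext n A \<longleftrightarrow> l \<in> A"
    "shift_ext n A - {2*n + l} = shift_ext n (A - {l})"
    "insert (2*n + l) (shift_ext n A) = shift_ext n (insert l A)"
    "below (shift_ext n A) (2*n + l) = 2*n + below A l"
proof -
  show "l \<in> shift_ext n A" "2*n + l \<in> shift_ext n A \<longleftrightarrow> l \<in> A"
    "shift_ext n A - {2*n + l} = shift_ext n (A - {l})"
    "insert (2*n + l) (shift_ext n A) = shift_ext n (insert l A)"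
    using assms by (auto simp: shift_ext_def)
  have "{i \<in> shift_ext n A. i < 2*n + l} = {1..2*n} \<union> (\<lambda>j. 2*n + j) ` {i\<in>A. i < l}"
    using assms by (auto simp: shift_ext_def)
  moreover have "card ({1..2*n} \<union> (\<lambda>j. 2*n + j) ` {i\<in>A. i < l}) = 2*n + card {i\<in>A. i < l}"
    using assms finite_subset[OF assms(1)]
    by (subst card_Un_disjoint) (auto simp: card_image inj_on_def)
  ultimately show "below (shift_ext n A) (2*n + l) = 2*n + below A l"
    by (simp add: below_def)
qed

text \<open>The block of \<open>2 * n\<close> integrated generators has even length, so operators on
  the second set pass it without a sign. A derivative in an integrated generator has no coefficient
  containing that generator, which is the vanishing of the Berezin integral of a derivative.\<close>

lemma top_coeff_gens:
  assumes l: "l \<in> {1..2*n}"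
  shows "top_coeff n (theta (2*n + l) * X) = theta l * top_coeff n X"
    "top_coeff n (gderiv (2*n + l) X) = gderiv l (top_coeff n X)"
    "top_coeff n (gderiv l X) = 0"
proof -
  have 1: "A - {l} \<subseteq> {1..2*n} \<longleftrightarrow> A \<subseteq> {1..2*n}" "insert l A \<subseteq> {1..2*n} \<longleftrightarrow> A \<subseteq> {1..2*n}" for A
    using l by auto
  show "top_coeff n (theta (2*n + l) * X) = theta l * top_coeff n X"
  proof (rule grassmann_eqI)
    fix A show "gcoeff (top_coeff n (theta (2*n + l) * X)) A = gcoeff (theta l * top_coeff n X) A"
      by (cases "A \<subseteq> {1..2*n}")
        (simp_all add: gcoeff_top_coeff gcoeff_theta_mult shift_ext_simps[OF _ l] 1 power_add power_mult del: One_nat_def)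
  qed
  show "top_coeff n (gderiv (2*n + l) X) = gderiv l (top_coeff n X)"
  proof (rule grassmann_eqI)
    fix A show "gcoeff (top_coeff n (gderiv (2*n + l) X)) A = gcoeff (gderiv l (top_coeff n X)) A"
      by (cases "A \<subseteq> {1..2*n}")
        (simp_all add: gcoeff_top_coeff gcoeff_gderiv shift_ext_simps[OF _ l] 1 power_add power_mult del: One_nat_def insert_subset)
  qed
  show "top_coeff n (gderiv l X) = 0"
    by (rule grassmann_eqI) (auto simp: gcoeff_top_coeff gcoeff_gderiv shift_ext_simps[OF _ l])
qed

lemma gen_index_cases:
  fixes l n :: nat
  assumes "l \<in> {1..2*n}"
  obtains j where "l = 2 * j" "j \<in> {1..n}" | j where "l = 2 * j - 1" "j \<in> {1..n}"
  using gens_cases[of "G l" 0 n] assms by auto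

text \<open>The shift by \<open>2 * n\<close> preserves parity, so the same constant serves both
  sets of generators.\<close>

lemma ddg_gderiv:
  assumes "l \<in> {1..2*n}"
  obtains k c where "k \<in> {1..2*n}" "\<And>g. ddg l g = gconst c * gderiv k g"
    "\<And>g. ddg (2*n + l) g = gconst c * gderiv (2*n + k) g"
  using assms
proof (cases rule: gen_index_cases)
  case (1 j)
  have "2*n + l - 1 = 2*n + (l - 1)" "even l" "l - 1 \<in> {1..2*n}" using 1 by auto
  then show ?thesis by (intro that[of "l - 1" 2]) (simp_all only: ddg_def even_add even_mult_iff even_numeral simp_thms if_True)
next
  case (2 j)
  have "2*n + l + 1 = 2*n + (l + 1)" "odd l" "l + 1 \<in> {1..2*n}" using 2 by auto
  then show ?thesis by (intro that[of "l + 1" "-2"]) (simp_all only: ddg_def even_add even_mult_iff even_numeral simp_thms if_False)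
qed

lemma top_coeff_ddg:
  assumes l: "l \<in> {1..2*n}"
  shows "top_coeff n (ddg (2*n + l) X) = ddg l (top_coeff n X)" "top_coeff n (ddg l X) = 0"
proof -
  obtain k c where k: "k \<in> {1..2*n}" "\<And>g. ddg l g = gconst c * gderiv k g"
    "\<And>g. ddg (2*n + l) g = gconst c * gderiv (2*n + k) g"
    using ddg_gderiv[OF l] by blast
  show "top_coeff n (ddg (2*n + l) X) = ddg l (top_coeff n X)" "top_coeff n (ddg l X) = 0"
    unfolding k(2,3) top_coeff_linear top_coeff_gens[OF k(1)] by simp_all
qed

lemma ddg_linear:
  "ddg l (a + b) = ddg l a + ddg l b" "ddg l (a - b) = ddg l a - ddg l b" "ddg l (gconst c * a) = gconst c * ddg l a"
  by (simp_all add: ddg_def distrib_left right_diff_distrib gconst_left_commute[of "gconst 2" c]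
    gconst_left_commute[of "gconst (-2)" c])

lemma ddg_exp:
  assumes "s \<in> quad B"
  shows "ddg l (gexp s * g) = ddg l s * (gexp s * g) + gexp s * ddg l g"
  by (simp add: ddg_def quad_exp(4)[OF assms] distrib_left mult.assoc gconst_left_commute[of "gexp s"])

section \<open>The fermionic Fourier kernel and its intertwining relations\<close>

definition fsum :: "nat \<Rightarrow> grassmann" where
  "fsum n = (\<Sum>j=1..n. theta (2*j-1) * theta (2*n + 2*j) - theta (2*j) * theta (2*n + (2*j-1)))"

definition fexp :: "real \<Rightarrow> nat \<Rightarrow> grassmann" where
  "fexp \<sigma> n = gexp (gconst (- (\<i> * of_real \<sigma>) / 2) * fsum n)"

text \<open>The index set records that every term has its second factor in the second set of
  generators. In \<open>ff_fgauss\<close> this makes the kernel invisible to coefficients indexed by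
  the first set.\<close>

lemma quad_fsum: "fsum n \<in> quad {2*n+1..4*n}"
  unfolding fsum_def
proof (rule quad_sum)
  fix j assume "j \<in> {1..n}"
  then have "gconst 1 * (theta (2*j-1) * theta (2*n + 2*j)) \<in> quad {2*n+1..4*n}"
    "gconst (- 1) * (theta (2*j) * theta (2*n + (2*j-1))) \<in> quad {2*n+1..4*n}"
    by (intro quad_single; auto)+
  from quad_add[OF this(2,1)]
  show "theta (2*j-1) * theta (2*n + 2*j) - theta (2*j) * theta (2*n + (2*j-1)) \<in> quad {2*n+1..4*n}"
    by (simp add: gconst_uminus)
qed

lemma gderiv_theta_theta:
  "gderiv i (theta a * theta b) = (if i = a then theta b else 0) - (if i = b then theta a else 0)"
  by (simp add: gderiv_theta_mult gderiv_theta)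

lemma gderiv_sum_single:
  fixes k n :: nat
  assumes "k \<in> {1..n}" "\<And>j. j \<in> {1..n} \<Longrightarrow> j \<noteq> k \<Longrightarrow> gderiv a (f j) = 0"
  shows "gderiv a (\<Sum>j=1..n. f j) = gderiv a (f k)"
proof -
  have "(\<Sum>j=1..n. gderiv a (f j)) = (\<Sum>j=1..n. if j = k then gderiv a (f k) else 0)"
    by (rule sum.cong) (use assms(2) in auto)
  also have "\<dots> = gderiv a (f k)"
    using assms(1) by (subst sum.delta) auto
  finally show ?thesis by (simp only: gderiv_sum)
qed

lemma gderiv_fsum:
  assumes k: "k \<in> {1..n}"
  shows "gderiv (2*k - 1) (fsum n) = theta (2*n + 2*k)"
    "gderiv (2*k) (fsum n) = - theta (2*n + (2*k-1))"
    "gderiv (2*n + 2*k) (fsum n) = - theta (2*k-1)"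
    "gderiv (2*n + (2*k - 1)) (fsum n) = theta (2*k)"
proof -
  have k: "1 \<le> k" "k \<le> n" using k by auto
  show "gderiv (2*k - 1) (fsum n) = theta (2*n + 2*k)"
  proof -
    \<comment> \<open>Subtraction is truncated, so these comparisons depend on
      \<open>k \<ge> 1\<close>: for \<open>k = 0\<close> the numbers \<open>2*k - 1\<close> and
      \<open>2*k\<close> coincide.\<close>
    have ck: "(2*k - 1 = 2*k-1) = True" "(2*k - 1 = 2*n + 2*k) = False" "(2*k - 1 = 2*k) = False" "(2*k - 1 = 2*n + (2*k-1)) = False"
      using k by (auto; presburger)+
    have "gderiv (2*k - 1) (fsum n) = gderiv (2*k - 1) (theta (2*k-1) * theta (2*n + 2*k) - theta (2*k) * theta (2*n + (2*k-1)))"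
      unfolding fsum_def
    proof (rule gderiv_sum_single)
      fix j assume "j \<in> {1..n}" and jk: "j \<noteq> k"
      then have j: "1 \<le> j" "j \<le> n" by auto
      have cj: "(2*k - 1 = 2*j-1) = False" "(2*k - 1 = 2*n + 2*j) = False" "(2*k - 1 = 2*j) = False" "(2*k - 1 = 2*n + (2*j-1)) = False"
        using j jk k by (auto; presburger)+
      show "gderiv (2*k - 1) (theta (2*j-1) * theta (2*n + 2*j) - theta (2*j) * theta (2*n + (2*j-1))) = 0"
        by (simp only: gderiv_linear gderiv_theta_theta cj if_False diff_self)
    qed (use k in auto)
    also have "\<dots> = theta (2*n + 2*k)"
      by (simp only: gderiv_linear gderiv_theta_theta ck if_False if_True diff_self diff_0 diff_0_right minus_minus)
    finally show ?thesis .
  qed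
  show "gderiv (2*k) (fsum n) = - theta (2*n + (2*k-1))"
  proof -
    have ck: "(2*k = 2*k-1) = False" "(2*k = 2*n + 2*k) = False" "(2*k = 2*k) = True" "(2*k = 2*n + (2*k-1)) = False"
      using k by (auto; presburger)+
    have "gderiv (2*k) (fsum n) = gderiv (2*k) (theta (2*k-1) * theta (2*n + 2*k) - theta (2*k) * theta (2*n + (2*k-1)))"
      unfolding fsum_def
    proof (rule gderiv_sum_single)
      fix j assume "j \<in> {1..n}" and jk: "j \<noteq> k"
      then have j: "1 \<le> j" "j \<le> n" by auto
      have cj: "(2*k = 2*j-1) = False" "(2*k = 2*n + 2*j) = False" "(2*k = 2*j) = False" "(2*k = 2*n + (2*j-1)) = False"
        using j jk k by (auto; presburger)+
      show "gderiv (2*k) (theta (2*j-1) * theta (2*n + 2*j) - theta (2*j) * theta (2*n + (2*j-1))) = 0"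
        by (simp only: gderiv_linear gderiv_theta_theta cj if_False diff_self)
    qed (use k in auto)
    also have "\<dots> = - theta (2*n + (2*k-1))"
      by (simp only: gderiv_linear gderiv_theta_theta ck if_False if_True diff_self diff_0 diff_0_right minus_minus)
    finally show ?thesis .
  qed
  show "gderiv (2*n + 2*k) (fsum n) = - theta (2*k-1)"
  proof -
    have ck: "(2*n + 2*k = 2*k-1) = False" "(2*n + 2*k = 2*n + 2*k) = True" "(2*n + 2*k = 2*k) = False" "(2*n + 2*k = 2*n + (2*k-1)) = False"
      using k by (auto; presburger)+
    have "gderiv (2*n + 2*k) (fsum n) = gderiv (2*n + 2*k) (theta (2*k-1) * theta (2*n + 2*k) - theta (2*k) * theta (2*n + (2*k-1)))"
      unfolding fsum_def
    proof (rule gderiv_sum_single)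
      fix j assume "j \<in> {1..n}" and jk: "j \<noteq> k"
      then have j: "1 \<le> j" "j \<le> n" by auto
      have cj: "(2*n + 2*k = 2*j-1) = False" "(2*n + 2*k = 2*n + 2*j) = False" "(2*n + 2*k = 2*j) = False" "(2*n + 2*k = 2*n + (2*j-1)) = False"
        using j jk k by (auto; presburger)+
      show "gderiv (2*n + 2*k) (theta (2*j-1) * theta (2*n + 2*j) - theta (2*j) * theta (2*n + (2*j-1))) = 0"
        by (simp only: gderiv_linear gderiv_theta_theta cj if_False diff_self)
    qed (use k in auto)
    also have "\<dots> = - theta (2*k-1)"
      by (simp only: gderiv_linear gderiv_theta_theta ck if_False if_True diff_self diff_0 diff_0_right minus_minus)
    finally show ?thesis .
  qed
  show "gderiv (2*n + (2*k - 1)) (fsum n) = theta (2*k)"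
  proof -
    have ck: "(2*n + (2*k - 1) = 2*k-1) = False" "(2*n + (2*k - 1) = 2*n + 2*k) = False" "(2*n + (2*k - 1) = 2*k) = False" "(2*n + (2*k - 1) = 2*n + (2*k-1)) = True"
      using k by (auto; presburger)+
    have "gderiv (2*n + (2*k - 1)) (fsum n) = gderiv (2*n + (2*k - 1)) (theta (2*k-1) * theta (2*n + 2*k) - theta (2*k) * theta (2*n + (2*k-1)))"
      unfolding fsum_def
    proof (rule gderiv_sum_single)
      fix j assume "j \<in> {1..n}" and jk: "j \<noteq> k"
      then have j: "1 \<le> j" "j \<le> n" by auto
      have cj: "(2*n + (2*k - 1) = 2*j-1) = False" "(2*n + (2*k - 1) = 2*n + 2*j) = False" "(2*n + (2*k - 1) = 2*j) = False" "(2*n + (2*k - 1) = 2*n + (2*j-1)) = False"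
        using j jk k by (auto; presburger)+
      show "gderiv (2*n + (2*k - 1)) (theta (2*j-1) * theta (2*n + 2*j) - theta (2*j) * theta (2*n + (2*j-1))) = 0"
        by (simp only: gderiv_linear gderiv_theta_theta cj if_False diff_self)
    qed (use k in auto)
    also have "\<dots> = theta (2*k)"
      by (simp only: gderiv_linear gderiv_theta_theta ck if_False if_True diff_self diff_0 diff_0_right minus_minus)
    finally show ?thesis .
  qed
qed

text \<open>The opposite signs in the two parity cases of \<open>ddg\<close> compensate those of the
  symplectic form, which gives one formula for both. The factor 2 later cancels the
  \<open>1/2\<close> of the pairing.\<close>

lemma ddg_fsum:
  assumes l: "l \<in> {1..2*n}"
  shows "ddg l (fsum n) = gconst 2 * theta (2*n + l)" "ddg (2*n + l) (fsum n) = gconst 2 * theta l"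
proof -
  have "ddg l (fsum n) = gconst 2 * theta (2*n + l) \<and> ddg (2*n + l) (fsum n) = gconst 2 * theta l"
    using l
  proof (cases rule: gen_index_cases)
    case (1 j)
    have "2*n + l - 1 = 2*n + (l - 1)" "even l" "even (2*n + l)" using 1 by auto
    then have "ddg l (fsum n) = gconst 2 * gderiv (2*j - 1) (fsum n)"
      "ddg (2*n + l) (fsum n) = gconst 2 * gderiv (2*n + (2*j - 1)) (fsum n)"
      by (simp_all only: ddg_def if_True 1)
    then show ?thesis by (simp only: gderiv_fsum[OF 1(2)]) (simp only: 1(1) simp_thms)
  next
    case (2 j)
    have "2*n + l + 1 = 2*n + (l + 1)" "odd l" "odd (2*n + l)" "l + 1 = 2*j" using 2 by auto
    then have "ddg l (fsum n) = gconst (-2) * gderiv (2*j) (fsum n)"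
      "ddg (2*n + l) (fsum n) = gconst (-2) * gderiv (2*n + 2*j) (fsum n)"
      by (simp_all only: ddg_def if_False)
    then show ?thesis
      by (simp only: gderiv_fsum[OF 2(2)]) (simp only: 2(1) gconst_uminus mult_minus_left mult_minus_right minus_minus simp_thms)
  qed
  then show "ddg l (fsum n) = gconst 2 * theta (2*n + l)" "ddg (2*n + l) (fsum n) = gconst 2 * theta l"
    by auto
qed

lemma quad_fexp: "gconst c * fsum n \<in> quad {2*n+1..4*n}"
  by (rule quad_gconst_mult[OF quad_fsum])

text \<open>The fermionic Fourier transform, with its share \<open>2 ^ n\<close> of the
  normalisation contained in \<open>top_coeff\<close>.\<close>

definition ff :: "real \<Rightarrow> nat \<Rightarrow> grassmann \<Rightarrow> grassmann" where
  "ff \<sigma> n g = top_coeff n (fexp \<sigma> n * g)"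

lemma ff_linear:
  "ff \<sigma> n (g + h) = ff \<sigma> n g + ff \<sigma> n h" "ff \<sigma> n (gconst c * g) = gconst c * ff \<sigma> n g" "ff \<sigma> n 0 = 0"
  by (simp_all add: ff_def distrib_left gconst_left_commute[of "fexp \<sigma> n"] top_coeff_linear)

lemma gderiv_in_gens:
  assumes "g \<in> in_gens n" "l \<notin> {1..2*n}"
  shows "gderiv l g = 0"
  using assms by (intro grassmann_eqI) (auto simp: gcoeff_gderiv in_gens_def)

lemma sigma_square:
  assumes "\<sigma>\<^sup>2 = 1"
  shows "\<i> * of_real \<sigma> * (\<i> * of_real \<sigma>) = (-1::complex)"
  using assms by (simp add: power_mult_distrib flip: power2_eq_square of_real_power)

text \<open>Multiplying the kernel by \<open>theta l\<close> amounts to differentiating it in the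
  dual generator \<open>2*n + l\<close>. This derivative does not touch \<open>g\<close>, which
  contains only generators of the first set, and it leaves the Berezin integral.\<close>

lemma ff_theta:
  assumes g: "g \<in> in_gens n" and l: "l \<in> {1..2*n}" and s: "\<sigma>\<^sup>2 = 1"
  shows "ff \<sigma> n (theta l * g) = gconst (\<i> * of_real \<sigma>) * ddg l (ff \<sigma> n g)"
proof -
  have "ddg (2*n + l) g = 0"
  proof -
    obtain k c where k: "k \<in> {1..2*n}" "\<And>g. ddg l g = gconst c * gderiv k g"
      "\<And>g. ddg (2*n + l) g = gconst c * gderiv (2*n + k) g"
      using ddg_gderiv[OF l] by blast
    have "2*n + k \<notin> {1..2*n}" using k(1) by auto
    then show ?thesis using gderiv_in_gens[OF g] by (simp add: k(3))
  qed
  then have "ddg (2*n + l) (fexp \<sigma> n * g) = gconst (- (\<i> * of_real \<sigma>)) * (theta l * (fexp \<sigma> n * g))"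
    unfolding fexp_def ddg_exp[OF quad_fexp] ddg_linear ddg_fsum(2)[OF l]
    by (simp add: gconst_mult mult.assoc[symmetric])
  then have "gconst (\<i> * of_real \<sigma>) * ddg (2*n + l) (fexp \<sigma> n * g) = theta l * (fexp \<sigma> n * g)"
    by (simp add: mult.assoc[symmetric] gconst_mult) (simp add: sigma_square[OF s, unfolded mult.assoc] mult.assoc)
  also have "\<dots> = fexp \<sigma> n * (theta l * g)"
    unfolding fexp_def by (metis quad_exp(3)[OF quad_fexp] mult.assoc)
  finally show ?thesis
    unfolding ff_def by (metis top_coeff_linear(2) top_coeff_ddg(1)[OF l])
qed

text \<open>Integration by parts: the integral of the total derivative is zero, and the derivative
  of the kernel brings down the dual generator.\<close>

lemma ff_ddg:
  assumes l: "l \<in> {1..2*n}"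
  shows "ff \<sigma> n (ddg l g) = gconst (\<i> * of_real \<sigma>) * (theta l * ff \<sigma> n g)"
proof -
  have "ddg l (fexp \<sigma> n * g) = gconst (- (\<i> * of_real \<sigma>)) * (theta (2*n + l) * (fexp \<sigma> n * g)) + fexp \<sigma> n * ddg l g"
    unfolding fexp_def ddg_exp[OF quad_fexp] ddg_linear ddg_fsum(1)[OF l]
    by (simp add: gconst_mult mult.assoc[symmetric])
  then have "fexp \<sigma> n * ddg l g = ddg l (fexp \<sigma> n * g) + gconst (\<i> * of_real \<sigma>) * (theta (2*n + l) * (fexp \<sigma> n * g))"
    by (simp add: gconst_uminus)
  then show ?thesis
    unfolding ff_def by (simp add: top_coeff_linear top_coeff_ddg(2)[OF l] top_coeff_gens(1)[OF l])
qed

section \<open>The fermionic Gaussian\<close>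

definition gsum :: "nat \<Rightarrow> grassmann" where
  "gsum n = (\<Sum>j=1..n. theta (2*j-1) * theta (2*j))"

definition fgauss :: "nat \<Rightarrow> grassmann" where
  "fgauss n = gexp (gconst (1/2) * gsum n)"

lemma quad_gsum: "gconst c * gsum n \<in> quad {1..2*n}"
proof (rule quad_gconst_mult)
  show "gsum n \<in> quad {1..2*n}" unfolding gsum_def
  proof (rule quad_sum)
    fix j assume "j \<in> {1..n}"
    then show "theta (2*j-1) * theta (2*j) \<in> quad {1..2*n}"
      using quad_single[of "2*j" "{1..2*n}" 1] by auto
  qed
qed

lemma gderiv_gsum:
  assumes k: "k \<in> {1..n}"
  shows "gderiv (2*k - 1) (gsum n) = theta (2*k)" "gderiv (2*k) (gsum n) = - theta (2*k-1)"
proof -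
  have k: "1 \<le> k" "k \<le> n" using k by auto
  show "gderiv (2*k - 1) (gsum n) = theta (2*k)"
  proof -
    have ck: "(2*k - 1 = 2*k-1) = True" "(2*k - 1 = 2*k) = False"
      using k by (auto; presburger)+
    have "gderiv (2*k - 1) (gsum n) = gderiv (2*k - 1) (theta (2*k-1) * theta (2*k))"
      unfolding gsum_def
    proof (rule gderiv_sum_single)
      fix j assume "j \<in> {1..n}" and jk: "j \<noteq> k"
      then have j: "1 \<le> j" "j \<le> n" by auto
      have cj: "(2*k - 1 = 2*j-1) = False" "(2*k - 1 = 2*j) = False"
        using j jk k by (auto; presburger)+
      show "gderiv (2*k - 1) (theta (2*j-1) * theta (2*j)) = 0"
        by (simp only: gderiv_theta_theta cj if_False diff_self)
    qed (use k in auto)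
    also have "\<dots> = theta (2*k)"
      by (simp only: gderiv_theta_theta ck if_False if_True diff_0 diff_0_right)
    finally show ?thesis .
  qed
  show "gderiv (2*k) (gsum n) = - theta (2*k-1)"
  proof -
    have ck: "(2*k = 2*k-1) = False" "(2*k = 2*k) = True"
      using k by (auto; presburger)+
    have "gderiv (2*k) (gsum n) = gderiv (2*k) (theta (2*k-1) * theta (2*k))"
      unfolding gsum_def
    proof (rule gderiv_sum_single)
      fix j assume "j \<in> {1..n}" and jk: "j \<noteq> k"
      then have j: "1 \<le> j" "j \<le> n" by auto
      have cj: "(2*k = 2*j-1) = False" "(2*k = 2*j) = False"
        using j jk k by (auto; presburger)+
      show "gderiv (2*k) (theta (2*j-1) * theta (2*j)) = 0"
        by (simp only: gderiv_theta_theta cj if_False diff_self)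
    qed (use k in auto)
    also have "\<dots> = - theta (2*k-1)"
      by (simp only: gderiv_theta_theta ck if_False if_True diff_0 diff_0_right)
    finally show ?thesis .
  qed
qed

text \<open>The factor 2 cancels the \<open>1/2\<close> in \<open>fgauss\<close>, so
  \<open>ddg l\<close> acts on the Gaussian as multiplication by \<open>theta l\<close>.\<close>

lemma ddg_gsum:
  assumes l: "l \<in> {1..2*n}"
  shows "ddg l (gsum n) = gconst 2 * theta l"
  using l
proof (cases rule: gen_index_cases)
  case (1 j)
  then show ?thesis by (simp only: ddg_def even_mult_iff even_numeral simp_thms if_True gderiv_gsum)
next
  case (2 j)
  then have "odd l" "l + 1 = 2*j" by auto
  then show ?thesis
    by (simp only: ddg_def if_False gderiv_gsum[OF 2(2)]) (simp only: 2(1) gconst_uminus mult_minus_left mult_minus_right minus_minus)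
qed

lemma ddg_fgauss_mult:
  assumes l: "l \<in> {1..2*n}"
  shows "ddg l (fgauss n * g) = theta l * (fgauss n * g) + fgauss n * ddg l g"
  unfolding fgauss_def ddg_exp[OF quad_gsum] ddg_linear ddg_gsum[OF l]
  by (simp add: gconst_mult mult.assoc[symmetric])

lemma ddg_one: "ddg l 1 = 0"
  by (simp add: ddg_def)

lemma ddg_fgauss: "l \<in> {1..2*n} \<Longrightarrow> ddg l (fgauss n) = theta l * fgauss n"
  using ddg_fgauss_mult[of l n 1] by (simp add: ddg_one)

lemma fgauss_commute: "fgauss n * theta l = theta l * fgauss n"
  unfolding fgauss_def by (rule quad_exp(3)[OF quad_gsum])

text \<open>A coefficient whose index set contains \<open>l\<close> would be visible in the
  derivative by \<open>theta l\<close>. For \<open>l\<close> outside the range the exponent, and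
  hence the exponential, has derivative zero.\<close>

lemma fgauss_in_gens: "fgauss n \<in> in_gens n"
proof -
  have "gcoeff (fgauss n) A = 0" if A: "\<not> A \<subseteq> {1..2*n}" for A
  proof (cases "finite A")
    case True
    obtain l where l: "l \<in> A" "l \<notin> {1..2*n}" using A by blast
    have "gderiv l (gsum n) = 0"
      unfolding gsum_def gderiv_sum by (rule sum.neutral) (use l in \<open>auto simp: gderiv_theta_theta\<close>)
    then have "gderiv l (fgauss n) = 0"
      using quad_exp(4)[OF quad_gsum, of l "1/2" n 1] by (simp add: fgauss_def)
    then have "gcoeff (gderiv l (fgauss n)) (A - {l}) = 0" by simp
    then show ?thesis using l by (simp add: gcoeff_gderiv insert_absorb)
  qed (simp add: gcoeff_infinite)
  then show ?thesis by (simp add: in_gens_def)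
qed

lemma fgauss_coeff_empty: "gcoeff (fgauss n) {} = 1"
  using quad_exp(5)[OF quad_gsum, of "{}" n "1/2" 1] by (simp add: fgauss_def gcoeff_one)

lemma fgauss_coeff_top:
  assumes "k \<le> n"
  shows "gcoeff (fgauss n) {1..2*k} = (1/2) ^ k"
  using assms
proof (induction k)
  case (Suc k)
  \<comment> \<open>At this index set the left side of the equation for
    \<open>ddg (2 * Suc k)\<close> reads the coefficient at \<open>{1..2 * Suc k}\<close>, with
    factor 2, and the right side the one at \<open>{1..2*k}\<close>.\<close>
  define A where "A = {1..2*k} \<union> {2 * Suc k}"
  have A: "finite A" "2*k + 1 \<notin> A" "insert (2*k+1) A = {1..2 * Suc k}" "A - {2 * Suc k} = {1..2*k}"
    by (auto simp: A_def)
  have b: "below A (2*k+1) = 2*k" "below A (2 * Suc k) = 2*k"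
  proof -
    have "{i\<in>A. i < 2*k+1} = {1..2*k}" "{i\<in>A. i < 2 * Suc k} = {1..2*k}" by (auto simp: A_def)
    then show "below A (2*k+1) = 2*k" "below A (2 * Suc k) = 2*k" by (auto simp: below_def)
  qed
  have "ddg (2 * Suc k) (fgauss n) = theta (2 * Suc k) * fgauss n"
    using Suc.prems by (intro ddg_fgauss) auto
  then have "gcoeff (ddg (2 * Suc k) (fgauss n)) A = gcoeff (theta (2 * Suc k) * fgauss n) A" by simp
  moreover have "gcoeff (ddg (2 * Suc k) (fgauss n)) A = 2 * gcoeff (fgauss n) {1..2 * Suc k}"
    using A(2,3) b(1) by (simp add: ddg_def gcoeff_gderiv power_mult)
  moreover have "gcoeff (theta (2 * Suc k) * fgauss n) A = gcoeff (fgauss n) {1..2*k}"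
    unfolding gcoeff_theta_mult A(4) b(2) by (simp add: A_def power_mult)
  ultimately have e: "2 * gcoeff (fgauss n) {1..2 * Suc k} = (1/2) ^ k" using Suc by simp
  show ?case unfolding power_Suc e[symmetric] by simp
qed (simp add: fgauss_coeff_empty)

text \<open>The equations express the coefficient at \<open>A\<close> by the one with a whole
  symplectic pair removed, or make it zero. By induction on the cardinality everything is determined
  by the constant coefficient.\<close>

lemma ddg_theta_unique:
  assumes g: "g \<in> in_gens n" and eq: "\<And>l. l \<in> {1..2*n} \<Longrightarrow> ddg l g = theta l * g" and 0: "gcoeff g {} = 0"
  shows "g = 0"
proof (rule grassmann_eqI)
  fix A
  show "gcoeff g A = gcoeff 0 A"
  proof (induction "card A" arbitrary: A rule: less_induct)
    case less
    show ?case
    proof (cases "A \<subseteq> {1..2*n} \<and> A \<noteq> {}")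
      case True
      then have fin: "finite A" by (auto dest: finite_subset)
      obtain a where a: "a \<in> A" "a \<in> {1..2*n}" using True by blast
      \<comment> \<open>The index for which \<open>ddg l\<close> differentiates in
        \<open>theta a\<close>.\<close>
      define l where "l = (if even a then a - 1 else a + 1)"
      have l: "l \<in> {1..2*n}" "l \<noteq> a"
        using a(2) unfolding l_def atLeastAtMost_iff by presburger+
      have "\<exists>c. c \<noteq> 0 \<and> ddg l g = gconst c * gderiv a g"
      proof (cases "even a")
        case True
        then have "a = l + 1" "odd l" using a(2) unfolding l_def atLeastAtMost_iff by presburger+
        then show ?thesis by (intro exI[of _ "-2"]) (simp add: ddg_def)
      next
        case False
        then have "a = l - 1" "even l" unfolding l_def by presburger+
        then show ?thesis by (intro exI[of _ 2]) (simp add: ddg_def)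
      qed
      then obtain c where c: "c \<noteq> 0" "ddg l g = gconst c * gderiv a g" by blast
      have "gcoeff (theta l * g) (A - {a}) = 0"
      proof (cases "l \<in> A - {a}")
        case True
        then have "card (A - {a} - {l}) < card A"
          using fin a by (intro psubset_card_mono) auto
        from less[OF this] show ?thesis by (simp add: gcoeff_theta_mult)
      qed (auto simp: gcoeff_theta_mult)
      then have "gcoeff (gderiv a g) (A - {a}) = 0"
        unfolding eq[OF l(1), symmetric] c(2) using c(1) by simp
      then show ?thesis using a(1) by (simp add: gcoeff_gderiv insert_absorb)
    next
      case False
      then show ?thesis using 0 g by (auto simp: in_gens_def)
    qed
  qed
qed

text \<open>The two intertwining relations turn the first-order equations of the Gaussian into the
  same equations for its transform. Only the constant coefficient remains to be compared.\<close>

lemma ff_fgauss: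
  assumes s: "\<sigma>\<^sup>2 = 1"
  shows "ff \<sigma> n (fgauss n) = fgauss n"
proof -
  define X where "X = ff \<sigma> n (fgauss n)"
  have "X - fgauss n = 0"
  proof (rule ddg_theta_unique)
    show "X - fgauss n \<in> in_gens n"
      using fgauss_in_gens top_coeff_in_gens[of n] by (simp add: X_def ff_def in_gens_def)
    fix l assume l: "l \<in> {1..2*n}"
    have "gconst (\<i> * of_real \<sigma>) * ddg l X = gconst (\<i> * of_real \<sigma>) * (theta l * X)"
      unfolding X_def ff_theta[OF fgauss_in_gens l s, symmetric] ff_ddg[OF l, symmetric] ddg_fgauss[OF l] ..
    then have "gconst (- (\<i> * of_real \<sigma>)) * (gconst (\<i> * of_real \<sigma>) * ddg l X) =
       gconst (- (\<i> * of_real \<sigma>)) * (gconst (\<i> * of_real \<sigma>) * (theta l * X))" by simp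
    moreover have "gconst (- (\<i> * of_real \<sigma>)) * (gconst (\<i> * of_real \<sigma>) * Y) = Y" for Y
    proof -
      have "- (\<i> * of_real \<sigma>) * (\<i> * of_real \<sigma>) = (1::complex)"
        using sigma_square[OF s] by simp
      then show ?thesis by (metis mult.assoc gconst_mult gconst_1 mult_1_left)
    qed
    ultimately have "ddg l X = theta l * X" by simp
    then show "ddg l (X - fgauss n) = theta l * (X - fgauss n)"
      by (simp add: ddg_linear ddg_fgauss[OF l] right_diff_distrib)
  next
    have "gcoeff X {} = 2 ^ n * gcoeff (fexp \<sigma> n * fgauss n) {1..2*n}"
      by (simp add: X_def ff_def gcoeff_top_coeff shift_ext_def)
    \<comment> \<open>Every nonconstant term of the kernel contains a generator of the second set,
      so only its constant term 1 contributes here.\<close>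
    also have "gcoeff (fexp \<sigma> n * fgauss n) {1..2*n} = gcoeff (fgauss n) {1..2*n}"
      unfolding fexp_def by (rule quad_exp(5)[OF quad_fexp]) auto
    also have "2 ^ n * gcoeff (fgauss n) {1..2*n} = 1"
      using fgauss_coeff_top[of n n] by (simp add: power_one_over del: One_nat_def)
    finally show "gcoeff (X - fgauss n) {} = 0" by (simp add: fgauss_coeff_empty)
  qed
  then show ?thesis by (simp add: X_def)
qed

section \<open>The super Fourier transform of a polynomial times the Gaussian\<close>

definition gsfuns :: "nat \<Rightarrow> nat \<Rightarrow> scalar_superfun set" where
  "gsfuns m n = {f. \<forall>A. (\<lambda>x. gcoeff (f x) A) \<in> gpolys m \<and> (\<not> A \<subseteq> {1..2*n} \<longrightarrow> (\<forall>x. gcoeff (f x) A = 0))}"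

lemma gsfuns_coeff: "f \<in> gsfuns m n \<Longrightarrow> (\<lambda>x. gcoeff (f x) A) \<in> gpolys m"
  by (simp add: gsfuns_def)

lemma gsfuns_in_gens: "f \<in> gsfuns m n \<Longrightarrow> f x \<in> in_gens n"
  by (simp add: gsfuns_def in_gens_def)

lemma gsfuns_add: "f \<in> gsfuns m n \<Longrightarrow> g \<in> gsfuns m n \<Longrightarrow> f + g \<in> gsfuns m n"
  by (auto simp: gsfuns_def fun_simps intro: gpolys.add)

lemma gsfuns_csc: "f \<in> gsfuns m n \<Longrightarrow> csc c f \<in> gsfuns m n"
  by (auto simp: gsfuns_def fun_simps intro: gpolys.scale)

lemma gsfuns_xv:
  assumes "f \<in> gsfuns m n" "i \<in> {1..m}"
  shows "xv i * f \<in> gsfuns m n"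
  using assms by (auto simp: gsfuns_def fun_simps xv_def intro!: gpolys_mult)

lemma gsfuns_xg:
  assumes f: "f \<in> gsfuns m n" and l: "l \<in> {1..2*n}"
  shows "xg l * f \<in> gsfuns m n"
proof -
  have "(\<lambda>x. gcoeff ((xg l * f) x) A) \<in> gpolys m" for A
    using gpolys.scale[OF gsfuns_coeff[OF f], of "(- 1) ^ below A l" "A - {l}"] gpolys_zero[of m]
    by (cases "l \<in> A") (simp_all add: fun_simps xg_def gcoeff_theta_mult)
  moreover have "gcoeff ((xg l * f) x) A = 0" if "\<not> A \<subseteq> {1..2*n}" for x A
  proof -
    have "\<not> A - {l} \<subseteq> {1..2*n}" using that l by blast
    then have "gcoeff (f x) (A - {l}) = 0"
      using gsfuns_in_gens[OF f, of x] by (simp add: in_gens_def)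
    then show ?thesis by (simp add: fun_simps xg_def gcoeff_theta_mult)
  qed
  ultimately show ?thesis by (simp add: gsfuns_def)
qed

lemma gsfuns_xx: "f \<in> gsfuns m n \<Longrightarrow> l \<in> gens m n \<Longrightarrow> xx l f \<in> gsfuns m n"
  by (cases l) (auto intro: gsfuns_xv gsfuns_xg)

text \<open>No sign arises: when \<open>theta j\<close> is removed, all smaller indices have been
  removed before.\<close>

lemma gcoeff_fold_gderiv:
  assumes "finite B" "\<forall>b\<in>B. N < b"
  shows "gcoeff (fold gderiv [1..<N+1] X) B = gcoeff X ({1..N} \<union> B)"
  using assms
proof (induction N arbitrary: B)
  case (Suc N)
  have "Suc N \<notin> B" "below B (Suc N) = 0" using Suc.prems by (auto simp: below_def)
  moreover have "{1..N} \<union> insert (Suc N) B = {1..Suc N} \<union> B" by auto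
  moreover have "gcoeff (fold gderiv [1..<N+1] X) (insert (Suc N) B) = gcoeff X ({1..N} \<union> insert (Suc N) B)"
    using Suc.prems by (intro Suc.IH) auto
  ultimately show ?case by (simp add: gcoeff_gderiv)
qed simp

lemma gcoeff_berezin:
  assumes "A \<subseteq> {1..2*n}"
  shows "gcoeff (berezin n X) ((\<lambda>j. 2*n + j) ` A) = of_real (1 / pi ^ n) * gcoeff X (shift_ext n A)"
proof -
  have "gcoeff (fold gderiv [1..<2*n+1] X) ((\<lambda>j. 2*n + j) ` A) = gcoeff X (shift_ext n A)"
    unfolding shift_ext_def by (rule gcoeff_fold_gderiv) (use assms in \<open>auto dest: finite_subset\<close>)
  then show ?thesis by (simp add: berezin_def)
qed

text \<open>The bosonic part of the exponent is a multiple of 1 in the Grassmann algebra, hence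
  central, and splits off as a scalar exponential.\<close>

lemma kernel_eq:
  "gexp (gconst (- of_real \<sigma> * \<i>) * pairing m n x y) = gconst (fkernel \<sigma> (\<Sum>i=1..m. x i * y i)) * fexp \<sigma> n"
proof -
  have "gconst (- of_real \<sigma> * \<i>) * pairing m n x y =
    gconst (- (\<i> * of_real \<sigma>) / 2) * fsum n + gconst (\<i> * of_real \<sigma> * of_real (\<Sum>i=1..m. x i * y i))"
  proof -
    have "gconst (- of_real \<sigma> * \<i>) * (gconst (1/2) * fsum n) = gconst (- (\<i> * of_real \<sigma>) / 2) * fsum n"
      by (simp add: gconst_mult mult.commute flip: mult.assoc)
    moreover have "gconst (- of_real \<sigma> * \<i>) * - (\<Sum>i=1..m. gconst (of_real (x i * y i))) =
      gconst (\<i> * of_real \<sigma> * of_real (\<Sum>i=1..m. x i * y i))"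
      unfolding gconst_sum[symmetric] mult_minus_right gconst_mult gconst_uminus[symmetric] of_real_sum
      by (simp add: mult.commute)
    ultimately show ?thesis
      unfolding pairing_def fsum_def[symmetric] distrib_left by (simp only: add.commute)
  qed
  then show ?thesis
    by (simp only: quad_exp(2)[OF quad_fexp] fexp_def fkernel_def)
qed

definition fbos :: "real \<Rightarrow> nat \<Rightarrow> scalar_superfun \<Rightarrow> scalar_superfun" where
  "fbos \<sigma> m f = (\<lambda>y. Grassmann (\<lambda>A. ft \<sigma> m (\<lambda>x. gcoeff (f x) A) y))"

lemma ft_zero: "ft \<sigma> m (\<lambda>x. 0) y = 0"
  by (simp add: ft_def)

lemma gcoeff_fbos: "gcoeff (fbos \<sigma> m f y) A = ft \<sigma> m (\<lambda>x. gcoeff (f x) A) y"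
  unfolding fbos_def by (rule gcoeff_Grassmann) (simp add: gcoeff_infinite ft_zero)

text \<open>The exponent contributes \<open>(2 * pi) ^ n\<close> for the fermionic variables.
  Together with the \<open>1 / pi ^ n\<close> of the Berezin integral this leaves the
  \<open>2 ^ n\<close> of \<open>top_coeff\<close> and the normalisation of
  \<open>ft\<close>.\<close>

lemma fourier_constant:
  "(2 * pi) powr (- (real m - 2 * real n) / 2) * (1 / pi ^ n) = (1 / sqrt (2 * pi)) ^ m * 2 ^ n"
proof -
  have "(2 * pi) powr (- (real m - 2 * real n) / 2) = (2 * pi) powr (real n - real m / 2)"
    by (rule arg_cong[of _ _ "\<lambda>x. (2 * pi) powr x"]) (simp add: field_simps)
  also have "\<dots> = (2 * pi) ^ n / (2 * pi) powr (1/2 * real m)"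
    by (simp add: powr_diff powr_realpow)
  also have "(2 * pi) powr (1/2 * real m) = sqrt (2 * pi) ^ m"
  proof -
    have "((2 * pi) powr (1/2)) powr real m = sqrt (2 * pi) ^ m"
      by (subst powr_half_sqrt, simp, rule powr_realpow, simp)
    then show ?thesis by (simp only: powr_powr)
  qed
  finally show ?thesis by (simp add: power_mult_distrib power_divide)
qed

text \<open>The fermionic kernel does not depend on the integration variables, so it leaves the
  integral coefficient by coefficient. Membership in \<open>gsfuns\<close> supplies the
  integrability for the finite sum.\<close>

lemma super_fourier_eq:
  assumes f: "f \<in> gsfuns m n"
  shows "super_fourier\<^sub>0 \<sigma> m n f = (\<lambda>y. ff \<sigma> n (fbos \<sigma> m f y))"
proof (intro ext grassmann_eqI)
  fix y A
  let ?K = "\<lambda>x. fkernel \<sigma> (\<Sum>i=1..m. x i * y i)"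
  have L: "gcoeff (super_fourier\<^sub>0 \<sigma> m n f y) A = (if A \<subseteq> {1..2*n} then
     of_real ((2 * pi) powr (- (real m - 2 * real n) / 2)) *
       (LINT x|PiM {1..m} (\<lambda>_. lborel).
          gcoeff (berezin n (gexp (gconst (- of_real \<sigma> * \<i>) * pairing m n x y) * f x))
            ((\<lambda>j. 2*n + j) ` A))
     else 0)"
    unfolding super_fourier\<^sub>0_def by (rule gcoeff_Grassmann) (auto dest: finite_subset)
  show "gcoeff (super_fourier\<^sub>0 \<sigma> m n f y) A = gcoeff (ff \<sigma> n (fbos \<sigma> m f y)) A"
  proof (cases "A \<subseteq> {1..2*n}")
    case True
    let ?D = "shift_ext n A" and ?M = "PiM {1..m} (\<lambda>_. lborel :: real measure)"
    let ?c = "\<lambda>B. gsign B (?D - B) * gcoeff (fexp \<sigma> n) B"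
    let ?N = "of_real (1 / sqrt (2 * pi)) ^ m :: complex"
    have 1: "gcoeff (berezin n (gexp (gconst (- of_real \<sigma> * \<i>) * pairing m n x y) * f x)) ((\<lambda>j. 2*n + j) ` A) =
       of_real (1 / pi ^ n) * (\<Sum>B\<in>Pow ?D. ?c B * (?K x * gcoeff (f x) (?D - B)))" for x
      unfolding gcoeff_berezin[OF True] kernel_eq mult.assoc gcoeff_gconst_mult
      by (simp add: gcoeff_mult sum_distrib_left mult_ac)
    have "(LINT x|?M. (\<Sum>B\<in>Pow ?D. ?c B * (?K x * gcoeff (f x) (?D - B)))) =
       (\<Sum>B\<in>Pow ?D. ?c B * (LINT x|?M. ?K x * gcoeff (f x) (?D - B)))"
      by (subst Bochner_Integration.integral_sum, intro integrable_mult_right gpolys_integrable gsfuns_coeff[OF f])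
        (simp only: integral_mult_right_zero)
    then have "?N * (LINT x|?M. (\<Sum>B\<in>Pow ?D. ?c B * (?K x * gcoeff (f x) (?D - B)))) =
      (\<Sum>B\<in>Pow ?D. ?c B * gcoeff (fbos \<sigma> m f y) (?D - B))"
      by (simp only: gcoeff_fbos ft_def sum_distrib_left) (simp only: mult_ac)
    also have "\<dots> = gcoeff (fexp \<sigma> n * fbos \<sigma> m f y) ?D"
      by (simp add: gcoeff_mult mult.assoc)
    finally have 2: "?N * (LINT x|?M. (\<Sum>B\<in>Pow ?D. ?c B * (?K x * gcoeff (f x) (?D - B)))) =
       gcoeff (fexp \<sigma> n * fbos \<sigma> m f y) ?D" .
    have c: "complex_of_real ((2 * pi) powr (- (real m - 2 * real n) / 2)) * of_real (1 / pi ^ n) = 2 ^ n * ?N"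
      unfolding of_real_mult[symmetric] fourier_constant by simp
    have "gcoeff (super_fourier\<^sub>0 \<sigma> m n f y) A =
      (complex_of_real ((2 * pi) powr (- (real m - 2 * real n) / 2)) * of_real (1 / pi ^ n)) *
        (LINT x|?M. (\<Sum>B\<in>Pow ?D. ?c B * (?K x * gcoeff (f x) (?D - B))))"
      unfolding L 1 integral_mult_right_zero using True by (simp only: if_True mult.assoc)
    also have "\<dots> = 2 ^ n * gcoeff (fexp \<sigma> n * fbos \<sigma> m f y) ?D"
      by (simp only: c mult.assoc[of "2 ^ n" ?N] 2)
    finally show ?thesis
      using True by (simp only: ff_def gcoeff_top_coeff if_True)
  next
    case False
    then show ?thesis by (simp only: L ff_def gcoeff_top_coeff if_False)
  qed
qed

lemma fbos_linear:
  assumes "f \<in> gsfuns m n"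
  shows "g \<in> gsfuns m n \<Longrightarrow> fbos \<sigma> m (f + g) y = fbos \<sigma> m f y + fbos \<sigma> m g y"
    and "fbos \<sigma> m (csc c f) y = gconst c * fbos \<sigma> m f y"
  using assms
  by (auto intro!: grassmann_eqI simp: gcoeff_fbos fun_simps ft_add gsfuns_coeff ft_scale)

lemma super_fourier_add:
  assumes "f \<in> gsfuns m n" "g \<in> gsfuns m n"
  shows "super_fourier\<^sub>0 \<sigma> m n (f + g) = super_fourier\<^sub>0 \<sigma> m n f + super_fourier\<^sub>0 \<sigma> m n g"
  using assms by (simp add: super_fourier_eq gsfuns_add fbos_linear[of _ m n] ff_linear fun_eq_iff fun_simps)

lemma super_fourier_csc:
  assumes "f \<in> gsfuns m n"
  shows "super_fourier\<^sub>0 \<sigma> m n (csc c f) = csc c (super_fourier\<^sub>0 \<sigma> m n f)"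
  using assms by (simp add: super_fourier_eq gsfuns_csc fbos_linear[of _ m n] ff_linear fun_eq_iff csc_def[of c "\<lambda>y. ff \<sigma> n (fbos \<sigma> m f y)"])

lemma fbos_diff:
  assumes f: "f \<in> gsfuns m n" and i: "i \<in> {1..m}" and s: "\<sigma>\<^sup>2 = 1"
  shows "((\<lambda>t. gcoeff (fbos \<sigma> m f (y(i := t))) A) has_vector_derivative
    gcoeff (csc (\<i> * of_real \<sigma>) (fbos \<sigma> m (xv i * f)) y) A) (at (y i))"
  using ft_has_vector_derivative[OF gsfuns_coeff[OF f, of A] i s, of y]
  by (simp add: gcoeff_fbos fun_simps xv_def)

text \<open>\<open>i\<close> may lie outside \<open>{1..m}\<close> here, where everything is constant in \<open>y i\<close>.\<close>

lemma fbos_diff_superfuns: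
  assumes f: "f \<in> gsfuns m n" and s: "\<sigma>\<^sup>2 = 1"
  shows "fbos \<sigma> m f \<in> diff_superfuns"
  unfolding diff_superfuns_def
proof (intro CollectI allI)
  fix A i and y :: "nat \<Rightarrow> real"
  show "(\<lambda>t. gcoeff (fbos \<sigma> m f (y(i := t))) A) differentiable (at (y i))"
  proof (cases "i \<in> {1..m}")
    case True
    then show ?thesis
      using fbos_diff[OF f True s] unfolding differentiable_def has_vector_derivative_def by blast
  next
    case False
    have "(\<Sum>k=1..m. x k * (y(i := t)) k) = (\<Sum>k=1..m. x k * y k)" for t and x :: "nat \<Rightarrow> real"
      using False by (intro sum.cong) auto
    then show ?thesis by (simp add: gcoeff_fbos ft_def del: fun_upd_apply)
  qed
qed

text \<open>Each coefficient of the fermionic transform is a fixed finite linear combination of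
  coefficients of the argument, so bosonic derivatives pass through it.\<close>

lemma partial_x_ff:
  assumes "f \<in> diff_superfuns"
  shows "(\<lambda>y. ff \<sigma> n (f y)) \<in> diff_superfuns" "partial_x i (\<lambda>y. ff \<sigma> n (f y)) = (\<lambda>y. ff \<sigma> n (partial_x i f y))"
proof -
  define g where "g = (\<lambda>_. fexp \<sigma> n) * f"
  have g: "g \<in> diff_superfuns" "partial_x i g = (\<lambda>_. fexp \<sigma> n) * partial_x i f" for i
    unfolding g_def using partial_x_mult[OF partial_x_const(1)[of "fexp \<sigma> n"] assms]
    by (simp_all add: partial_x_const)
  have eq: "ff \<sigma> n (f y) = top_coeff n (g y)" "ff \<sigma> n (partial_x i f y) = top_coeff n (partial_x i g y)" for y i
    by (simp_all add: ff_def g(2)) (simp_all add: g_def fun_simps)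
  have D: "((\<lambda>t. gcoeff (ff \<sigma> n (f (y(i := t)))) A) has_vector_derivative
     gcoeff (ff \<sigma> n (partial_x i f y)) A) (at (y i))" for i y A
    unfolding eq gcoeff_top_coeff using has_partial_x[OF g(1), of y i "shift_ext n A"]
    by (auto intro!: has_vector_derivative_mult_right)
  show "(\<lambda>y. ff \<sigma> n (f y)) \<in> diff_superfuns" by (rule diff_superfunsI, rule D)
  show "partial_x i (\<lambda>y. ff \<sigma> n (f y)) = (\<lambda>y. ff \<sigma> n (partial_x i f y))" by (rule partial_xI, rule D)
qed

lemma dd_G: "dd (G l) f = (\<lambda>x. ddg l (f x))"
  by (auto simp: ddg_def partial_xg_def csc_def)

lemma fbos_theta: "fbos \<sigma> m (xg l * f) y = theta l * fbos \<sigma> m f y"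
  by (rule grassmann_eqI) (simp add: gcoeff_fbos gcoeff_theta_mult fun_simps xg_def ft_zero ft_scale)

lemma fbos_gderiv: "fbos \<sigma> m (\<lambda>x. gderiv l (f x)) y = gderiv l (fbos \<sigma> m f y)"
  by (rule grassmann_eqI) (simp add: gcoeff_fbos gcoeff_gderiv ft_zero ft_scale)

lemma fbos_gconst: "fbos \<sigma> m (\<lambda>x. gconst c * f x) y = gconst c * fbos \<sigma> m f y"
  by (rule grassmann_eqI) (simp add: gcoeff_fbos ft_scale)

lemma fbos_ddg: "fbos \<sigma> m (\<lambda>x. ddg l (f x)) y = ddg l (fbos \<sigma> m f y)"
  by (simp add: ddg_def fbos_gconst fbos_gderiv)

lemma fbos_in_gens: "f \<in> gsfuns m n \<Longrightarrow> fbos \<sigma> m f y \<in> in_gens n"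
  by (simp add: in_gens_def gsfuns_def gcoeff_fbos ft_zero)

text \<open>The minus sign in \<open>dd (E i)\<close> and the factors in \<open>dd (G j)\<close> are
  what makes the same constant appear in the bosonic and the fermionic case.\<close>

lemma super_fourier_xx:
  assumes f: "f \<in> gsfuns m n" and l: "l \<in> gens m n" and s: "\<sigma>\<^sup>2 = 1"
  shows "super_fourier\<^sub>0 \<sigma> m n (xx l f) = csc (\<i> * of_real \<sigma>) (dd l (super_fourier\<^sub>0 \<sigma> m n f))"
proof (cases l)
  case (E i)
  then have i: "i \<in> {1..m}" using l by simp
  have "partial_x i (fbos \<sigma> m f) = csc (\<i> * of_real \<sigma>) (fbos \<sigma> m (xv i * f))"
    by (rule partial_xI, rule fbos_diff[OF f i s])
  then have "csc (\<i> * of_real \<sigma>) (dd l (super_fourier\<^sub>0 \<sigma> m n f)) =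
     csc (\<i> * of_real \<sigma>) (- csc (\<i> * of_real \<sigma>) (super_fourier\<^sub>0 \<sigma> m n (xx l f)))"
    by (simp add: E super_fourier_eq[OF f] super_fourier_eq[OF gsfuns_xv[OF f i]] partial_x_ff fbos_diff_superfuns[OF f s])
      (simp add: csc_def ff_linear gconst_mult[symmetric] mult.assoc)
  then show ?thesis
    by (simp add: sigma_square[OF s] csc_minus)
next
  case (G j)
  then have j: "j \<in> {1..2*n}" using l by simp
  show ?thesis
    by (simp add: G super_fourier_eq[OF f] super_fourier_eq[OF gsfuns_xg[OF f j]] fbos_theta ff_theta[OF fbos_in_gens[OF f] j s] dd_G del: dd.simps)
      (simp add: csc_def)
qed

lemma super_fourier_dd:
  assumes f: "f \<in> gsfuns m n" and d: "f \<in> diff_superfuns" and l: "l \<in> gens m n" and s: "\<sigma>\<^sup>2 = 1"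
    and df: "dd l f \<in> gsfuns m n"
  shows "super_fourier\<^sub>0 \<sigma> m n (dd l f) = csc (\<i> * of_real \<sigma>) (xx l (super_fourier\<^sub>0 \<sigma> m n f))"
proof (cases l)
  case (E i)
  then have i: "i \<in> {1..m}" using l by simp
  have "fbos \<sigma> m (dd l f) y = gconst (\<i> * of_real \<sigma> * of_real (y i)) * fbos \<sigma> m f y" for y
  proof (rule grassmann_eqI)
    fix A
    obtain g where g: "g \<in> gpolys m"
      "\<And>x. ((\<lambda>t. gcoeff (f (x(i := t))) A) has_vector_derivative g x) (at (x i))"
      "\<And>y. ft \<sigma> m g y = - (\<i> * of_real \<sigma> * of_real (y i)) * ft \<sigma> m (\<lambda>x. gcoeff (f x) A) y"
      using gpolys_derivative[OF gsfuns_coeff[OF f] i] by blast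
    have "gcoeff (partial_x i f x) A = g x" for x
      unfolding gcoeff_partial_x by (rule vector_derivative_at[OF g(2)])
    then have "(\<lambda>x. gcoeff (dd l f x) A) = (\<lambda>x. (- 1) * g x)"
      by (simp add: E fun_simps)
    then show "gcoeff (fbos \<sigma> m (dd l f) y) A = gcoeff (gconst (\<i> * of_real \<sigma> * of_real (y i)) * fbos \<sigma> m f y) A"
      by (simp only: gcoeff_fbos ft_scale g(3) gcoeff_gconst_mult) simp
  qed
  then show ?thesis
    by (simp add: super_fourier_eq f df ff_linear)
      (simp add: E fun_eq_iff csc_def xv_def fun_simps gconst_mult[symmetric] mult.assoc)
next
  case (G j)
  then have j: "j \<in> {1..2*n}" using l by simp
  have "fbos \<sigma> m (dd l f) y = ddg j (fbos \<sigma> m f y)" for y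
    by (simp add: G dd_G fbos_ddg del: dd.simps)
  then show ?thesis
    by (simp add: super_fourier_eq f df ff_ddg[OF j]) (simp add: G fun_eq_iff csc_def xg_def fun_simps)
qed

subsection \<open>The Gaussian\<close>

definition gs :: "nat \<Rightarrow> nat \<Rightarrow> scalar_superfun" where
  "gs m n = (\<lambda>x. gconst (gmonom m (\<lambda>_. 0) x) * fgauss n)"

lemma gaussian_eq: "gaussian m n = scalar (gs m n)"
proof -
  have "gexp (gconst (1/2) * super_vec_sq m n x) = gs m n x" for x
  proof -
    have xv2: "((xv j)\<^sup>2) x = gconst (of_real ((x j)\<^sup>2))" for j
      by (simp add: power2_eq_square fun_simps xv_def gconst_mult)
    have "super_vec_sq m n x = gsum n - gconst (of_real (\<Sum>j=1..m. (x j)\<^sup>2))"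
      unfolding super_vec_sq_def gsum_def minus_apply sum_fun_apply xv2 of_real_sum gconst_sum
      by (simp add: fun_simps xg_def)
    then have "gconst (1/2) * super_vec_sq m n x = gconst (1/2) * gsum n + gconst (- (1/2) * of_real (\<Sum>j=1..m. (x j)\<^sup>2))"
      by (simp only: right_diff_distrib gconst_mult gconst_uminus mult_minus_left) simp
    moreover have "exp (- (1/2) * of_real (\<Sum>j=1..m. (x j)\<^sup>2)) = gmonom m (\<lambda>_. 0) x"
    proof -
      have "exp (- (1/2) * (\<Sum>j=1..m. (x j)\<^sup>2)) = (\<Prod>j=1..m. exp (- (x j)\<^sup>2 / 2))"
        unfolding sum_distrib_left by (subst exp_sum) auto
      then have "complex_of_real (exp (- (1/2) * (\<Sum>j=1..m. (x j)\<^sup>2))) = gmonom m (\<lambda>_. 0) x"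
        by (simp only: gmonom_def gmono_def power_0 mult_1_left of_real_prod)
      then show ?thesis by (simp flip: exp_of_real)
    qed
    ultimately show ?thesis
      by (simp only: quad_exp(2)[OF quad_gsum] gs_def fgauss_def)
  qed
  then show ?thesis by (simp add: gaussian_def)
qed

lemma gs_gsfuns: "gs m n \<in> gsfuns m n"
proof -
  have "(\<lambda>x. gcoeff (gs m n x) A) \<in> gpolys m" for A
    using gpolys.scale[OF gpolys.gmonom, of "gcoeff (fgauss n) A"] by (simp add: gs_def mult.commute)
  then show ?thesis using fgauss_in_gens[of n] by (auto simp: gsfuns_def in_gens_def gs_def)
qed

lemma super_fourier_gs:
  assumes "\<sigma>\<^sup>2 = 1"
  shows "super_fourier\<^sub>0 \<sigma> m n (gs m n) = gs m n"
proof -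
  have "fbos \<sigma> m (gs m n) y = gconst (gmonom m (\<lambda>_. 0) y) * fgauss n" for y
  proof (rule grassmann_eqI)
    fix A
    have "(\<lambda>x. gcoeff (gs m n x) A) = (\<lambda>x. gcoeff (fgauss n) A * gmonom m (\<lambda>_. 0) x)"
      by (simp add: gs_def mult.commute)
    then show "gcoeff (fbos \<sigma> m (gs m n) y) A = gcoeff (gconst (gmonom m (\<lambda>_. 0) y) * fgauss n) A"
      by (simp add: gcoeff_fbos ft_scale ft_gaussian[OF assms])
  qed
  then show ?thesis
    by (simp add: super_fourier_eq gs_gsfuns ff_linear ff_fgauss[OF assms]) (simp add: gs_def)
qed

lemma gs_commute: "f * gs m n = gs m n * f" if "\<And>x. f x * fgauss n = fgauss n * f x" for f
  by (simp add: fun_eq_iff fun_simps gs_def gconst_left_commute[of "f _"] that mult.assoc)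

lemma gs_xx: "gs m n * xx l f = xx l (gs m n * f)"
proof -
  have "xv i * gs m n = gs m n * xv i" "xg i * gs m n = gs m n * xg i" for i
    by (rule gs_commute, simp add: xv_def gconst_commute, rule gs_commute, simp add: xg_def fgauss_commute)
  then show ?thesis by (cases l) (simp_all flip: mult.assoc)
qed

lemma gs_diff:
  shows "gs m n \<in> diff_superfuns" and "i \<in> {1..m} \<Longrightarrow> partial_x i (gs m n) = - xv i * gs m n"
proof -
  have D: "((\<lambda>t. gcoeff (gs m n (x(i := t))) A) has_vector_derivative
     gcoeff (gs m n x) A * - of_real (x i)) (at (x i))" if i: "i \<in> {1..m}" for x A i
  proof -
    have "((\<lambda>t. gmonom m (\<lambda>_. 0) (x(i := t))) has_vector_derivative gmonom m (\<lambda>_. 0) x * - of_real (x i)) (at (x i))"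
      using has_vector_derivative_mult_left[OF gmono_has_vector_derivative[of 0 "x i"], of "\<Prod>k\<in>{1..m}-{i}. gmono 0 (x k)"]
      by (simp add: gmonom_split[OF i] gmono_Suc mult_ac)
    from has_vector_derivative_mult_left[OF this, of "gcoeff (fgauss n) A"]
    show ?thesis by (simp add: gs_def mult_ac del: fun_upd_apply)
  qed
  show "gs m n \<in> diff_superfuns"
    unfolding diff_superfuns_def
  proof (intro CollectI allI)
    fix A i and x :: "nat \<Rightarrow> real"
    show "(\<lambda>t. gcoeff (gs m n (x(i := t))) A) differentiable (at (x i))"
    proof (cases "i \<in> {1..m}")
      case True
      then show ?thesis using D unfolding differentiable_def has_vector_derivative_def by blast
    next
      case False
      have "gmonom m (\<lambda>_. 0) (x(i := t)) = gmonom m (\<lambda>_. 0) x" for t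
        unfolding gmonom_def using False by (intro prod.cong) auto
      then show ?thesis by (simp add: gs_def del: fun_upd_apply)
    qed
  qed
  show "partial_x i (gs m n) = - xv i * gs m n" if "i \<in> {1..m}"
    by (rule partial_xI) (use D[OF that] in \<open>simp add: fun_simps xv_def mult.commute del: fun_upd_apply\<close>)
qed

text \<open>Differentiating the Gaussian gives multiplication by the variable, with the same sign
  for all letters. Conjugation thus turns \<open>dd l\<close> into \<open>xx l + dd l\<close>, and
  this is the origin of the 2 in \<open>rr\<close>.\<close>

lemma dd_gs:
  assumes f: "f \<in> diff_superfuns" and l: "l \<in> gens m n"
  shows "dd l (gs m n * f) = gs m n * (xx l f + dd l f)"
proof (cases l)
  case (E i)
  then have i: "i \<in> {1..m}" using l by simp
  show ?thesis
    using gs_xx[of m n l f]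
    by (simp add: E partial_x_mult[OF gs_diff(1) f] gs_diff(2)[OF i] right_diff_distrib distrib_left mult.assoc)
next
  case (G j)
  then have j: "j \<in> {1..2*n}" using l by simp
  have "dd l (gs m n * f) = xx l (gs m n * f) + gs m n * dd l f"
    by (simp add: G dd_G del: dd.simps)
      (simp add: fun_eq_iff fun_simps gs_def mult.assoc ddg_linear ddg_fgauss_mult[OF j] xg_def distrib_left
        gconst_left_commute[of "theta j"])
  then show ?thesis by (simp add: distrib_left gs_xx)
qed

lemma gs_spolys_gsfuns: "f \<in> spolys m n \<Longrightarrow> gs m n * f \<in> gsfuns m n"
  by (induction rule: spolys.induct)
    (auto simp: distrib_left gs_gsfuns mult_csc gs_xx intro: gsfuns_add gsfuns_csc gsfuns_xx)

lemma gs_spolys_diff: "f \<in> spolys m n \<Longrightarrow> gs m n * f \<in> diff_superfuns"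
  by (intro partial_x_mult gs_diff spolys_diff_superfuns)

lemma super_fourier_dd_gs:
  assumes f: "f \<in> spolys m n" and l: "l \<in> gens m n" and s: "\<sigma>\<^sup>2 = 1"
  shows "super_fourier\<^sub>0 \<sigma> m n (dd l (gs m n * f)) = csc (\<i> * of_real \<sigma>) (xx l (super_fourier\<^sub>0 \<sigma> m n (gs m n * f)))"
proof (rule super_fourier_dd[OF gs_spolys_gsfuns[OF f] gs_spolys_diff[OF f] l s])
  show "dd l (gs m n * f) \<in> gsfuns m n"
    unfolding dd_gs[OF spolys_diff_superfuns[OF f] l]
    by (intro gs_spolys_gsfuns spolys.add spolys.xx spolys_dd f l)
qed

definition raise :: "gen \<Rightarrow> scalar_superfun \<Rightarrow> scalar_superfun" where
  "raise l f = dd l f + xx l f"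

lemma raise_gs:
  assumes f: "f \<in> spolys m n" and l: "l \<in> gens m n"
  shows "raise l (gs m n * f) = gs m n * rr l f"
proof -
  have "csc 2 (xx l f) = xx l f + xx l f" using csc_add[of 1 1 "xx l f"] by simp
  then show ?thesis
    by (simp add: raise_def rr_def dd_gs[OF spolys_diff_superfuns[OF f] l] gs_xx[symmetric] distrib_left add_ac)
qed

text \<open>The transform exchanges \<open>xx l\<close> and \<open>dd l\<close> with one and the
  same factor, so it intertwines their sum with itself.\<close>

lemma super_fourier_raise:
  assumes f: "f \<in> spolys m n" and l: "l \<in> gens m n" and s: "\<sigma>\<^sup>2 = 1"
  shows "super_fourier\<^sub>0 \<sigma> m n (raise l (gs m n * f)) = csc (\<i> * of_real \<sigma>) (raise l (super_fourier\<^sub>0 \<sigma> m n (gs m n * f)))"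
proof -
  have "dd l (gs m n * f) \<in> gsfuns m n"
    unfolding dd_gs[OF spolys_diff_superfuns[OF f] l]
    by (intro gs_spolys_gsfuns spolys.add spolys.xx spolys_dd f l)
  then show ?thesis
    using super_fourier_add[OF _ gsfuns_xx[OF gs_spolys_gsfuns[OF f] l], of _ \<sigma>]
      super_fourier_xx[OF gs_spolys_gsfuns[OF f] l s] super_fourier_dd_gs[OF f l s]
    by (simp add: raise_def add.commute)
qed

lemma raise_csc: "f \<in> diff_superfuns \<Longrightarrow> raise l (csc c f) = csc c (raise l f)"
  by (simp add: raise_def dd_csc)

lemma super_fourier_hermite:
  assumes s: "\<sigma>\<^sup>2 = 1"
  shows "hermite m n d p \<Longrightarrow> super_fourier\<^sub>0 \<sigma> m n (gs m n * p) = csc ((\<i> * of_real \<sigma>) ^ d) (gs m n * p)"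
proof (induction rule: hermite.induct)
  case (zero d)
  then show ?case using super_fourier_csc[OF gs_gsfuns, of \<sigma> m n 0] by simp
next
  case one
  then show ?case by (simp add: super_fourier_gs[OF s])
next
  case (add d p q)
  then show ?case
    using super_fourier_add[OF gs_spolys_gsfuns[OF hermite_spolys[OF add.hyps(1)]] gs_spolys_gsfuns[OF hermite_spolys[OF add.hyps(2)]]]
    by (simp add: distrib_left)
next
  case (csc d p c)
  then show ?case
    using super_fourier_csc[OF gs_spolys_gsfuns[OF hermite_spolys[OF csc.hyps(1)]]]
    by (simp add: mult_csc mult.commute)
next
  case (rr d p l)
  note p = hermite_spolys[OF rr.hyps(1)]
  show ?case
    using super_fourier_raise[OF p rr.hyps(2) s] rr.IH
    by (simp add: raise_gs[OF p rr.hyps(2)] raise_csc gs_spolys_diff[OF p])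
qed

section \<open>A dual description of the relation ideal\<close>

lemma poly_mapping_expand:
  fixes f :: "'a \<Rightarrow>\<^sub>0 'b::comm_monoid_add"
  shows "f = (\<Sum>w\<in>Poly_Mapping.keys f. Poly_Mapping.single w (Poly_Mapping.lookup f w))"
proof (rule poly_mapping_eqI)
  fix k
  have "(\<Sum>w\<in>Poly_Mapping.keys f. Poly_Mapping.lookup (Poly_Mapping.single w (Poly_Mapping.lookup f w)) k) =
     (\<Sum>w\<in>Poly_Mapping.keys f. if w = k then Poly_Mapping.lookup f k else 0)"
    by (rule sum.cong) (auto simp: lookup_single when_def)
  then show "Poly_Mapping.lookup f k = Poly_Mapping.lookup (\<Sum>w\<in>Poly_Mapping.keys f. Poly_Mapping.single w (Poly_Mapping.lookup f w)) k"
    by (simp add: lookup_sum in_keys_iff)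
qed

lemma poly_mapping_sum_induct:
  fixes f :: "'a \<Rightarrow>\<^sub>0 'b::comm_monoid_add"
  assumes "P 0" "\<And>f g. P f \<Longrightarrow> P g \<Longrightarrow> P (f + g)"
    "\<And>w. w \<in> Poly_Mapping.keys f \<Longrightarrow> P (Poly_Mapping.single w (Poly_Mapping.lookup f w))"
  shows "P f"
proof -
  have "P (\<Sum>w\<in>S. Poly_Mapping.single w (Poly_Mapping.lookup f w))" if "finite S" "S \<subseteq> Poly_Mapping.keys f" for S
    using that by (induction S rule: finite_induct) (auto intro: assms)
  from this[of "Poly_Mapping.keys f"] show ?thesis by (simp flip: poly_mapping_expand)
qed

text \<open>The linear functional on the free algebra with value \<open>\<mu> w\<close> on the word
  \<open>w\<close>, applied to the second tensor factor.\<close>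

definition pairing_with :: "(monomial \<Rightarrow> complex) \<Rightarrow> superfun \<Rightarrow> scalar_superfun" where
  "pairing_with \<mu> f = (\<Sum>w\<in>Poly_Mapping.keys f. csc (\<mu> w) (Poly_Mapping.lookup f w))"

lemma pairing_with_superset:
  assumes "finite S" "Poly_Mapping.keys f \<subseteq> S"
  shows "pairing_with \<mu> f = (\<Sum>w\<in>S. csc (\<mu> w) (Poly_Mapping.lookup f w))"
  unfolding pairing_with_def using assms
  by (intro sum.mono_neutral_left) (auto simp: in_keys_iff)

lemma pairing_with_zero [simp]: "pairing_with \<mu> 0 = 0"
  by (simp add: pairing_with_def)

lemma pairing_with_add: "pairing_with \<mu> (f + g) = pairing_with \<mu> f + pairing_with \<mu> g"
proof -
  let ?S = "Poly_Mapping.keys f \<union> Poly_Mapping.keys g"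
  have "finite ?S" "Poly_Mapping.keys (f + g) \<subseteq> ?S" by (auto simp: Poly_Mapping.keys_add)
  then show ?thesis
    by (simp add: pairing_with_superset[of ?S] lookup_add sum.distrib)
qed

lemma pairing_with_single [simp]: "pairing_with \<mu> (Poly_Mapping.single w c) = csc (\<mu> w) c"
  by (cases "c = 0") (simp_all add: pairing_with_def)

lemma pairing_with_uminus: "pairing_with \<mu> (- f) = - pairing_with \<mu> f"
  using pairing_with_add[of \<mu> f "- f"] by (simp add: add_eq_0_iff)

lemma pairing_with_diff: "pairing_with \<mu> (f - g) = pairing_with \<mu> f - pairing_with \<mu> g"
  using pairing_with_add[of \<mu> f "- g"] by (simp add: pairing_with_uminus)

lemma pairing_with_sum: "pairing_with \<mu> (\<Sum>i\<in>I. f i) = (\<Sum>i\<in>I. pairing_with \<mu> (f i))"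
  by (induction I rule: infinite_finite_induct) (simp_all add: pairing_with_add)

lemma pairing_with_scalar: "pairing_with \<mu> (scalar s * f) = s * pairing_with \<mu> f"
  by (induction f rule: poly_mapping_sum_induct)
    (simp_all add: distrib_left pairing_with_add mult_single mult_csc)

lemma csc_mult: "csc c f = (\<lambda>_. gconst c) * f"
  by (auto simp: csc_def fun_simps)

lemma pairing_with_const: "pairing_with \<mu> (const c * f) = csc c (pairing_with \<mu> f)"
  by (simp add: const_def pairing_with_scalar csc_mult)

definition letter :: "gen \<Rightarrow> superfun" where
  "letter l = Poly_Mapping.single (Mon [l]) 1"

definition cons_word :: "gen \<Rightarrow> monomial \<Rightarrow> monomial" where
  "cons_word l w = Mon (l # letters w)"

lemma letter_single: "letter l * Poly_Mapping.single w c = Poly_Mapping.single (cons_word l w) c"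
  by (simp add: letter_def mult_single plus_monomial_def cons_word_def)

lemma pairing_with_letter: "pairing_with \<mu> (letter l * f) = pairing_with (\<lambda>w. \<mu> (cons_word l w)) f"
  by (induction f rule: poly_mapping_sum_induct)
    (simp_all add: distrib_left pairing_with_add letter_single)

lemma superfuns_mult: "a \<in> superfuns m n \<Longrightarrow> b \<in> superfuns m n \<Longrightarrow> a * b \<in> superfuns m n"
  unfolding superfuns_def using Poly_Mapping.keys_mult[of a b]
  by (fastforce simp: plus_monomial_def)

lemma superfuns_single: "set (letters w) \<subseteq> gens m n \<Longrightarrow> Poly_Mapping.single w c \<in> superfuns m n"
  by (simp add: superfuns_def)

lemma relation_ideal_mult_left:
  "f \<in> relation_ideal m n \<Longrightarrow> a \<in> superfuns m n \<Longrightarrow> a * f \<in> relation_ideal m n"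
proof (induction rule: relation_ideal.induct)
  case (gen b r c)
  then show ?case
    using relation_ideal.gen[OF superfuns_mult[OF gen.prems gen.hyps(1)] gen.hyps(2,3)]
    by (simp add: mult.assoc)
qed (auto simp: distrib_left intro: relation_ideal.intros)

lemma relation_ideal_mult_right:
  "f \<in> relation_ideal m n \<Longrightarrow> a \<in> superfuns m n \<Longrightarrow> f * a \<in> relation_ideal m n"
proof (induction rule: relation_ideal.induct)
  case (gen b r c)
  then show ?case
    using relation_ideal.gen[OF gen.hyps(1,2) superfuns_mult[OF gen.hyps(3) gen.prems]]
    by (simp add: mult.assoc)
qed (auto simp: distrib_right intro: relation_ideal.intros)

definition annihilators :: "nat \<Rightarrow> nat \<Rightarrow> (monomial \<Rightarrow> complex) set" where
  "annihilators m n = {\<mu>. \<forall>f\<in>relation_ideal m n. pairing_with \<mu> f = 0}"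

text \<open>Dual to the stability of the ideal under left multiplication by a letter. It allows the
  letters in front of the summands of the Dirac operator to be absorbed into the functional.\<close>

lemma annihilators_cons:
  assumes "\<mu> \<in> annihilators m n" "l \<in> gens m n"
  shows "(\<lambda>w. \<mu> (cons_word l w)) \<in> annihilators m n"
proof -
  have "letter l \<in> superfuns m n" unfolding letter_def using assms(2) by (intro superfuns_single) auto
  then show ?thesis
    using assms(1) relation_ideal_mult_left unfolding annihilators_def
    by (auto simp flip: pairing_with_letter)
qed

text \<open>Superfunctions with constant coefficients, identified with the free algebra over \<open>\<complex>\<close>.\<close>

definition emb :: "(monomial \<Rightarrow>\<^sub>0 complex) \<Rightarrow> superfun" where
  "emb p = Poly_Mapping.map (\<lambda>c _. gconst c) p"

lemma gconst_fun: "(\<lambda>_. 0) = (0::scalar_superfun)" "(\<lambda>_. 1) = (1::scalar_superfun)"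
  by (simp_all add: zero_fun_def one_fun_def)

lemma lookup_emb: "Poly_Mapping.lookup (emb p) w = (\<lambda>_. gconst (Poly_Mapping.lookup p w))"
  by (simp add: emb_def Poly_Mapping.map.rep_eq when_def gconst_fun)

lemma emb_add: "emb (p + q) = emb p + emb q"
  by (rule poly_mapping_eqI) (simp add: lookup_emb lookup_add gconst_add fun_eq_iff fun_simps)

lemma emb_single: "emb (Poly_Mapping.single w c) = Poly_Mapping.single w (\<lambda>_. gconst c)"
  by (rule poly_mapping_eqI) (simp add: lookup_emb lookup_single when_def gconst_fun)

lemma emb_zero [simp]: "emb 0 = 0"
  using emb_single[of 0 0] by (simp add: gconst_fun)

lemma emb_uminus: "emb (- p) = - emb p"
  using emb_add[of p "- p"] by (simp add: add_eq_0_iff)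

lemma emb_diff: "emb (p - q) = emb p - emb q"
  using emb_add[of p "- q"] by (simp add: emb_uminus)

lemma gconst_fun_mult: "(\<lambda>_. gconst a) * (\<lambda>_. gconst b) = (\<lambda>_. gconst (a * b) :: grassmann)"
  by (simp add: fun_eq_iff fun_simps gconst_mult)

lemma emb_mult: "emb (p * q) = emb p * emb q"
proof (induction p rule: poly_mapping_sum_induct)
  case (3 w)
  show ?case
    by (induction q rule: poly_mapping_sum_induct)
      (simp_all add: distrib_left emb_add emb_single mult_single gconst_fun_mult)
qed (simp_all add: distrib_right emb_add)

lemma emb_scale: "emb (Poly_Mapping.single 0 c * p) = const c * emb p"
  by (simp add: emb_mult emb_single const_def)

lemma emb_range_one: "Poly_Mapping.single w 1 \<in> range emb"
proof -
  have "emb (Poly_Mapping.single w 1) = Poly_Mapping.single w 1" by (simp add: emb_single gconst_fun)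
  then show ?thesis by (metis rangeI)
qed

text \<open>Constancy of the relations is what reduces the ideal to linear algebra over the complex
  numbers.\<close>

lemma relations_const: "r \<in> relations m n \<Longrightarrow> r \<in> range emb"
proof -
  have add: "a + b \<in> range emb" and diff: "a - b \<in> range emb" and mult: "a * b \<in> range emb"
    if "a \<in> range emb" "b \<in> range emb" for a b
    using that by (auto simp flip: emb_add emb_diff emb_mult)
  have 0: "0 \<in> range emb" using emb_zero by (metis rangeI)
  have 1: "1 \<in> range emb" using emb_range_one[of 0] by simp
  have e: "e_orth j \<in> range emb" "e_symp j \<in> range emb" for j
    unfolding e_orth_def e_symp_def by (rule emb_range_one)+
  have 2: "2 \<in> range emb" using add[OF 1 1] by simp
  show "r \<in> relations m n \<Longrightarrow> r \<in> range emb"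
    by (induction rule: relations.induct) (auto intro!: add diff mult e 0 1 2)
qed

section \<open>The free algebra as a complex vector space, and the ideal as a span of constant
  elements\<close>

abbreviation fscale :: "complex \<Rightarrow> (monomial \<Rightarrow>\<^sub>0 complex) \<Rightarrow> (monomial \<Rightarrow>\<^sub>0 complex)" where
  "fscale c p \<equiv> Poly_Mapping.single 0 c * p"

interpretation free: vector_space fscale
  by standard (simp_all add: distrib_left distrib_right single_add mult_single flip: mult.assoc)

interpretation free_pair: vector_space_pair fscale fscale ..

text \<open>A basis of \<open>I\<close> is extended to a basis of the whole space; \<open>P\<close>
  kills the former and fixes the new basis vectors, so it projects along \<open>I\<close>.\<close>

lemma free_projection:
  assumes I: "free.subspace I"
  obtains P where "Vector_Spaces.linear fscale fscale P" "\<And>p. p \<in> I \<Longrightarrow> P p = 0" "\<And>p. p - P p \<in> I"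
proof -
  obtain B where B: "B \<subseteq> I" "free.independent B" "I \<subseteq> free.span B"
    using free.maximal_independent_subset by blast
  have BI: "free.span B = I" using B free.span_minimal[OF B(1) I] by blast
  let ?B = "free.extend_basis B"
  have ext: "B \<subseteq> ?B" "free.independent ?B" "free.span ?B = UNIV"
    using B(2) by (auto simp: free.extend_basis_superset free.independent_extend_basis)
  obtain P where P: "Vector_Spaces.linear fscale fscale P" "\<And>b. b \<in> ?B \<Longrightarrow> P b = (if b \<in> B then 0 else b)"
    using free_pair.linear_independent_extend[OF ext(2), of "\<lambda>b. if b \<in> B then 0 else b"] by blast
  interpret P: Vector_Spaces.linear fscale fscale P by (rule P(1))
  have "P p = 0" if "p \<in> free.span B" for p
    using that
  proof (induction rule: free.span_induct_alt)
    case (step c b p)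
    then show ?case using P(2) ext(1) by (auto simp: P.add P.scale)
  qed (simp add: P.zero)
  moreover have "p - P p \<in> I" for p
  proof -
    have "p \<in> free.span ?B" using ext(3) by simp
    then show ?thesis
    proof (induction rule: free.span_induct_alt)
      case base
      then show ?case using free.subspace_0[OF I] by (simp add: P.zero)
    next
      case (step c b p)
      have "b - P b \<in> I" using P(2)[OF step(1)] free.subspace_0[OF I] B(1) by auto
      then have "fscale c (b - P b) + (p - P p) \<in> I"
        using step free.subspace_add[OF I] free.subspace_scale[OF I] by blast
      then show ?case by (simp add: P.add P.scale right_diff_distrib algebra_simps)
    qed
  qed
  ultimately show ?thesis using that P(1) BI by blast
qed

inductive_set ideal_span :: "nat \<Rightarrow> nat \<Rightarrow> superfun set" for m n where
  zero: "0 \<in> ideal_span m n"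
| step: "g \<in> ideal_span m n \<Longrightarrow> emb q \<in> relation_ideal m n \<Longrightarrow> g + scalar h * emb q \<in> ideal_span m n"

lemma ideal_span_add: "g \<in> ideal_span m n \<Longrightarrow> f \<in> ideal_span m n \<Longrightarrow> f + g \<in> ideal_span m n"
  by (induction rule: ideal_span.induct) (auto simp: add.assoc[symmetric] intro: ideal_span.step)

text \<open>Function coefficients commute with words, and constants are central in the Grassmann
  algebra. The outer coefficients can therefore be merged, in their order, into one scalar
  factor.\<close>

lemma single_emb_single:
  "Poly_Mapping.single u a * emb p * Poly_Mapping.single v b =
     scalar (a * b) * (Poly_Mapping.single u 1 * emb p * Poly_Mapping.single v 1)"
proof (induction p rule: poly_mapping_sum_induct)
  case (3 w)
  have "a * (\<lambda>_. gconst c) * b = a * b * (\<lambda>_. gconst c)" for c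
    by (simp add: fun_eq_iff fun_simps mult.assoc gconst_commute[of b c for b])
  then show ?case by (simp add: emb_single mult_single)
qed (simp_all add: distrib_left distrib_right emb_add)

lemma relation_ideal_span: "f \<in> relation_ideal m n \<Longrightarrow> f \<in> ideal_span m n"
proof (induction rule: relation_ideal.induct)
  case (gen a r b)
  obtain p where p: "r = emb p" using relations_const[OF gen.hyps(2)] by blast
  have key: "Poly_Mapping.single u c * emb p * Poly_Mapping.single v d \<in> ideal_span m n"
    if "set (letters u) \<subseteq> gens m n" "set (letters v) \<subseteq> gens m n" for u v c d
  proof -
    let ?q = "Poly_Mapping.single u 1 * p * Poly_Mapping.single v 1 :: monomial \<Rightarrow>\<^sub>0 complex"
    have q: "emb ?q = Poly_Mapping.single u 1 * emb p * Poly_Mapping.single v 1"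
      by (simp add: emb_mult emb_single gconst_fun)
    have "emb ?q \<in> relation_ideal m n"
      unfolding q p[symmetric] by (intro relation_ideal.gen superfuns_single that gen.hyps)
    from ideal_span.step[OF ideal_span.zero this, of "c * d"] show ?thesis
      by (simp add: single_emb_single[of u c p v d] q)
  qed
  have key2: "Poly_Mapping.single u c * emb p * b \<in> ideal_span m n"
    if u: "set (letters u) \<subseteq> gens m n" for u c
  proof (rule poly_mapping_sum_induct[where f = b and P = "\<lambda>b. Poly_Mapping.single u c * emb p * b \<in> ideal_span m n"])
    fix v assume "v \<in> Poly_Mapping.keys b"
    then show "Poly_Mapping.single u c * emb p * Poly_Mapping.single v (Poly_Mapping.lookup b v) \<in> ideal_span m n"
      using key[OF u] gen.hyps(3) by (auto simp: superfuns_def)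
  qed (auto simp: distrib_left ideal_span.zero intro: ideal_span_add)
  show ?case unfolding p
  proof (rule poly_mapping_sum_induct[where f = a and P = "\<lambda>a. a * emb p * b \<in> ideal_span m n"])
    fix u assume "u \<in> Poly_Mapping.keys a"
    then show "Poly_Mapping.single u (Poly_Mapping.lookup a u) * emb p * b \<in> ideal_span m n"
      using key2 gen.hyps(1) by (auto simp: superfuns_def)
  qed (auto simp: distrib_right ideal_span.zero intro: ideal_span_add)
qed (auto intro: ideal_span.zero ideal_span_add)

lemma relation_ideal_uminus: "f \<in> relation_ideal m n \<Longrightarrow> - f \<in> relation_ideal m n"
  using ideal_diff[OF relation_ideal.zero] by force

text \<open>For the converse, each word \<open>w\<close> is split as \<open>w - P w\<close> plus
  \<open>P w\<close>, with \<open>P\<close> the projection along the constant elements of the ideal.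
  The first parts contribute an element of the ideal; the second parts contribute zero because the
  coordinates of \<open>P\<close> are annihilators.\<close>

lemma relation_ideal_iff:
  "f \<in> relation_ideal m n \<longleftrightarrow> (\<forall>\<mu>\<in>annihilators m n. pairing_with \<mu> f = 0)"
proof
  assume R: "\<forall>\<mu>\<in>annihilators m n. pairing_with \<mu> f = 0"
  let ?I = "{p. emb p \<in> relation_ideal m n}"
  have "free.subspace ?I"
    by (auto simp: free.subspace_def emb_add emb_scale const_def
        intro: relation_ideal.zero relation_ideal.add relation_ideal_scalar)
  from free_projection[OF this] obtain P where P: "Vector_Spaces.linear fscale fscale P"
    "\<And>p. p \<in> ?I \<Longrightarrow> P p = 0" "\<And>p. p - P p \<in> ?I"
    by blast
  interpret P: Vector_Spaces.linear fscale fscale P by (rule P(1))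
  \<comment> \<open>The functional \<open>\<mu> u\<close> takes the coordinate at \<open>u\<close>
    of the projection.\<close>
  define \<mu> where "\<mu> u w = Poly_Mapping.lookup (P (Poly_Mapping.single w 1)) u" for u w
  have \<mu>_emb: "pairing_with (\<mu> u) (emb p) = (\<lambda>_. gconst (Poly_Mapping.lookup (P p) u))" for u p
  proof (induction p rule: poly_mapping_sum_induct)
    case (3 w)
    have "P (Poly_Mapping.single w (Poly_Mapping.lookup p w)) =
        fscale (Poly_Mapping.lookup p w) (P (Poly_Mapping.single w 1))"
      by (simp add: P.scale[symmetric] mult_single)
    moreover have "Poly_Mapping.lookup (fscale c q) u = c * Poly_Mapping.lookup q u" for c q
      by (simp add: mult_map_scale_conv_mult[symmetric] Poly_Mapping.map.rep_eq when_def)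
    ultimately show ?case
      by (simp add: emb_single \<mu>_def csc_def gconst_mult mult.commute)
  qed (auto simp: P.zero P.add pairing_with_add emb_add lookup_add gconst_add fun_eq_iff fun_simps)
  have "\<mu> u \<in> annihilators m n" for u
    unfolding annihilators_def
  proof (intro CollectI ballI)
    fix g assume "g \<in> relation_ideal m n"
    then have "g \<in> ideal_span m n" by (rule relation_ideal_span)
    then show "pairing_with (\<mu> u) g = 0"
    proof induction
      case (step g q h)
      then have "P q = 0" using P(2) by blast
      then show ?case using step by (simp add: pairing_with_add pairing_with_scalar \<mu>_emb gconst_fun)
    qed simp
  qed
  then have f0: "pairing_with (\<mu> u) f = 0" for u using R by blast
  let ?K = "Poly_Mapping.keys f" and ?c = "Poly_Mapping.lookup f"
  let ?s = "\<lambda>w. Poly_Mapping.single w 1 :: monomial \<Rightarrow>\<^sub>0 complex"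
  have "f = (\<Sum>w\<in>?K. scalar (?c w) * emb (?s w))"
    by (subst poly_mapping_expand[of f]) (simp add: emb_single mult_single gconst_fun)
  also have "\<dots> = (\<Sum>w\<in>?K. scalar (?c w) * emb (?s w - P (?s w))) + (\<Sum>w\<in>?K. scalar (?c w) * emb (P (?s w)))"
    by (simp add: emb_diff right_diff_distrib sum_subtractf)
  \<comment> \<open>The coefficient of this sum at \<open>u\<close> is the pairing of
    \<open>f\<close> with \<open>\<mu> u\<close>.\<close>
  also have "(\<Sum>w\<in>?K. scalar (?c w) * emb (P (?s w))) = 0"
  proof (rule poly_mapping_eqI)
    fix u
    have "Poly_Mapping.lookup (scalar a * g) u = a * Poly_Mapping.lookup g u" for a :: scalar_superfun and g
      by (simp add: mult_map_scale_conv_mult[symmetric] Poly_Mapping.map.rep_eq when_def)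
    moreover have "?c w * (\<lambda>_. gconst c) = csc c (?c w)" for w c
      by (simp add: fun_eq_iff fun_simps csc_def gconst_commute)
    ultimately have "Poly_Mapping.lookup (\<Sum>w\<in>?K. scalar (?c w) * emb (P (?s w))) u = pairing_with (\<mu> u) f"
      by (simp add: lookup_sum lookup_emb pairing_with_def \<mu>_def)
    then show "Poly_Mapping.lookup (\<Sum>w\<in>?K. scalar (?c w) * emb (P (?s w))) u = Poly_Mapping.lookup 0 u"
      using f0 by simp
  qed
  finally have "f = (\<Sum>w\<in>?K. scalar (?c w) * emb (?s w - P (?s w)))" by simp
  also have "\<dots> \<in> relation_ideal m n"
    using P(3) by (intro relation_ideal_sum relation_ideal_scalar) blast
  finally show "f \<in> relation_ideal m n" .
qed (auto simp: annihilators_def)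

section \<open>Lifting to superfunctions with values in the algebra\<close>

definition valued :: "scalar_superfun set \<Rightarrow> superfun set" where
  "valued S = {f. \<forall>w. Poly_Mapping.lookup f w \<in> S}"

text \<open>Derivatives and integrals are linear only on suitable functions, so linearity is
  recorded relative to a subspace \<open>S\<close>.\<close>

definition lin_on :: "scalar_superfun set \<Rightarrow> (scalar_superfun \<Rightarrow> scalar_superfun) \<Rightarrow> bool" where
  "lin_on S T \<longleftrightarrow> 0 \<in> S \<and> (\<forall>f\<in>S. \<forall>g\<in>S. f + g \<in> S \<and> T (f + g) = T f + T g) \<and>
     (\<forall>f\<in>S. \<forall>c. csc c f \<in> S \<and> T (csc c f) = csc c (T f))"

lemma lin_on_zero: "lin_on S T \<Longrightarrow> T 0 = 0"
  unfolding lin_on_def by (metis csc_simps(6))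

lemma lin_on_sum:
  assumes "lin_on S T" "\<And>i. i \<in> I \<Longrightarrow> f i \<in> S"
  shows "(\<Sum>i\<in>I. f i) \<in> S \<and> T (\<Sum>i\<in>I. f i) = (\<Sum>i\<in>I. T (f i))"
  using assms(2)
proof (induction I rule: infinite_finite_induct)
  case (insert i I)
  then show ?case using assms(1) by (simp add: lin_on_def)
qed (use assms(1) lin_on_zero[OF assms(1)] in \<open>auto simp: lin_on_def\<close>)

lemma lookup_lift_op:
  assumes "T 0 = 0"
  shows "Poly_Mapping.lookup (lift_op T f) w = T (Poly_Mapping.lookup f w)"
  using assms by (simp add: lift_op_def Poly_Mapping.map.rep_eq when_def)

text \<open>The operator acts on the first tensor factor and the functional on the second. Linearity
  of \<open>T\<close> on \<open>S\<close> makes them commute.\<close>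

lemma pairing_with_lift_op:
  assumes T: "lin_on S T" and f: "f \<in> valued S"
  shows "pairing_with \<mu> (lift_op T f) = T (pairing_with \<mu> f)" "pairing_with \<mu> f \<in> S"
proof -
  have in_S: "csc (\<mu> w) (Poly_Mapping.lookup f w) \<in> S" for w
    using T f by (simp add: lin_on_def valued_def)
  have "Poly_Mapping.keys (lift_op T f) \<subseteq> Poly_Mapping.keys f"
    by (auto simp: in_keys_iff lookup_lift_op lin_on_zero[OF T])
  then have "pairing_with \<mu> (lift_op T f) = (\<Sum>w\<in>Poly_Mapping.keys f. csc (\<mu> w) (T (Poly_Mapping.lookup f w)))"
    by (subst pairing_with_superset[of "Poly_Mapping.keys f"]) (simp_all add: lookup_lift_op lin_on_zero[OF T])
  also have "\<dots> = (\<Sum>w\<in>Poly_Mapping.keys f. T (csc (\<mu> w) (Poly_Mapping.lookup f w)))"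
    by (rule sum.cong) (use T f in \<open>simp_all add: lin_on_def valued_def\<close>)
  also have "\<dots> = T (pairing_with \<mu> f)"
    using lin_on_sum[OF T, of "Poly_Mapping.keys f" "\<lambda>w. csc (\<mu> w) (Poly_Mapping.lookup f w)"] in_S
    by (simp add: pairing_with_def)
  finally show "pairing_with \<mu> (lift_op T f) = T (pairing_with \<mu> f)" .
  show "pairing_with \<mu> f \<in> S"
    unfolding pairing_with_def
    using lin_on_sum[OF T, of "Poly_Mapping.keys f" "\<lambda>w. csc (\<mu> w) (Poly_Mapping.lookup f w)"] in_S by simp
qed

lemma lookup_letter_mult:
  "Poly_Mapping.lookup (letter l * f) w =
    (case letters w of [] \<Rightarrow> 0 | a # v \<Rightarrow> if a = l then Poly_Mapping.lookup f (Mon v) else 0)"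
proof (induction f rule: poly_mapping_sum_induct)
  case (3 v)
  show ?case
    by (cases w; cases v) (auto simp: letter_single lookup_single when_def cons_word_def split: list.split)
qed (auto simp: distrib_left lookup_add split: list.split)

lemma lift_op_letter:
  assumes "T 0 = 0"
  shows "lift_op T (letter l * f) = letter l * lift_op T f"
  by (rule poly_mapping_eqI) (auto simp: lookup_letter_mult lookup_lift_op assms split: list.split)

lemma valued_letter: "0 \<in> S \<Longrightarrow> f \<in> valued S \<Longrightarrow> letter l * f \<in> valued S"
  by (auto simp: valued_def lookup_letter_mult split: list.split)

lemma lookup_scalar_mult: "Poly_Mapping.lookup (scalar s * f) w = s * Poly_Mapping.lookup f w"
  by (simp add: mult_map_scale_conv_mult[symmetric] Poly_Mapping.map.rep_eq when_def)

lemma lookup_const_mult: "Poly_Mapping.lookup (const c * f) w = csc c (Poly_Mapping.lookup f w)"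
  by (simp add: const_def lookup_scalar_mult csc_mult)

lemma valued_lin:
  assumes "lin_on S T"
  shows "f \<in> valued S \<Longrightarrow> g \<in> valued S \<Longrightarrow> f + g \<in> valued S"
    and "f \<in> valued S \<Longrightarrow> g \<in> valued S \<Longrightarrow> f - g \<in> valued S"
    and "f \<in> valued S \<Longrightarrow> const c * f \<in> valued S"
    and "(\<And>i. i \<in> I \<Longrightarrow> F i \<in> valued S) \<Longrightarrow> (\<Sum>i\<in>I. F i) \<in> valued S"
proof -
  show "f \<in> valued S \<Longrightarrow> g \<in> valued S \<Longrightarrow> f + g \<in> valued S"
    using assms by (simp add: valued_def lookup_add lin_on_def)
  show "f - g \<in> valued S" if "f \<in> valued S" "g \<in> valued S"
  proof -
    have "Poly_Mapping.lookup f w + csc (-1) (Poly_Mapping.lookup g w) \<in> S" for w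
      using assms that by (simp add: valued_def lin_on_def)
    then show ?thesis by (simp add: valued_def lookup_minus csc_minus)
  qed
  show "f \<in> valued S \<Longrightarrow> const c * f \<in> valued S"
    using assms by (simp add: valued_def lookup_const_mult lin_on_def)
  show "(\<And>i. i \<in> I \<Longrightarrow> F i \<in> valued S) \<Longrightarrow> (\<Sum>i\<in>I. F i) \<in> valued S"
    using lin_on_sum[OF assms, of I] by (simp add: valued_def lookup_sum)
qed

lemma lookup_mult_scalar: "Poly_Mapping.lookup (f * scalar s) w = Poly_Mapping.lookup f w * s"
proof (induction f rule: poly_mapping_sum_induct)
  case (3 v)
  then show ?case by (simp add: mult_single lookup_single when_def)
qed (simp_all add: lookup_add distrib_right)

lemma lift_op_linear:
  assumes T: "lin_on S T"
  shows "f \<in> valued S \<Longrightarrow> g \<in> valued S \<Longrightarrow> lift_op T (f - g) = lift_op T f - lift_op T g"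
    and "f \<in> valued S \<Longrightarrow> lift_op T (const c * f) = const c * lift_op T f"
    and "(\<And>i. i \<in> I \<Longrightarrow> F i \<in> valued S) \<Longrightarrow> lift_op T (\<Sum>i\<in>I. F i) = (\<Sum>i\<in>I. lift_op T (F i))"
proof -
  show "lift_op T (f - g) = lift_op T f - lift_op T g" if "f \<in> valued S" "g \<in> valued S"
  proof (rule poly_mapping_eqI)
    fix w
    have "T (Poly_Mapping.lookup f w + csc (-1) (Poly_Mapping.lookup g w)) =
      T (Poly_Mapping.lookup f w) + csc (-1) (T (Poly_Mapping.lookup g w))"
      using T that by (simp add: valued_def lin_on_def)
    then show "Poly_Mapping.lookup (lift_op T (f - g)) w = Poly_Mapping.lookup (lift_op T f - lift_op T g) w"
      by (simp add: lookup_lift_op lin_on_zero[OF T] lookup_minus csc_minus)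
  qed
  show "lift_op T (const c * f) = const c * lift_op T f" if "f \<in> valued S"
    by (rule poly_mapping_eqI)
      (use T that in \<open>simp add: lookup_lift_op lin_on_zero[OF T] lookup_const_mult valued_def lin_on_def\<close>)
  show "lift_op T (\<Sum>i\<in>I. F i) = (\<Sum>i\<in>I. lift_op T (F i))" if "\<And>i. i \<in> I \<Longrightarrow> F i \<in> valued S"
    by (rule poly_mapping_eqI)
      (use lin_on_sum[OF T, of I] that in \<open>simp add: lookup_lift_op lin_on_zero[OF T] lookup_sum valued_def\<close>)
qed

lemma const_mult: "const a * const b = const (a * b)"
  by (simp add: const_def mult_single gconst_fun_mult)

lemma const_one: "const 1 = 1"
  by (simp add: const_def gconst_fun)

lemma const_minus: "const (- c) = - const c"
proof -
  have "(\<lambda>_. gconst (- c)) = - ((\<lambda>_. gconst c) :: scalar_superfun)"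
    by (simp add: fun_eq_iff fun_simps gconst_uminus)
  then show ?thesis unfolding const_def by (simp only: single_uminus)
qed

lemma const_add: "const (a + b) = const a + const b"
proof -
  have "(\<lambda>_. gconst (a + b)) = (\<lambda>_. gconst a) + ((\<lambda>_. gconst b) :: scalar_superfun)"
    by (simp add: fun_eq_iff fun_simps gconst_add)
  then show ?thesis unfolding const_def by (simp only: single_add)
qed

lemma scalar_letter_commute: "scalar s * letter l = letter l * scalar s"
  by (simp add: letter_def mult_single)

lemma sum_gens: "(\<Sum>l\<in>gens m n. h l) = (\<Sum>i=1..m. h (E i)) + (\<Sum>j=1..2*n. h (G j))"
  for h :: "gen \<Rightarrow> 'a::comm_monoid_add"
proof -
  have "(\<Sum>l\<in>gens m n. h l) = (\<Sum>l\<in>E ` {1..m}. h l) + (\<Sum>l\<in>G ` {1..2*n}. h l)"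
    unfolding gens_def by (rule sum.union_disjoint) auto
  then show ?thesis by (simp add: sum.reindex inj_on_def)
qed

lemma partial_zero: "partial_x i 0 = 0" "partial_xg j 0 = 0"
  using partial_x_const(2)[of i 0] by (auto simp: gconst_fun partial_xg_def fun_eq_iff fun_simps)

lemma dirac_eq: "dirac m n f = (\<Sum>l\<in>gens m n. letter l * lift_op (dd l) f)"
proof -
  have E: "letter (E i) * lift_op (dd (E i)) f = - (e_orth i * lift_op (partial_x i) f)" for i
  proof -
    have "lift_op (dd (E i)) f = - lift_op (partial_x i) f"
      by (rule poly_mapping_eqI) (simp add: lookup_lift_op partial_zero)
    then show ?thesis by (simp add: letter_def e_orth_def)
  qed
  have c2: "csc 2 g = g + g" for g using csc_add[of 1 1 g] by simp
  have G1: "letter (G (2*j)) * lift_op (dd (G (2*j))) f = 2 * (e_symp (2*j) * lift_op (partial_xg (2*j-1)) f)" for j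
  proof -
    have "lift_op (dd (G (2*j))) f = lift_op (partial_xg (2*j-1)) f + lift_op (partial_xg (2*j-1)) f"
      by (rule poly_mapping_eqI) (simp add: lookup_lift_op partial_zero lookup_add c2)
    then show ?thesis by (simp add: letter_def e_symp_def mult_2 distrib_left)
  qed
  have G2: "letter (G (2*j-1)) * lift_op (dd (G (2*j-1))) f = - (2 * (e_symp (2*j-1) * lift_op (partial_xg (2*j)) f))"
    if "j \<in> {1..n}" for j
  proof -
    have j: "odd (2*j-1)" "2*j-1+1 = 2*j" using that by auto
    have "lift_op (dd (G (2*j-1))) f = - (lift_op (partial_xg (2*j)) f + lift_op (partial_xg (2*j)) f)"
      by (rule poly_mapping_eqI)
        (simp only: lookup_lift_op dd.simps j if_False partial_zero csc_simps lookup_add lookup_uminus csc_minus c2)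
    then show ?thesis by (simp only: letter_def e_symp_def mult_2 distrib_left mult_minus_right)
  qed
  have "(\<Sum>j=1..2*n. letter (G j) * lift_op (dd (G j)) f) =
    (\<Sum>j=1..n. 2 * (e_symp (2*j) * lift_op (partial_xg (2*j-1)) f - e_symp (2*j-1) * lift_op (partial_xg (2*j)) f))"
    unfolding sum_parity by (rule sum.cong) (simp_all only: G1 G2 right_diff_distrib add_uminus_conv_diff uminus_add_conv_diff)
  then show ?thesis
    unfolding sum_gens E by (simp add: dirac_def sum_distrib_left sum_negf)
qed

lemma super_vec_mult: "super_vec m n * f = (\<Sum>l\<in>gens m n. letter l * lift_op (xx l) f)"
proof -
  have "lift_op (xx (E i)) f = scalar (xv i) * f" "lift_op (xx (G i)) f = scalar (xg i) * f" for i
    by (rule poly_mapping_eqI, simp add: lookup_lift_op lookup_scalar_mult)+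
  then have "scalar (xv i) * e_orth i * f = letter (E i) * lift_op (xx (E i)) f"
    "scalar (xg i) * e_symp i * f = letter (G i) * lift_op (xx (G i)) f" for i
    by (simp_all add: e_orth_def e_symp_def letter_def mult_single flip: mult.assoc)
  then show ?thesis
    unfolding sum_gens super_vec_def distrib_right sum_distrib_right by simp
qed

lemma raise_zero: "raise l 0 = 0"
  by (simp add: raise_def dd_zero)

lemma dirac_plus_vec_eq: "dirac_plus_vec m n f = (\<Sum>l\<in>gens m n. letter l * lift_op (raise l) f)"
proof -
  have "lift_op (dd l) f + lift_op (xx l) f = lift_op (raise l) f" for l
    by (rule poly_mapping_eqI) (simp add: lookup_lift_op lookup_add dd_zero raise_zero, simp add: raise_def)
  then show ?thesis
    unfolding dirac_plus_vec_def dirac_eq super_vec_mult sum.distrib[symmetric] distrib_left[symmetric] by simp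
qed

subsection \<open>Superpolynomials\<close>

lift_definition theta_basis :: "nat set \<Rightarrow> grassmann" is "\<lambda>A B. if finite A \<and> B = A then 1 else 0"
  by auto

lemma theta_basis_insert:
  assumes "finite A" "\<forall>a\<in>A. l < a"
  shows "theta_basis (insert l A) = theta l * theta_basis A"
proof (rule grassmann_eqI)
  fix B
  have "below (insert l A) l = 0" using assms(2) by (auto simp: below_def)
  moreover have "l \<notin> A" using assms(2) by auto
  ultimately show "gcoeff (theta_basis (insert l A)) B = gcoeff (theta l * theta_basis A) B"
    using assms(1) by (auto simp: gcoeff_theta_mult theta_basis.rep_eq insert_absorb)
qed

lemma spolys_theta_basis:
  assumes "finite A" "A \<subseteq> {1..2*n}"
  shows "(\<lambda>_. theta_basis A) \<in> spolys m n"
  using assms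
proof (induction A rule: finite_linorder_min_induct)
  case empty
  have "theta_basis {} = 1"
    by (rule grassmann_eqI) (simp add: theta_basis.rep_eq gcoeff_one)
  then show ?case using spolys.one by (simp add: one_fun_def)
next
  case (insert l A)
  have "(\<lambda>_. theta_basis (insert l A)) = xx (G l) (\<lambda>_. theta_basis A)"
    using insert by (simp add: fun_eq_iff fun_simps xg_def theta_basis_insert)
  then show ?case using insert by (auto intro!: spolys.xx simp del: xx.simps)
qed

lemma spolys_monomial:
  assumes "h \<in> spolys m n" "k \<le> m"
  shows "(\<lambda>x. gconst (\<Prod>i=1..k. complex_of_real (x i) ^ \<alpha> i) * h x) \<in> spolys m n"
  using assms(2)
proof (induction k)
  case 0
  then show ?case using assms(1) by simp
next
  case (Suc k)
  have "(\<lambda>x. gconst (complex_of_real (x (Suc k)) ^ r) * g x) \<in> spolys m n" if "g \<in> spolys m n" for g r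
  proof (induction r)
    case (Suc r)
    have "(\<lambda>x. gconst (complex_of_real (x (Suc k)) ^ Suc r) * g x) =
      xx (E (Suc k)) (\<lambda>x. gconst (complex_of_real (x (Suc k)) ^ r) * g x)"
      by (simp add: fun_eq_iff fun_simps xv_def gconst_mult flip: mult.assoc)
    then show ?case using spolys.xx[OF Suc, of "E (Suc k)"] \<open>Suc k \<le> m\<close> by simp
  qed (use that in simp)
  from this[OF Suc.IH, of "\<alpha> (Suc k)"] Suc.prems
  show ?case by (simp add: gconst_mult mult.commute flip: mult.assoc)
qed

lemma spolys_poly:
  assumes "p \<in> poly_funs m" "h \<in> spolys m n"
  shows "(\<lambda>x. gconst (p x) * h x) \<in> spolys m n"
proof -
  obtain S :: "(nat \<Rightarrow> nat) set" and c where S: "finite S"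
    "p = (\<lambda>x. \<Sum>\<alpha>\<in>S. c \<alpha> * (\<Prod>i=1..m. complex_of_real (x i) ^ \<alpha> i))"
    using assms(1) unfolding poly_funs_def by blast
  have "(\<lambda>x. gconst (p x) * h x) =
    (\<Sum>\<alpha>\<in>S. csc (c \<alpha>) (\<lambda>x. gconst (\<Prod>i=1..m. complex_of_real (x i) ^ \<alpha> i) * h x))"
    by (simp add: fun_eq_iff sum_fun_apply S(2) csc_def gconst_sum sum_distrib_right gconst_mult[symmetric] mult.assoc)
  also have "\<dots> \<in> spolys m n"
    by (intro spolys_sum spolys.csc spolys_monomial assms(2)) simp
  finally show ?thesis .
qed

lemma superpolys_spolys:
  assumes "\<And>A. (\<lambda>x. gcoeff (h x) A) \<in> (if A \<subseteq> {1..2*n} then poly_funs m else {0})"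
  shows "h \<in> spolys m n"
proof -
  have "h = (\<Sum>A\<in>Pow {1..2*n}. (\<lambda>x. gconst (gcoeff (h x) A) * theta_basis A))"
  proof (intro ext grassmann_eqI)
    fix x B
    have "(\<Sum>A\<in>Pow {1..2*n}. gcoeff (h x) A * gcoeff (theta_basis A) B) =
      (\<Sum>A\<in>Pow {1..2*n}. if A = B then gcoeff (h x) B else 0)"
      by (rule sum.cong) (auto simp: theta_basis.rep_eq dest: finite_subset)
    also have "\<dots> = gcoeff (h x) B"
    proof (cases "B \<subseteq> {1..2*n}")
      case False
      then have "gcoeff (h x) B = 0" using assms[of B] by (simp add: fun_eq_iff fun_simps del: One_nat_def)
      then show ?thesis by simp
    qed simp
    finally show "gcoeff (h x) B = gcoeff ((\<Sum>A\<in>Pow {1..2*n}. (\<lambda>x. gconst (gcoeff (h x) A) * theta_basis A)) x) B"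
      by (simp add: sum_fun_apply gcoeff_sum)
  qed
  also have "\<dots> \<in> spolys m n"
  proof (rule spolys_sum)
    fix A assume "A \<in> Pow {1..2*n}"
    then have "A \<subseteq> {1..2*n}" "finite A" by (auto dest: finite_subset)
    then show "(\<lambda>x. gconst (gcoeff (h x) A) * theta_basis A) \<in> spolys m n"
      using spolys_poly[OF _ spolys_theta_basis, of "\<lambda>x. gcoeff (h x) A" m A n] assms[of A] by simp
  qed
  finally show ?thesis .
qed

lemma superpolys_valued:
  assumes "H \<in> superpolys m n"
  shows "H \<in> valued (spolys m n)" "H \<in> superfuns m n"
  using assms superpolys_spolys unfolding superpolys_def valued_def by blast+

section \<open>The Dirac, Laplace and Euler operators under functionals on C\<close>

lemma lin_on_dd: "lin_on (spolys m n) (dd l)"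
  by (auto simp: lin_on_def spolys_0 dd_add dd_csc spolys_diff_superfuns intro: spolys.intros)

lemma lin_on_id: "lin_on (spolys m n) (\<lambda>f. f)"
  by (auto simp: lin_on_def spolys_0 intro: spolys.intros)

lemma pairing_with_dirac:
  assumes "f \<in> valued (spolys m n)"
  shows "pairing_with \<mu> (dirac m n f) = (\<Sum>l\<in>gens m n. dd l (pairing_with (\<lambda>w. \<mu> (cons_word l w)) f))"
  by (simp add: dirac_eq pairing_with_sum pairing_with_letter pairing_with_lift_op[OF lin_on_dd assms])

lemma dirac_valued:
  assumes "f \<in> valued (spolys m n)"
  shows "dirac m n f \<in> valued (spolys m n)"
  unfolding dirac_eq
proof (intro valued_lin(4)[OF lin_on_id] valued_letter spolys_0)
  fix l show "lift_op (dd l) f \<in> valued (spolys m n)"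
    using assms by (simp add: valued_def lookup_lift_op dd_zero spolys_dd)
qed

text \<open>The five families of relations in one formula: the plus sign in front of
  \<open>ss\<close> gives anticommutators where variables commute and commutators where they
  anticommute.\<close>

lemma relation_letters:
  assumes "l \<in> gens m n" "l' \<in> gens m n"
  shows "letter l * letter l' + const (ss l l') * (letter l' * letter l) - const (if l' = partner l then kap l else 0)
    \<in> relation_ideal m n"
proof -
  have L: "letter (E i) = e_orth i" "letter (G i) = e_symp i" for i
    by (simp_all add: letter_def e_orth_def e_symp_def)
  have c0: "const 0 = 0" by (simp add: const_def gconst_fun)
  have c2: "const 2 = 2" using const_add[of 1 1] by (simp add: const_one)
  note c = c0 c2 const_one const_minus
  note rel = relations.intros[THEN relation_ideal_relation]
  have odd: "2*j - 1 \<noteq> 2*i" "2*i \<noteq> 2*j - 1" if "j \<in> {1..n}" for i j :: nat using that by (auto, presburger+)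
  from assms(1) show ?thesis
  proof (cases rule: gens_cases)
    case l: (1 i)
    from assms(2) show ?thesis
    proof (cases rule: gens_cases)
      case (1 j)
      then show ?thesis using rel(1)[OF l(2) 1(2), of n] l by (auto simp: L c)
    next
      case (2 j)
      then show ?thesis using rel(5)[OF l(2), of "2*j" n] l by (simp add: L c)
    next
      case (3 j)
      then have "2*j-1 \<in> {1..2*n}" by auto
      then show ?thesis using rel(5)[OF l(2), of "2*j-1" n] l 3 by (simp add: L c)
    qed
  next
    case l: (2 i)
    from assms(2) show ?thesis
    proof (cases rule: gens_cases)
      case (1 j)
      then show ?thesis using rel(5)[OF 1(2), of "2*i" n] l by (simp add: L c add.commute)
    next
      case (2 j)
      then show ?thesis using rel(2)[OF l(2) 2(2), of m] l odd[OF l(2), of j] by (simp add: L c)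
    next
      case (3 j)
      \<comment> \<open>The defining relation has the odd letter first; reversing the order changes
        the sign of its constant, in accordance with \<open>kap (G (2*i)) = -1\<close>.\<close>
      have "- (e_symp (2*j-1) * e_symp (2*i) - e_symp (2*i) * e_symp (2*j-1) - (if j = i then 1 else 0)) \<in> relation_ideal m n"
        by (rule relation_ideal_uminus, rule rel(4)[OF 3(2) l(2)])
      moreover have "G (2*j-1) = partner (G (2*i)) \<longleftrightarrow> j = i"
        using 3(2) l(2) by auto
      ultimately show ?thesis using 3(1) l(1)
        by (cases "j = i") (simp_all add: L c algebra_simps)
    qed
  next
    case l: (3 i)
    have oi: "odd (2*i - 1)" "2*i - 1 + 1 = 2*i" using l(2) by auto
    from assms(2) show ?thesis
    proof (cases rule: gens_cases)
      case (1 j)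
      have "2*i-1 \<in> {1..2*n}" using l(2) by auto
      then show ?thesis using rel(5)[OF 1(2), of "2*i-1" n] l 1 by (simp add: L c add.commute)
    next
      case (2 j)
      have "G (2*j) = partner (G (2*i-1)) \<longleftrightarrow> i = j"
        using oi by (simp only: partner.simps if_False gen.inject) auto
      then show ?thesis using rel(4)[OF l(2) 2(2), of m] l(1) 2(1) oi(1)
        by (cases "i = j") (simp_all add: L c)
    next
      case (3 j)
      have "G (2*j-1) \<noteq> partner (G (2*i-1))"
        using oi odd[OF 3(2), of i] by (simp only: partner.simps if_False gen.inject simp_thms)
      then show ?thesis using rel(3)[OF l(2) 3(2), of m] l(1) 3(1)
        by (simp add: L c)
    qed
  qed
qed

lemma pairing_with_letters:
  assumes \<mu>: "\<mu> \<in> annihilators m n" and l: "l \<in> gens m n" "l' \<in> gens m n" and H: "H \<in> superfuns m n"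
  shows "pairing_with (\<lambda>w. \<mu> (cons_word l (cons_word l' w))) H +
      csc (ss l l') (pairing_with (\<lambda>w. \<mu> (cons_word l' (cons_word l w))) H) =
    csc (if l' = partner l then kap l else 0) (pairing_with \<mu> H)"
proof -
  have "pairing_with \<mu> ((letter l * letter l' + const (ss l l') * (letter l' * letter l) -
      const (if l' = partner l then kap l else 0)) * H) = 0"
    using \<mu> relation_ideal_mult_right[OF relation_letters[OF l] H] unfolding annihilators_def by blast
  then show ?thesis
    by (simp only: left_diff_distrib distrib_right pairing_with_diff pairing_with_add mult.assoc
      pairing_with_const pairing_with_letter right_minus_eq)
qed

text \<open>Adding the double sum to itself with the roles of \<open>l\<close> and \<open>l'\<close>
  interchanged, and exchanging the two derivatives by \<open>dd_dd\<close>, leaves only the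
  combination of letters in \<open>relation_letters\<close>. This is a constant and nonzero only for
  partners.\<close>

lemma twice_dirac_dirac:
  assumes \<mu>: "\<mu> \<in> annihilators m n" and H: "H \<in> superpolys m n"
  shows "csc 2 (pairing_with \<mu> (dirac m n (dirac m n H))) =
    (\<Sum>l\<in>gens m n. csc (kap l) (dd l (dd (partner l) (pairing_with \<mu> H))))"
proof -
  let ?h = "\<lambda>l l'. pairing_with (\<lambda>w. \<mu> (cons_word l (cons_word l' w))) H"
  let ?I = "gens m n"
  note V = superpolys_valued[OF H]
  have h: "pairing_with \<nu> H \<in> spolys m n" for \<nu>
    by (rule pairing_with_lift_op(2)[OF lin_on_id V(1)])
  have T: "pairing_with \<mu> (dirac m n (dirac m n H)) = (\<Sum>l\<in>?I. \<Sum>l'\<in>?I. dd l (dd l' (?h l l')))"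
    by (simp add: pairing_with_dirac dirac_valued V(1) dd_sum[of _ _ m n] h spolys_dd)
  have "csc 2 (pairing_with \<mu> (dirac m n (dirac m n H))) =
    (\<Sum>l\<in>?I. \<Sum>l'\<in>?I. dd l (dd l' (?h l l'))) + (\<Sum>l\<in>?I. \<Sum>l'\<in>?I. dd l' (dd l (?h l' l)))"
    using csc_add[of 1 1] unfolding T by (subst (3) sum.swap) simp
  also have "\<dots> = (\<Sum>l\<in>?I. \<Sum>l'\<in>?I. dd l (dd l' (?h l l' + csc (ss l l') (?h l' l))))"
    unfolding sum.distrib[symmetric]
  proof (intro sum.cong refl)
    fix l l'
    show "dd l (dd l' (?h l l')) + dd l' (dd l (?h l' l)) = dd l (dd l' (?h l l' + csc (ss l l') (?h l' l)))"
      by (simp add: dd_add dd_csc h spolys_diff_superfuns[of _ m n] dd_diff_superfuns[of _ m n] partial_x_csc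
        dd_dd[OF h, of l' l] ss_commute[of l' l])
  qed
  also have "\<dots> = (\<Sum>l\<in>?I. \<Sum>l'\<in>?I. if l' = partner l then csc (kap l) (dd l (dd (partner l) (pairing_with \<mu> H))) else 0)"
  proof (intro sum.cong refl)
    fix l l' assume l: "l \<in> ?I" "l' \<in> ?I"
    show "dd l (dd l' (?h l l' + csc (ss l l') (?h l' l))) =
       (if l' = partner l then csc (kap l) (dd l (dd (partner l) (pairing_with \<mu> H))) else 0)"
      unfolding pairing_with_letters[OF \<mu> l V(2)]
      by (simp add: dd_zero dd_csc spolys_diff_superfuns[OF h] dd_diff_superfuns[OF h])
  qed
  also have "\<dots> = (\<Sum>l\<in>?I. csc (kap l) (dd l (dd (partner l) (pairing_with \<mu> H))))"
    by (intro sum.cong refl) simp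
  finally show ?thesis .
qed

text \<open>The plain partial derivative in the variable of \<open>l\<close>, in contrast to
  \<open>dd l\<close>, which carries a factor and, for symplectic letters, differentiates in the
  variable of the partner.\<close>

definition pd :: "gen \<Rightarrow> scalar_superfun \<Rightarrow> scalar_superfun" where
  "pd l f = (case l of E i \<Rightarrow> partial_x i f | G j \<Rightarrow> partial_xg j f)"

lemma lin_on_pd: "lin_on (spolys m n) (pd l)"
  by (cases l)
    (auto simp: pd_def lin_on_def spolys_0 partial_x_add partial_x_csc partial_xg_linear spolys_diff_superfuns
      intro: spolys.intros)

lemma euler_eq: "euler m n f = (\<Sum>l\<in>gens m n. lift_op (xx l) (lift_op (pd l) f))"
proof -
  have "lift_op (xx (E i)) f = scalar (xv i) * f" "lift_op (xx (G i)) f = scalar (xg i) * f" for i f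
    by (rule poly_mapping_eqI, simp add: lookup_lift_op lookup_scalar_mult)+
  then show ?thesis
    unfolding sum_gens euler_def by (simp add: pd_def[abs_def])
qed

lemma pairing_with_euler:
  assumes "f \<in> valued (spolys m n)"
  shows "pairing_with \<mu> (euler m n f) = (\<Sum>l\<in>gens m n. xx l (pd l (pairing_with \<mu> f)))"
proof -
  have xx: "lin_on UNIV (xx l)" for l by (simp add: lin_on_def)
  have "lift_op (pd l) f \<in> valued UNIV" for l by (simp add: valued_def)
  then show ?thesis
    by (simp add: euler_eq pairing_with_sum pairing_with_lift_op[OF xx] pairing_with_lift_op[OF lin_on_pd assms])
qed

lemma kap_pd:
  assumes "l \<in> gens m n"
  shows "csc (kap l) (dd (partner l) f) = csc 2 (pd l f)"
  using assms
proof (cases rule: gens_cases)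
  case (1 i)
  then show ?thesis by (simp add: pd_def csc_minus)
next
  case (2 j)
  then have "odd (2*j-1)" "2*j-1+1 = 2*j" by auto
  then show ?thesis
    using 2 by (simp only: pd_def partner.simps kap.simps dd.simps if_False if_True gen.case csc_simps) (simp add: csc_minus)
next
  case (3 j)
  then have "odd (2*j-1)" "2*j-1+1 = 2*j" by auto
  then show ?thesis
    using 3 by (simp only: pd_def partner.simps kap.simps dd.simps if_False gen.case csc_simps) simp
qed

text \<open>Under an annihilator both congruences become equations for one scalar superpolynomial.
  The second-order part of \<open>numop\<close> is then zero and the first-order part gives the
  eigenvalue \<open>4 * k\<close>.\<close>

lemma harmonic_hermite:
  assumes H: "H \<in> superpolys m n" and lap: "cong\<^sub>C m n (laplace m n H) 0"
    and eul: "cong\<^sub>C m n (euler m n H) (of_nat k * H)" and \<mu>: "\<mu> \<in> annihilators m n"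
  shows "hermite m n k (pairing_with \<mu> H)"
proof -
  let ?h = "pairing_with \<mu> H"
  note V = superpolys_valued[OF H]
  have h: "?h \<in> spolys m n" by (rule pairing_with_lift_op(2)[OF lin_on_id V(1)])
  have cn: "const (of_nat k) = of_nat k"
    by (induction k) (simp_all add: const_add const_one, simp add: const_def gconst_fun)
  have "pairing_with \<mu> (laplace m n H) = 0"
    using lap \<mu> by (simp add: cong\<^sub>C_def annihilators_def)
  then have L: "(\<Sum>l\<in>gens m n. csc (kap l) (dd l (dd (partner l) ?h))) = 0"
    using twice_dirac_dirac[OF \<mu> H] by (simp add: laplace_def)
  have "pairing_with \<mu> (euler m n H - const (of_nat k) * H) = 0"
    using eul \<mu> by (simp add: cong\<^sub>C_def annihilators_def cn)
  then have Eu: "(\<Sum>l\<in>gens m n. xx l (pd l ?h)) = csc (of_nat k) ?h"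
    by (simp add: pairing_with_diff pairing_with_const pairing_with_euler[OF V(1)])
  have "csc (kap l) (rr l (dd (partner l) ?h)) = csc 4 (xx l (pd l ?h)) + csc (kap l) (dd l (dd (partner l) ?h))"
    if "l \<in> gens m n" for l
  proof -
    have "csc (kap l) (csc 2 (xx l (dd (partner l) ?h))) = csc 2 (xx l (csc (kap l) (dd (partner l) ?h)))"
      by (simp add: mult.commute)
    then show ?thesis unfolding kap_pd[OF that] by (simp add: rr_def)
  qed
  then have "numop m n ?h = csc 4 (\<Sum>l\<in>gens m n. xx l (pd l ?h)) + (\<Sum>l\<in>gens m n. csc (kap l) (dd l (dd (partner l) ?h)))"
    by (simp add: numop_def sum.distrib csc_sum)
  also have "\<dots> = csc (4 * of_nat k) ?h"
    unfolding L Eu by simp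
  finally show ?thesis by (rule numop_eigen_hermite[OF h])
qed

section \<open>The super Fourier transform of the Hermite functions\<close>

text \<open>This space is invariant under the raising operators and under the transform, so
  iterating the Dirac operator plus vector variable never leaves it.\<close>

definition gauss_polys :: "nat \<Rightarrow> nat \<Rightarrow> scalar_superfun set" where
  "gauss_polys m n = (\<lambda>p. gs m n * p) ` spolys m n"

lemma gauss_polys_lin:
  shows "0 \<in> gauss_polys m n"
    and "f \<in> gauss_polys m n \<Longrightarrow> g \<in> gauss_polys m n \<Longrightarrow> f + g \<in> gauss_polys m n"
    and "f \<in> gauss_polys m n \<Longrightarrow> csc c f \<in> gauss_polys m n"
proof -
  show "0 \<in> gauss_polys m n"
    unfolding gauss_polys_def using spolys_0[of m n] by (metis image_eqI mult_zero_right)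
  show "f \<in> gauss_polys m n \<Longrightarrow> g \<in> gauss_polys m n \<Longrightarrow> f + g \<in> gauss_polys m n"
    unfolding gauss_polys_def by (auto intro: spolys.add simp flip: distrib_left)
  show "f \<in> gauss_polys m n \<Longrightarrow> csc c f \<in> gauss_polys m n"
    unfolding gauss_polys_def by (auto intro: spolys.csc simp flip: mult_csc)
qed

lemma lin_on_gauss_polys:
  shows lin_on_raise: "lin_on (gauss_polys m n) (raise l)"
    and lin_on_fourier: "lin_on (gauss_polys m n) (super_fourier\<^sub>0 \<sigma> m n)"
proof -
  have d: "f \<in> diff_superfuns" "f \<in> gsfuns m n" if "f \<in> gauss_polys m n" for f
    using that by (auto simp: gauss_polys_def gs_spolys_diff gs_spolys_gsfuns)
  show "lin_on (gauss_polys m n) (raise l)"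
    unfolding lin_on_def by (auto simp: gauss_polys_lin d raise_def dd_add dd_csc)
  show "lin_on (gauss_polys m n) (super_fourier\<^sub>0 \<sigma> m n)"
    unfolding lin_on_def by (auto simp: gauss_polys_lin d super_fourier_add super_fourier_csc)
qed

lemma gauss_polys_raise: "f \<in> gauss_polys m n \<Longrightarrow> l \<in> gens m n \<Longrightarrow> raise l f \<in> gauss_polys m n"
  by (auto simp: gauss_polys_def raise_gs intro: spolys_rr)

text \<open>The expansion into Hermite components yields the closure, since on each component the
  transform is a scalar.\<close>

lemma gauss_polys_fourier:
  assumes "f \<in> gauss_polys m n" "\<sigma>\<^sup>2 = 1"
  shows "super_fourier\<^sub>0 \<sigma> m n f \<in> gauss_polys m n"
proof -
  obtain p where p: "p \<in> spolys m n" "f = gs m n * p" using assms(1) by (auto simp: gauss_polys_def)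
  have "super_fourier\<^sub>0 \<sigma> m n (gs m n * p) \<in> gauss_polys m n"
    using spolys_hermite_span[OF p(1)]
  proof induction
    case zero
    then show ?case using lin_on_zero[OF lin_on_fourier] gauss_polys_lin(1) by simp
  next
    case (step d q u)
    have q: "gs m n * q \<in> gauss_polys m n" "gs m n * u \<in> gauss_polys m n"
      using hermite_spolys[OF step.hyps(1)] hermite_span_spolys[OF step.hyps(2)] by (auto simp: gauss_polys_def)
    then have "super_fourier\<^sub>0 \<sigma> m n (gs m n * (q + u)) =
      csc ((\<i> * of_real \<sigma>) ^ d) (gs m n * q) + super_fourier\<^sub>0 \<sigma> m n (gs m n * u)"
      using lin_on_fourier[of m n \<sigma>] super_fourier_hermite[OF assms(2) step.hyps(1)]
      unfolding lin_on_def by (simp add: distrib_left)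
    then show ?case using q(1) step.IH by (simp add: gauss_polys_lin)
  qed
  then show ?thesis by (simp add: p(2))
qed

lemma spolys_gs_commute: "f \<in> spolys m n \<Longrightarrow> f * gs m n = gs m n * f"
proof (induction rule: spolys.induct)
  case (csc f c)
  have "csc c f * gs m n = csc c (f * gs m n)" by (simp add: csc_mult mult.assoc)
  then show ?case using csc by (simp add: mult_csc)
next
  case (xx f l)
  have "xx l f * gs m n = xx l (f * gs m n)" by (cases l) (simp_all add: mult.assoc)
  then show ?case using xx by (simp add: gs_xx)
qed (simp_all add: distrib_left distrib_right)

lemma mult_gaussian:
  assumes "H \<in> valued (spolys m n)"
  shows "H * gaussian m n \<in> valued (gauss_polys m n)"
    and "pairing_with \<mu> (H * gaussian m n) = gs m n * pairing_with \<mu> H"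
proof -
  have lk: "Poly_Mapping.lookup (H * gaussian m n) w = gs m n * Poly_Mapping.lookup H w" for w
    using assms by (simp add: gaussian_eq lookup_mult_scalar spolys_gs_commute valued_def)
  then show "H * gaussian m n \<in> valued (gauss_polys m n)"
    using assms by (simp add: valued_def gauss_polys_def)
  have "H * gaussian m n = scalar (gs m n) * H"
    by (rule poly_mapping_eqI) (simp add: lk lookup_scalar_mult)
  then show "pairing_with \<mu> (H * gaussian m n) = gs m n * pairing_with \<mu> H"
    by (simp add: pairing_with_scalar)
qed

lemma dirac_plus_vec_valued:
  assumes "f \<in> valued (gauss_polys m n)"
  shows "dirac_plus_vec m n f \<in> valued (gauss_polys m n)"
  unfolding dirac_plus_vec_eq
proof (intro valued_lin(4)[OF lin_on_raise] valued_letter gauss_polys_lin)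
  fix l assume "l \<in> gens m n"
  then show "lift_op (raise l) f \<in> valued (gauss_polys m n)"
    using assms by (simp add: valued_def lookup_lift_op raise_zero gauss_polys_raise)
qed

lemma dirac_plus_vec_linear:
  assumes "f \<in> valued (gauss_polys m n)"
  shows "g \<in> valued (gauss_polys m n) \<Longrightarrow>
      dirac_plus_vec m n (f - g) = dirac_plus_vec m n f - dirac_plus_vec m n g"
    and "dirac_plus_vec m n (const c * f) = const c * dirac_plus_vec m n f"
proof -
  show "dirac_plus_vec m n (f - g) = dirac_plus_vec m n f - dirac_plus_vec m n g"
    if "g \<in> valued (gauss_polys m n)"
    by (simp add: dirac_plus_vec_eq lift_op_linear(1)[OF lin_on_raise assms that] right_diff_distrib sum_subtractf)
  have "letter l * (const c * g) = const c * (letter l * g)" for l g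
    using scalar_letter_commute[of "\<lambda>_. gconst c" l] by (simp add: const_def flip: mult.assoc)
  then show "dirac_plus_vec m n (const c * f) = const c * dirac_plus_vec m n f"
    by (simp add: dirac_plus_vec_eq lift_op_linear(2)[OF lin_on_raise assms] sum_distrib_left)
qed

text \<open>The operator involves derivatives and is no mere multiplication, so its compatibility
  with congruence needs proof. Annihilators absorb the letters, and the remaining scalar operators
  map zero to zero.\<close>

lemma dirac_plus_vec_ideal:
  assumes f: "f \<in> valued (gauss_polys m n)" and I: "f \<in> relation_ideal m n"
  shows "dirac_plus_vec m n f \<in> relation_ideal m n"
  unfolding relation_ideal_iff
proof
  fix \<mu> assume "\<mu> \<in> annihilators m n"
  then have "pairing_with (\<lambda>w. \<mu> (cons_word l w)) f = 0" if "l \<in> gens m n" for l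
    using annihilators_cons[OF _ that] I by (auto simp: relation_ideal_iff)
  then show "pairing_with \<mu> (dirac_plus_vec m n f) = 0"
    by (simp add: dirac_plus_vec_eq pairing_with_sum pairing_with_letter pairing_with_lift_op[OF lin_on_raise f] raise_zero)
qed

text \<open>An equality and not just a congruence, as no letters are reordered. In the iteration the
  relations of C thus enter the eigenvalue only through the start \<open>j = 0\<close>.\<close>

lemma fourier_dirac_plus_vec:
  assumes f: "f \<in> valued (gauss_polys m n)" and s: "\<sigma>\<^sup>2 = 1"
  shows "super_fourier \<sigma> m n (dirac_plus_vec m n f) = const (\<i> * of_real \<sigma>) * dirac_plus_vec m n (super_fourier \<sigma> m n f)"
proof -
  note F0 = lin_on_zero[OF lin_on_fourier]
  have v: "lift_op (raise l) f \<in> valued (gauss_polys m n)" if "l \<in> gens m n" for l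
    using f that by (simp add: valued_def lookup_lift_op raise_zero gauss_polys_raise)
  have *: "lift_op (super_fourier\<^sub>0 \<sigma> m n) (lift_op (raise l) f) =
    const (\<i> * of_real \<sigma>) * lift_op (raise l) (lift_op (super_fourier\<^sub>0 \<sigma> m n) f)" if l: "l \<in> gens m n" for l
  proof (rule poly_mapping_eqI)
    fix w
    obtain p where "p \<in> spolys m n" "Poly_Mapping.lookup f w = gs m n * p"
      using f by (auto simp: valued_def gauss_polys_def)
    then show "Poly_Mapping.lookup (lift_op (super_fourier\<^sub>0 \<sigma> m n) (lift_op (raise l) f)) w =
      Poly_Mapping.lookup (const (\<i> * of_real \<sigma>) * lift_op (raise l) (lift_op (super_fourier\<^sub>0 \<sigma> m n) f)) w"
      using super_fourier_raise[OF _ l s, of p] by (simp add: lookup_lift_op F0 raise_zero lookup_const_mult)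
  qed
  have comm: "letter l * (const c * g) = const c * (letter l * g)" for l g c
    using scalar_letter_commute[of "\<lambda>_. gconst c" l] by (simp add: const_def flip: mult.assoc)
  have "super_fourier \<sigma> m n (dirac_plus_vec m n f) =
    (\<Sum>l\<in>gens m n. lift_op (super_fourier\<^sub>0 \<sigma> m n) (letter l * lift_op (raise l) f))"
    unfolding super_fourier_def dirac_plus_vec_eq
    by (rule lift_op_linear(3)[OF lin_on_fourier]) (intro valued_letter gauss_polys_lin v)
  also have "\<dots> = (\<Sum>l\<in>gens m n. const (\<i> * of_real \<sigma>) * (letter l * lift_op (raise l) (super_fourier \<sigma> m n f)))"
    by (rule sum.cong) (simp_all add: lift_op_letter F0 * comm super_fourier_def)
  finally show ?thesis by (simp add: dirac_plus_vec_eq sum_distrib_left)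
qed

lemma fourier_valued:
  "f \<in> valued (gauss_polys m n) \<Longrightarrow> \<sigma>\<^sup>2 = 1 \<Longrightarrow> super_fourier \<sigma> m n f \<in> valued (gauss_polys m n)"
  by (simp add: valued_def super_fourier_def lookup_lift_op lin_on_zero[OF lin_on_fourier] gauss_polys_fourier)

lemma const_ideal: "f \<in> relation_ideal m n \<Longrightarrow> const c * f \<in> relation_ideal m n"
  unfolding const_def by (rule relation_ideal_scalar)

lemma fourier_iterate:
  assumes s: "\<sigma>\<^sup>2 = 1" and H: "H \<in> superpolys m n" and lap: "cong\<^sub>C m n (laplace m n H) 0"
    and eul: "cong\<^sub>C m n (euler m n H) (of_nat k * H)"
  shows "cong\<^sub>C m n (super_fourier \<sigma> m n ((dirac_plus_vec m n ^^ j) (H * gaussian m n)))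
     (const ((\<i> * of_real \<sigma>) ^ (j + k)) * (dirac_plus_vec m n ^^ j) (H * gaussian m n))"
    and "(dirac_plus_vec m n ^^ j) (H * gaussian m n) \<in> valued (gauss_polys m n)"
proof -
  note V = superpolys_valued[OF H]
  have "cong\<^sub>C m n (super_fourier \<sigma> m n ((dirac_plus_vec m n ^^ j) (H * gaussian m n)))
     (const ((\<i> * of_real \<sigma>) ^ (j + k)) * (dirac_plus_vec m n ^^ j) (H * gaussian m n)) \<and>
     (dirac_plus_vec m n ^^ j) (H * gaussian m n) \<in> valued (gauss_polys m n)"
  proof (induction j)
    case 0
    have "pairing_with \<mu> (super_fourier \<sigma> m n (H * gaussian m n) - const ((\<i> * of_real \<sigma>) ^ k) * (H * gaussian m n)) = 0"
      if "\<mu> \<in> annihilators m n" for \<mu>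
      using super_fourier_hermite[OF s harmonic_hermite[OF H lap eul that]]
      by (simp add: pairing_with_diff pairing_with_const super_fourier_def
        pairing_with_lift_op(1)[OF lin_on_fourier mult_gaussian(1)[OF V(1)]] mult_gaussian(2)[OF V(1)])
    then show ?case
      by (simp add: cong\<^sub>C_def relation_ideal_iff mult_gaussian(1)[OF V(1)])
  next
    case (Suc j)
    let ?f = "(dirac_plus_vec m n ^^ j) (H * gaussian m n)" and ?c = "const ((\<i> * of_real \<sigma>) ^ (j + k))"
    let ?D = "dirac_plus_vec m n" and ?F = "super_fourier \<sigma> m n"
    have f: "?f \<in> valued (gauss_polys m n)" and I: "?F ?f - ?c * ?f \<in> relation_ideal m n"
      using Suc by (auto simp: cong\<^sub>C_def)
    have Ff: "?F ?f \<in> valued (gauss_polys m n)" by (rule fourier_valued[OF f s])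
    have cf: "?c * ?f \<in> valued (gauss_polys m n)" by (rule valued_lin(3)[OF lin_on_fourier f])
    \<comment> \<open>The induction hypothesis may be differentiated because both terms lie in the
      space on which the operator preserves the ideal.\<close>
    have "?D (?F ?f - ?c * ?f) \<in> relation_ideal m n"
      by (rule dirac_plus_vec_ideal[OF valued_lin(2)[OF lin_on_fourier Ff cf] I])
    then have "const (\<i> * of_real \<sigma>) * (?D (?F ?f) - ?c * ?D ?f) \<in> relation_ideal m n"
      by (simp add: dirac_plus_vec_linear(1)[OF Ff cf] dirac_plus_vec_linear(2)[OF f] const_ideal)
    then have "?F (?D ?f) - const ((\<i> * of_real \<sigma>) ^ (Suc j + k)) * ?D ?f \<in> relation_ideal m n"
      by (simp add: fourier_dirac_plus_vec[OF f s] right_diff_distrib const_mult flip: mult.assoc)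
    then show ?case using dirac_plus_vec_valued[OF f] by (simp add: cong\<^sub>C_def)
  qed
  then show "cong\<^sub>C m n (super_fourier \<sigma> m n ((dirac_plus_vec m n ^^ j) (H * gaussian m n)))
     (const ((\<i> * of_real \<sigma>) ^ (j + k)) * (dirac_plus_vec m n ^^ j) (H * gaussian m n))"
    and "(dirac_plus_vec m n ^^ j) (H * gaussian m n) \<in> valued (gauss_polys m n)" by auto
qed

text \<open>The Dirac operator of a monogenic is zero only modulo the ideal, so a second application
  must be shown to stay there; this again follows by absorbing the letters into the
  annihilators.\<close>

lemma monogenics_subset_harmonics: "monogenics m n k \<subseteq> harmonics m n k"
proof
  fix M assume M: "M \<in> monogenics m n k"
  then have P: "M \<in> superpolys m n" and d: "dirac m n M \<in> relation_ideal m n"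
    by (auto simp: monogenics_def cong\<^sub>C_def)
  have "pairing_with \<mu> (dirac m n (dirac m n M)) = 0" if \<mu>: "\<mu> \<in> annihilators m n" for \<mu>
  proof -
    have "pairing_with (\<lambda>w. \<mu> (cons_word l w)) (dirac m n M) = 0" if "l \<in> gens m n" for l
      using annihilators_cons[OF \<mu> that] d by (auto simp: relation_ideal_iff)
    then show ?thesis
      by (simp add: pairing_with_dirac dirac_valued superpolys_valued[OF P] dd_zero)
  qed
  then show "M \<in> harmonics m n k"
    using M by (simp add: monogenics_def harmonics_def cong\<^sub>C_def laplace_def relation_ideal_iff)
qed

lemma fourier_eigenvalue:
  assumes "\<sigma> \<in> {1, -1}"
  shows "exp (of_real \<sigma> * \<i> * of_nat N * (of_real pi / 2)) = (\<i> * of_real \<sigma>) ^ N"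
proof -
  have "exp (of_real \<sigma> * \<i> * (of_real pi / 2)) = \<i> * of_real \<sigma>"
    using assms by (auto simp: exp_eq_polar cis_conv_exp[symmetric] exp_minus)
  then show ?thesis
    by (metis (no_types, lifting) exp_of_nat_mult mult.assoc mult.commute)
qed

theorem mainTheorem1:
  fixes m n j k :: nat and \<sigma> :: real
  assumes "\<sigma> \<in> {1, -1}"
  shows "(\<forall>M\<in>monogenics m n k.
            cong\<^sub>C m n (super_fourier \<sigma> m n (phi_fun m n j M))
              (const (exp (of_real \<sigma> * \<i> * of_nat (j + k) * (of_real pi / 2))) * phi_fun m n j M)) \<and>
         (\<forall>H\<in>harmonics m n k.
            cong\<^sub>C m n (super_fourier \<sigma> m n (psi_fun m n j H))
              (const (exp (of_real \<sigma> * \<i> * of_nat (2 * j + k) * (of_real pi / 2))) * psi_fun m n j H))"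
proof -
  have s: "\<sigma>\<^sup>2 = 1" using assms by auto
  have "cong\<^sub>C m n (super_fourier \<sigma> m n ((dirac_plus_vec m n ^^ i) (H * gaussian m n)))
     (const (exp (of_real \<sigma> * \<i> * of_nat (i + k) * (of_real pi / 2))) * (dirac_plus_vec m n ^^ i) (H * gaussian m n))"
    if "H \<in> harmonics m n k" for H i
    unfolding fourier_eigenvalue[OF assms]
    using that by (intro fourier_iterate[OF s]) (auto simp: harmonics_def)
  then show ?thesis
    using monogenics_subset_harmonics[of m n k] unfolding phi_fun_def psi_fun_def by blast
qed

end
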